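(* Let $\Gamma$ be a positive MOY graph, i.e. $\mathrm{rot}(C)>0$ for every nonempty cycle $C$ of $\Gamma$ (with any fixed total ordering of its vertices). Let $F_\Gamma(q,a,z,Z)=\sum_\gamma\langle\Gamma,\gamma\rangle(q,a)\,z^\gamma Z^\gamma$ (sum over all colorings $\gamma$ of $\Gamma$, monomials in standard order), let $P_\Gamma(q,a,x)=\sum_{C\in\mathcal C(\Gamma)}(a^{-1/2}q^{1/2})^{\mathrm{rot}(C)}x_C$ be the cycle polynomial, and let $(P_\Gamma(q,a,x),q)_\infty=\prod_{k=0}^{\infty}P_\Gamma(q,a,q^{k\,\mathrm{rot}(C)}x_C)$ (ordered product, $k$ increasing from left to right). Then $$F_\Gamma(q,a,z,Z)\;\mu\left((P_\Gamma(q,a^{-1},x),q)_\infty\right)=\mu\left((P_\Gamma(q,a,x),q)_\infty\right),$$ $$F_\Gamma(q,q^2a,z,Z)=\mu\left(P_\Gamma(q^{-1},a,x)\right)\,F_\Gamma(q,a,z,Z)\,\mu\left(P_\Gamma(q,a^{-1},x)\right),$$ where $$(P_\Gamma(q,a,x),q)_\infty\in\mathcal R_-\langle\langle x\rangle\rangle,\qquad \mu\left((P_\Gamma(q,a,x),q)_\infty\right)\in\mathcal R\langle\langle z,Z\rangle\rangle.$$ Here $\mu$ is the algebra homomorphism with $\mu(x_C)=z^CZ^C$, $\mathcal R=\mathbb Z[[q^{1/2}]][a^{-1/2},a^{1/2}]$ and $\mathcal R_-=\mathbb Z[[q^{1/2}]][a^{-1/2}]$.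
   Context: **MOY graphs and colorings.** A MOY graph $\Gamma$ is a planar trivalent graph with oriented edges and no sinks or sources (so each vertex has either one incoming and two outgoing half-edges, or two incoming and one outgoing). Multiple edges, loops, and vertex-free components (oriented circles, each counted as one edge) are allowed. $V(\Gamma)$ and $E(\Gamma)$ are the sets of vertices and edges. A coloring (flow) is a map $\gamma:E(\Gamma)\to\mathbb N=\{0,1,2,\dots\}$ such that at each vertex the sum of the values on the incoming edges equals the sum of the values on the outgoing edges. **Half-edges at a vertex.** At a vertex $v$, let $(v,m)$ be the half-edge that is alone in its direction (the unique incoming or the unique outgoing one), and let $(v,l)$, $(v,r)$ be the other two half-edges, lying respectively on the left and on the right when facing in the direction of the orientation. A vertex-free circle component is regarded as having a single half-edge. **Cycles.** A cycle of $\Gamma$ is a (possibly empty, possibly disconnected) $2$-regular subgraph each of whose components is consistently oriented. $\mathcal C(\Gamma)$ is the set of cycles. The rotation number of a connected cycle is $\mathrm{rot}(C)=1$ if it is oriented counter-clockwise and $-1$ if clockwise; in general $\mathrm{rot}(C)$ is the sum over the connected components of $C$ (so $\mathrm{rot}(\emptyset)=0$). **States.** Let $A_N=\{-\frac{N-1}{2},\dots,\frac{N-3}{2},\frac{N-1}{2}\}$ (an $N$-element set, consecutive elements differing by $1$). A state is a function $\sigma:\mathcal C(\Gamma)\to 2^{A_N}$ (values are subsets of $A_N$) with $\sigma(\emptyset)=\emptyset$ and such that $\sigma(C)\cap\sigma(C')=\emptyset$ whenever two distinct cycles $C$ and $C'$ both contain the same edge. For an edge $e$ or half-edge $h$ put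 $\sigma(e)=\bigcup_{C\ni e}\sigma(C)$, $\sigma(h)=\bigcup_{C\ni h}\sigma(C)$. Let $|\sigma|$ be the flow $|\sigma|(e)=|\sigma(e)|$, and $\mathrm{rot}(\sigma)=\sum_{C}\mathrm{rot}(C)\sum_{x\in\sigma(C)}x$. **MOY evaluation.** For a positive integer $N$ and a coloring $\gamma$, $$\langle\Gamma,\gamma\rangle_N(q)=\sum_{\sigma:\,|\sigma|=\gamma}q^{\mathrm{rot}(\sigma)}\prod_{v\in V(\Gamma)}\mathrm{wt}(v;\sigma),\qquad \mathrm{wt}(v;\sigma)=q^{\frac14(R(v;\sigma)-L(v;\sigma))},$$ where $L(v;\sigma)=|\{(a,b)\in\sigma(v,l)\times\sigma(v,r): a>b\}|$ and $R(v;\sigma)=|\{(a,b)\in\sigma(v,l)\times\sigma(v,r): a<b\}|$. **HOMFLY evaluation (known fact).** For each colored MOY graph $(\Gamma,\gamma)$ there exists $\langle\Gamma,\gamma\rangle(q,a)\in\mathbb Q(q^{1/2},a^{1/2})$ with $\langle\Gamma,\gamma\rangle(q,q^N)=\langle\Gamma,\gamma\rangle_N(q)$ for every positive integer $N$. When $\Gamma$ is positive, $F_\Gamma(q,a,z,Z)\in\mathcal R\langle\langle z,Z\rangle\rangle$. **Half-edge variables.** To each vertex $v$ assign six variables, ordered $z_{v,l}<z_{v,m}<z_{v,r}<Z_{v,r}<Z_{v,m}<Z_{v,l}$. To the half-edge of each vertex-free circle component assign two commuting variables $z,Z$. All variables commute except that $$z_{v,r}z_{v,l}=q^{-1/4}z_{v,l}z_{v,r},\qquad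 Z_{v,r}Z_{v,l}=q^{-1/4}Z_{v,l}Z_{v,r}\qquad(v\in V(\Gamma)).$$ A total order on $V(\Gamma)$ is fixed, and all variables at $v$ precede all variables at $w$ if $v<w$; this gives a total order of the variables. $\mathcal R\langle\langle z,Z\rangle\rangle$ denotes formal power series in these $q$-commuting variables with coefficients in $\mathcal R$. For a coloring $\gamma$, and a half-edge $h$ of an edge $e$, put $\gamma(h)=\gamma(e)$; $z^\gamma Z^\gamma$ denotes the monomial $\prod_h z_h^{\gamma(h)}\prod_h Z_h^{\gamma(h)}$ written in the standard (increasing) order. For a cycle $C$, $z^CZ^C$ is this monomial for the indicator function of $C$. **Cycle variables.** The variables $x_C$, $C\in\mathcal C(\Gamma)$, with $x_\emptyset=1$, satisfy $x_Cx_{C'}=q^{\langle C,C'\rangle}x_{C'}x_C$, where $$\langle C,C'\rangle=\tfrac12\left(\#\{v\in V(\Gamma): (v,l)\in C,(v,r)\in C'\}-\#\{v\in V(\Gamma):(v,r)\in C,(v,l)\in C'\}\right).$$ $\mathcal R_-\langle\langle x\rangle\rangle$ denotes formal power series in these $q$-commuting variables with coefficients in $\mathcal R_-$. There is a well-defined monomial homomorphism $\mu$, linear over the coefficients, with $\mu(x_C)=z^CZ^C$ and $\mu(x_Cx_{C'})=\mu(x_C)\mu(x_{C'})$. **Substitutions.** $P_\Gamma(q,a,q^{k\,\mathrm{rot}(C)}x_C)$ means each $x_C$ in $P_\Gamma(q,a,x)$ is replaced by $q^{k\,\mathrm{rot}(C)}x_C$. Substitutions for $q$ and $a$ act on the displayed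 coefficients, not on the commutation relations: $P_\Gamma(q,a^{-1},x)=\sum_C(a^{1/2}q^{1/2})^{\mathrm{rot}(C)}x_C$, $P_\Gamma(q^{-1},a,x)=\sum_C(a^{-1/2}q^{-1/2})^{\mathrm{rot}(C)}x_C$, $(P_\Gamma(q,a^{-1},x),q)_\infty$ is obtained from $(P_\Gamma(q,a,x),q)_\infty$ by $a^{1/2}\mapsto a^{-1/2}$, and $F_\Gamma(q,q^2a,z,Z)$ is obtained from $F_\Gamma(q,a,z,Z)$ by $a\mapsto q^2a$ in the coefficients.
   Formalization: States need σ(C)∩σ(C')=∅ for all distinct cycles, not only those sharing an edge (otherwise disjoint cycles are overcounted); series over R or R_- are sums of words with coefficients there modulo the commutation relations, as standard-monomial coefficients can have negative powers of q. *)

theory Defs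
  imports
    "HOL-Complex_Analysis.Winding_Numbers"
    "HOL-Computational_Algebra.Formal_Laurent_Series"
    "HOL-Computational_Algebra.Fraction_Field"
    "HOL-Library.Poly_Mapping"
    "HOL-Library.Multiset"
begin

section \<open>MOY graphs\<close>

text \<open>
  A graph is drawn in the complex plane: vertices are points, the edge \<open>e\<close> is the path
  \<open>curve \<Gamma> e\<close>, oriented by its parametrisation.  An edge whose end points are not vertices
  is a vertex-free circle.
\<close>

record 'e moy_graph =
  verts :: "complex set"
  edges :: "'e set"
  curve :: "'e \<Rightarrow> real \<Rightarrow> complex"

datatype 'e half_edge = Initial 'e | Terminal 'e | Circle 'e

fun base_edge :: "'e half_edge \<Rightarrow> 'e" where
  "base_edge (Initial e) = e"
| "base_edge (Terminal e) = e"
| "base_edge (Circle e) = e"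

definition circles :: "'e moy_graph \<Rightarrow> 'e set" where
  "circles \<Gamma> = {e \<in> edges \<Gamma>. pathstart (curve \<Gamma> e) \<notin> verts \<Gamma>}"

definition half_edges :: "'e moy_graph \<Rightarrow> 'e half_edge set" where
  "half_edges \<Gamma> = Initial ` (edges \<Gamma> - circles \<Gamma>) \<union> Terminal ` (edges \<Gamma> - circles \<Gamma>)
     \<union> Circle ` circles \<Gamma>"

definition out_edges :: "'e moy_graph \<Rightarrow> complex \<Rightarrow> 'e set" where
  "out_edges \<Gamma> v = {e \<in> edges \<Gamma>. pathstart (curve \<Gamma> e) = v}"

definition in_edges :: "'e moy_graph \<Rightarrow> complex \<Rightarrow> 'e set" where
  "in_edges \<Gamma> v = {e \<in> edges \<Gamma>. pathfinish (curve \<Gamma> e) = v}"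

fun germ :: "'e moy_graph \<Rightarrow> 'e half_edge \<Rightarrow> real \<Rightarrow> complex" where
  "germ \<Gamma> (Initial e) = curve \<Gamma> e"
| "germ \<Gamma> (Terminal e) = reversepath (curve \<Gamma> e)"
| "germ \<Gamma> (Circle e) = curve \<Gamma> e"

definition first_hit :: "(real \<Rightarrow> complex) \<Rightarrow> real \<Rightarrow> complex" where
  "first_hit g \<epsilon> = g (Inf {t \<in> {0..1}. dist (g 0) (g t) = \<epsilon>})"

text \<open>
  Counter-clockwise cyclic order of three half-edges around \<open>v\<close>: no tangent directions are
  needed, one looks at the points where the half-edges first meet a small circle around \<open>v\<close>.
\<close>

definition ccw_at :: "'e moy_graph \<Rightarrow> complex \<Rightarrow> 'e half_edge \<Rightarrow> 'e half_edge \<Rightarrow> 'e half_edge \<Rightarrow> bool" where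
  "ccw_at \<Gamma> v h1 h2 h3 \<longleftrightarrow> (\<forall>\<^sub>F \<epsilon> in at_right 0.
     let d = (\<lambda>h. first_hit (germ \<Gamma> h) \<epsilon> - v)
     in 0 < Arg2pi (d h2 / d h1) \<and> Arg2pi (d h2 / d h1) < Arg2pi (d h3 / d h1))"

text \<open>
  Facing the direction of the orientation, a unique incoming half-edge arrives from behind and
  the other two leave ahead, so that the counter-clockwise order is middle, right, left; at a
  vertex with a unique outgoing half-edge it is middle, left, right.
\<close>

definition vertex_config ::
  "'e moy_graph \<Rightarrow> complex \<Rightarrow> 'e half_edge \<times> 'e half_edge \<times> 'e half_edge \<Rightarrow> bool" where
  "vertex_config \<Gamma> v = (\<lambda>(l, m, r). l \<noteq> r \<and>
     (Terminal ` in_edges \<Gamma> v = {m} \<and> Initial ` out_edges \<Gamma> v = {l, r} \<and> ccw_at \<Gamma> v m r l \<or>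
      Initial ` out_edges \<Gamma> v = {m} \<and> Terminal ` in_edges \<Gamma> v = {l, r} \<and> ccw_at \<Gamma> v m l r))"

definition lft :: "'e moy_graph \<Rightarrow> complex \<Rightarrow> 'e half_edge" where
  "lft \<Gamma> v = fst (THE c. vertex_config \<Gamma> v c)"

definition mid :: "'e moy_graph \<Rightarrow> complex \<Rightarrow> 'e half_edge" where
  "mid \<Gamma> v = fst (snd (THE c. vertex_config \<Gamma> v c))"

definition rgt :: "'e moy_graph \<Rightarrow> complex \<Rightarrow> 'e half_edge" where
  "rgt \<Gamma> v = snd (snd (THE c. vertex_config \<Gamma> v c))"

text \<open>The existence of a configuration at every vertex includes trivalence and the absence of
  sinks and sources.\<close>

definition moy_graph :: "'e moy_graph \<Rightarrow> bool" where
  "moy_graph \<Gamma> \<longleftrightarrow>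
     finite (verts \<Gamma>) \<and> finite (edges \<Gamma>) \<and>
     (\<forall>e \<in> edges \<Gamma>. simple_path (curve \<Gamma> e) \<and>
        curve \<Gamma> e ` {0<..<1} \<inter> verts \<Gamma> = {} \<and>
        (pathstart (curve \<Gamma> e) \<in> verts \<Gamma> \<and> pathfinish (curve \<Gamma> e) \<in> verts \<Gamma> \<or>
         pathstart (curve \<Gamma> e) \<notin> verts \<Gamma> \<and> pathfinish (curve \<Gamma> e) = pathstart (curve \<Gamma> e))) \<and>
     (\<forall>e \<in> edges \<Gamma>. \<forall>f \<in> edges \<Gamma>. e \<noteq> f \<longrightarrow>
        path_image (curve \<Gamma> e) \<inter> path_image (curve \<Gamma> f) \<subseteq> verts \<Gamma>) \<and>
     (\<forall>v \<in> verts \<Gamma>. \<exists>c. vertex_config \<Gamma> v c)"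

lemma ccw_at_asym: "ccw_at \<Gamma> v h1 h2 h3 \<Longrightarrow> ccw_at \<Gamma> v h1 h3 h2 \<Longrightarrow> False"
proof -
  assume a: "ccw_at \<Gamma> v h1 h2 h3" and b: "ccw_at \<Gamma> v h1 h3 h2"
  have "\<forall>\<^sub>F \<epsilon> in at_right (0::real). False"
    using a[unfolded ccw_at_def Let_def] b[unfolded ccw_at_def Let_def]
    by eventually_elim linarith
  then show False by (simp add: eventually_False)
qed

lemma vertex_config_unique:
  assumes "vertex_config \<Gamma> v c" "vertex_config \<Gamma> v d"
  shows "c = d"
proof -
  obtain l m r where c: "c = (l, m, r)" by (metis prod.exhaust)
  obtain l' m' r' where d: "d = (l', m', r')" by (metis prod.exhaust)
  show ?thesis
    using assms ccw_at_asym[of \<Gamma> v m l r] ccw_at_asym[of \<Gamma> v m r l]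
    unfolding c d vertex_config_def by (auto simp: doubleton_eq_iff)
qed

text \<open>A coloring is normalised to vanish outside the edges.\<close>

definition coloring :: "'e moy_graph \<Rightarrow> ('e \<Rightarrow> nat) \<Rightarrow> bool" where
  "coloring \<Gamma> \<gamma> \<longleftrightarrow> (\<forall>e. e \<notin> edges \<Gamma> \<longrightarrow> \<gamma> e = 0) \<and>
     (\<forall>v \<in> verts \<Gamma>. (\<Sum>e \<in> in_edges \<Gamma> v. \<gamma> e) = (\<Sum>e \<in> out_edges \<Gamma> v. \<gamma> e))"


section \<open>Cycles and rotation numbers\<close>

text \<open>A 2-regular subgraph has no isolated vertices, so it is given by its set of edges.\<close>

definition cycles :: "'e moy_graph \<Rightarrow> 'e set set" where
  "cycles \<Gamma> = {C. C \<subseteq> edges \<Gamma> \<and> (\<forall>v \<in> verts \<Gamma>.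
     card (C \<inter> in_edges \<Gamma> v) + card (C \<inter> out_edges \<Gamma> v) \<in> {0, 2} \<and>
     card (C \<inter> in_edges \<Gamma> v) = card (C \<inter> out_edges \<Gamma> v))}"

definition cycle_support :: "'e moy_graph \<Rightarrow> 'e set \<Rightarrow> complex set" where
  "cycle_support \<Gamma> C = (\<Union>e \<in> C. path_image (curve \<Gamma> e))"

definition connected_cycles :: "'e moy_graph \<Rightarrow> 'e set set" where
  "connected_cycles \<Gamma> = {C \<in> cycles \<Gamma>. C \<noteq> {} \<and> connected (cycle_support \<Gamma> C)}"

text \<open>
  The winding number of the closed curve traversing a connected cycle is the sum of the
  contributions of its edges (cf. \<open>winding_number_join\<close>); the cycle is counter-clockwise
  if this is 1 around the points it encloses.
\<close>

definition counterclockwise :: "'e moy_graph \<Rightarrow> 'e set \<Rightarrow> bool" where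
  "counterclockwise \<Gamma> C \<longleftrightarrow>
     (\<forall>z \<in> inside (cycle_support \<Gamma> C). (\<Sum>e \<in> C. winding_number (curve \<Gamma> e) z) = 1)"

text \<open>The connected components of a cycle are exactly the connected cycles contained in it.\<close>

definition rot :: "'e moy_graph \<Rightarrow> 'e set \<Rightarrow> int" where
  "rot \<Gamma> C = (\<Sum>D | D \<in> connected_cycles \<Gamma> \<and> D \<subseteq> C. if counterclockwise \<Gamma> D then 1 else -1)"

definition positive_moy :: "'e moy_graph \<Rightarrow> bool" where
  "positive_moy \<Gamma> \<longleftrightarrow> (\<forall>C \<in> cycles \<Gamma>. C \<noteq> {} \<longrightarrow> rot \<Gamma> C > 0)"


section \<open>Coefficients\<close>

text \<open>
  The indeterminate of \<^typ>\<open>int fls\<close> is the fourth root of \<open>q\<close>, and \<open>single j c\<close> in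
  \<open>laurent\<close> is \<open>c a\<^bsup>j/2\<^esup>\<close>; so \<open>laurent\<close> is the ring of Laurent polynomials in
  \<open>a\<^bsup>1/2\<^esup>\<close> over the Laurent series in \<open>q\<^bsup>1/4\<^esup>\<close>.
\<close>

type_synonym laurent = "int \<Rightarrow>\<^sub>0 int fls"

text \<open>\<open>q\<^bsup>r\<^esup>\<close>, only used if \<open>4 r\<close> is an integer.\<close>

definition qpow :: "rat \<Rightarrow> int fls" where
  "qpow r = fls_X_intpow \<lfloor>4 * r\<rfloor>"

text \<open>\<open>aq j r\<close> is \<open>a\<^bsup>j/2\<^esup> q\<^bsup>r\<^esup>\<close>.\<close>

definition aq :: "int \<Rightarrow> rat \<Rightarrow> laurent" where
  "aq j r = Poly_Mapping.single j (qpow r)"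

text \<open>The rings \<open>\<int>[[q\<^bsup>1/2\<^esup>]][a\<^bsup>-1/2\<^esup>, a\<^bsup>1/2\<^esup>]\<close> and \<open>\<int>[[q\<^bsup>1/2\<^esup>]][a\<^bsup>-1/2\<^esup>]\<close>.\<close>

definition Rcoeff :: "laurent set" where
  "Rcoeff = {k. \<forall>j i. fls_nth (Poly_Mapping.lookup k j) i \<noteq> 0 \<longrightarrow> 0 \<le> i \<and> even i}"

definition Rminus :: "laurent set" where
  "Rminus = {k \<in> Rcoeff. \<forall>j. Poly_Mapping.lookup k j \<noteq> 0 \<longrightarrow> j \<le> 0}"

text \<open>The substitution \<open>a \<mapsto> q\<^sup>2 a\<close>.\<close>

definition shift_a :: "laurent \<Rightarrow> laurent" where
  "shift_a k = Poly_Mapping.mapp (\<lambda>j c. qpow (of_int j) * c) k"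


section \<open>MOY and HOMFLY evaluations\<close>

definition A_set :: "nat \<Rightarrow> rat set" where
  "A_set N = (\<lambda>i. of_nat i - (of_nat N - 1) / 2) ` {..<N}"

text \<open>
  Every color lies in \<open>\<sigma>(C)\<close> for at most one cycle \<open>C\<close>, also when the cycles involved have no
  common edge: disjoint cycles of the same color are recorded by their union, which is again a
  cycle.  (Otherwise the same distribution of colors on the edges would be counted repeatedly.)
\<close>

definition states :: "'e moy_graph \<Rightarrow> nat \<Rightarrow> ('e set \<Rightarrow> rat set) set" where
  "states \<Gamma> N = {\<sigma>. (\<forall>C. \<sigma> C \<subseteq> A_set N) \<and> (\<forall>C. C \<notin> cycles \<Gamma> \<longrightarrow> \<sigma> C = {}) \<and> \<sigma> {} = {} \<and>
     (\<forall>C \<in> cycles \<Gamma>. \<forall>C' \<in> cycles \<Gamma>. C \<noteq> C' \<longrightarrow> \<sigma> C \<inter> \<sigma> C' = {})}"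

definition edge_colors :: "'e moy_graph \<Rightarrow> ('e set \<Rightarrow> rat set) \<Rightarrow> 'e \<Rightarrow> rat set" where
  "edge_colors \<Gamma> \<sigma> e = (\<Union>C \<in> {C \<in> cycles \<Gamma>. e \<in> C}. \<sigma> C)"

definition half_colors :: "'e moy_graph \<Rightarrow> ('e set \<Rightarrow> rat set) \<Rightarrow> 'e half_edge \<Rightarrow> rat set" where
  "half_colors \<Gamma> \<sigma> h = edge_colors \<Gamma> \<sigma> (base_edge h)"

definition rot_state :: "'e moy_graph \<Rightarrow> ('e set \<Rightarrow> rat set) \<Rightarrow> rat" where
  "rot_state \<Gamma> \<sigma> = (\<Sum>C \<in> cycles \<Gamma>. of_int (rot \<Gamma> C) * (\<Sum>x \<in> \<sigma> C. x))"

definition L_count :: "'e moy_graph \<Rightarrow> complex \<Rightarrow> ('e set \<Rightarrow> rat set) \<Rightarrow> nat" where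
  "L_count \<Gamma> v \<sigma> =
     card {(a, b). a \<in> half_colors \<Gamma> \<sigma> (lft \<Gamma> v) \<and> b \<in> half_colors \<Gamma> \<sigma> (rgt \<Gamma> v) \<and> a > b}"

definition R_count :: "'e moy_graph \<Rightarrow> complex \<Rightarrow> ('e set \<Rightarrow> rat set) \<Rightarrow> nat" where
  "R_count \<Gamma> v \<sigma> =
     card {(a, b). a \<in> half_colors \<Gamma> \<sigma> (lft \<Gamma> v) \<and> b \<in> half_colors \<Gamma> \<sigma> (rgt \<Gamma> v) \<and> a < b}"

definition wt :: "'e moy_graph \<Rightarrow> complex \<Rightarrow> ('e set \<Rightarrow> rat set) \<Rightarrow> int fls" where
  "wt \<Gamma> v \<sigma> = qpow ((of_nat (R_count \<Gamma> v \<sigma>) - of_nat (L_count \<Gamma> v \<sigma>)) / 4)"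

definition moy_eval :: "'e moy_graph \<Rightarrow> nat \<Rightarrow> ('e \<Rightarrow> nat) \<Rightarrow> int fls" where
  "moy_eval \<Gamma> N \<gamma> =
     (\<Sum>\<sigma> | \<sigma> \<in> states \<Gamma> N \<and> (\<forall>e \<in> edges \<Gamma>. card (edge_colors \<Gamma> \<sigma> e) = \<gamma> e).
        qpow (rot_state \<Gamma> \<sigma>) * (\<Prod>v \<in> verts \<Gamma>. wt \<Gamma> v \<sigma>))"

text \<open>
  The field \<open>\<rat>(q\<^bsup>1/2\<^esup>, a\<^bsup>1/2\<^esup>)\<close> is the type \<^typ>\<open>int poly poly fract\<close>; the variable of the
  inner polynomials is \<open>q\<^bsup>1/2\<^esup>\<close>, that of the outer ones is \<open>a\<^bsup>1/2\<^esup>\<close>.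
\<close>

definition q_embed :: "int poly \<Rightarrow> int fls" where
  "q_embed p = poly (map_poly of_int p) (qpow (1/2))"

definition at_qN :: "nat \<Rightarrow> int poly poly \<Rightarrow> int fls" where
  "at_qN N p = poly (map_poly q_embed p) (qpow (of_nat N / 2))"

definition aq_embed :: "int poly poly \<Rightarrow> laurent" where
  "aq_embed p = poly (map_poly (\<lambda>c. Poly_Mapping.single 0 (q_embed c)) p) (aq 1 0)"

definition homfly :: "'e moy_graph \<Rightarrow> ('e \<Rightarrow> nat) \<Rightarrow> int poly poly fract" where
  "homfly \<Gamma> \<gamma> = (THE h. \<forall>N \<ge> 1. \<exists>p r. h = Fract p r \<and> at_qN N r \<noteq> 0 \<and>
     at_qN N p = moy_eval \<Gamma> N \<gamma> * at_qN N r)"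

text \<open>A rational function \<open>p / r\<close> regarded as the element \<open>k\<close> of \<open>laurent\<close> with \<open>k r = p\<close>.\<close>

definition fract_to_laurent :: "int poly poly fract \<Rightarrow> laurent" where
  "fract_to_laurent h =
     (THE k. \<exists>p r. r \<noteq> 0 \<and> h = Fract p r \<and> k * aq_embed r = aq_embed p)"


section \<open>Power series in q-commuting variables\<close>

text \<open>
  The variables, in increasing order, and the exponents in the commutation relations
  \<open>x y = q\<^bsup>qexp x y\<^esup> y x\<close>.
\<close>

record 'x qvars =
  vars :: "'x list"
  qexp :: "'x \<Rightarrow> 'x \<Rightarrow> rat"

text \<open>A series is given by its coefficients with respect to the standard (increasing) monomials.\<close>

type_synonym 'x qseries = "'x multiset \<Rightarrow> laurent"

definition before :: "'x list \<Rightarrow> 'x \<Rightarrow> 'x \<Rightarrow> bool" where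
  "before xs x y \<longleftrightarrow> (\<exists>us ws. xs = us @ x # ws \<and> y \<in> set ws)"

definition std_word :: "'x qvars \<Rightarrow> 'x multiset \<Rightarrow> 'x list" where
  "std_word X m = concat (map (\<lambda>x. replicate (count m x) x) (vars X))"

text \<open>
  The product of the letters of a word \<open>w\<close> is \<open>q\<^bsup>reorder X w\<^esup>\<close> times the standard monomial
  with the same letters: each pair of letters in decreasing order has to be interchanged.
\<close>

definition reorder :: "'x qvars \<Rightarrow> 'x list \<Rightarrow> rat" where
  "reorder X w = (\<Sum>(i, j) | i < j \<and> j < length w \<and> before (vars X) (w ! j) (w ! i).
     qexp X (w ! i) (w ! j))"

definition qmult :: "'x qvars \<Rightarrow> 'x qseries \<Rightarrow> 'x qseries \<Rightarrow> 'x qseries" where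
  "qmult X f g = (\<lambda>m. \<Sum>a | a \<subseteq># m.
     f a * g (m - a) * aq 0 (reorder X (std_word X a @ std_word X (m - a))))"

definition qmono :: "'x multiset \<Rightarrow> 'x qseries" where
  "qmono a = (\<lambda>m. if m = a then 1 else 0)"

definition qseries_tendsto :: "(nat \<Rightarrow> 'x qseries) \<Rightarrow> 'x qseries \<Rightarrow> bool" where
  "qseries_tendsto F f \<longleftrightarrow>
     (\<forall>m j. (\<lambda>n. Poly_Mapping.lookup (F n m) j) \<longlonglongrightarrow> Poly_Mapping.lookup (f m) j)"

text \<open>
  \<open>S\<langle>\<langle>x\<rangle>\<rangle>\<close>: formal sums of words in the variables with coefficients in \<open>S\<close>, modulo the commutation
  relations.  The coefficients with respect to standard monomials need not lie in \<open>S\<close> again, since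
  the commutation relations involve negative powers of \<open>q\<close>; they must however not involve the
  odd powers of \<open>q\<^bsup>1/4\<^esup>\<close>.
\<close>

definition qseries_over :: "laurent set \<Rightarrow> 'x qvars \<Rightarrow> 'x qseries set" where
  "qseries_over S X = {f.
     (\<exists>c. (\<forall>w. c w \<in> S) \<and>
       (\<forall>m. f m = (\<Sum>w | set w \<subseteq> set (vars X) \<and> mset w = m. c w * aq 0 (reorder X w)))) \<and>
     (\<forall>m j i. odd i \<longrightarrow> fls_nth (Poly_Mapping.lookup (f m) j) i = 0)}"

lemma finite_submultisets: "finite {c. c \<subseteq># m}"
proof (induction m)
  case (add x m)
  have "{c. c \<subseteq># add_mset x m} \<subseteq> {c. c \<subseteq># m} \<union> add_mset x ` {c. c \<subseteq># m}"
  proof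
    fix c assume c: "c \<in> {c. c \<subseteq># add_mset x m}"
    show "c \<in> {c. c \<subseteq># m} \<union> add_mset x ` {c. c \<subseteq># m}"
    proof (cases "x \<in># c")
      case True
      then obtain d where d: "c = add_mset x d" by (metis insert_DiffM)
      then show ?thesis using c by auto
    next
      case False
      then have "c \<subseteq># m" using c
        by (metis (mono_tags, lifting) add_mset_remove_trivial diff_single_trivial mem_Collect_eq
            subset_eq_diff_conv add_mset_add_single)
      then show ?thesis by simp
    qed
  qed
  then show ?case using add by (meson finite_UnI finite_imageI finite_subset)
qed simp

lemma qmult_qmono:
  "qmult X (qmono a) (qmono b) =
     (\<lambda>m. aq 0 (reorder X (std_word X a @ std_word X b)) * qmono (a + b) m)"
proof
  fix m
  let ?k = "aq 0 (reorder X (std_word X a @ std_word X b))"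
  have "qmult X (qmono a) (qmono b) m =
      (\<Sum>c | c \<subseteq># m. if c = a then (if m = a + b then ?k else 0) else 0)"
    unfolding qmult_def qmono_def
    by (intro sum.cong) (auto simp: subset_mset.le_iff_add)
  also have "\<dots> = ?k * qmono (a + b) m"
    using finite_submultisets[of m] by (auto simp: qmono_def)
  finally show "qmult X (qmono a) (qmono b) m = ?k * qmono (a + b) m" .
qed

lemma before_total:
  assumes "distinct xs" "x \<in> set xs" "y \<in> set xs" "x \<noteq> y"
  shows "before xs x y \<noteq> before xs y x"
  using assms
proof (induction xs)
  case (Cons z zs)
  have *: "before (z # zs) u w \<longleftrightarrow> u = z \<and> w \<in> set zs \<or> before zs u w" for u w
    unfolding before_def by (auto simp: Cons_eq_append_conv)
  have **: "before zs u w \<Longrightarrow> u \<in> set zs \<and> w \<in> set zs" for u w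
    unfolding before_def by auto
  show ?case using Cons * ** by auto
qed simp

lemma std_word_single:
  assumes "distinct (vars X)" "x \<in> set (vars X)"
  shows "std_word X {#x#} = [x]"
proof -
  obtain us ws where s: "vars X = us @ x # ws" by (meson assms(2) split_list)
  have e: "concat (map (\<lambda>y. replicate (count {#x#} y) y) us') = []" if "x \<notin> set us'" for us'
    using that by (induction us') auto
  have "x \<notin> set us" "x \<notin> set ws" using assms(1) by (auto simp: s)
  then show ?thesis using e[of us] e[of ws]
    unfolding std_word_def s map_append concat_append by (simp del: concat_eq_Nil_conv)
qed

lemma aq_mult: "aq 0 r * aq 0 s = aq 0 (r + s)" if "4 * r \<in> \<int>" "4 * s \<in> \<int>"
proof -
  have "\<lfloor>4 * r\<rfloor> + \<lfloor>4 * s\<rfloor> = \<lfloor>4 * (r + s)\<rfloor>"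
    using that by (auto elim!: Ints_cases simp: algebra_simps)
  then show ?thesis
    by (simp add: aq_def qpow_def mult_single fls_X_intpow_times_fls_X_intpow del: fls_X_intpow_times_conv_shift)
qed

text \<open>The commutation relations hold in this model.\<close>

lemma qmult_commutation:
  assumes "distinct (vars X)" "x \<in> set (vars X)" "y \<in> set (vars X)"
    and "qexp X x x = 0" "qexp X y x = - qexp X x y" "4 * qexp X x y \<in> \<int>"
  shows "qmult X (qmono {#x#}) (qmono {#y#}) =
    (\<lambda>m. aq 0 (qexp X x y) * qmult X (qmono {#y#}) (qmono {#x#}) m)"
proof -
  have r: "reorder X [u, w] = (if before (vars X) w u then qexp X u w else 0)" for u w
  proof -
    have "{(i, j). i < j \<and> j < length [u, w] \<and> before (vars X) ([u, w] ! j) ([u, w] ! i)} =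
      (if before (vars X) w u then {(0, 1)} else {})"
      by (auto simp: less_Suc_eq)
    then show ?thesis unfolding reorder_def by simp
  qed
  have n: "4 * (- qexp X x y) \<in> \<int>" using assms(6) by simp
  have "aq 0 (qexp X x y) * aq 0 (- qexp X x y) = aq 0 0"
    using aq_mult[OF assms(6) n] by simp
  moreover have "aq 0 0 = 1" by (simp add: aq_def qpow_def)
  ultimately show ?thesis
    using assms before_total[OF assms(1-3)]
    by (cases "x = y")
      (auto simp: qmult_qmono std_word_single r add_mset_commute mult.assoc[symmetric])
qed


section \<open>Half-edge variables\<close>

text \<open>\<open>Lower h\<close> is \<open>z\<^sub>h\<close> and \<open>Upper h\<close> is \<open>Z\<^sub>h\<close>.\<close>

datatype 'h zvar = Lower 'h | Upper 'h

text \<open>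
  The list \<open>vs\<close> enumerates the vertices and \<open>fs\<close> the vertex-free circles, whose variables are
  central and are put at the end.
\<close>

definition zvars :: "'e moy_graph \<Rightarrow> complex list \<Rightarrow> 'e list \<Rightarrow> 'e half_edge zvar qvars" where
  "zvars \<Gamma> vs fs = \<lparr>
     vars = concat (map (\<lambda>v. [Lower (lft \<Gamma> v), Lower (mid \<Gamma> v), Lower (rgt \<Gamma> v),
                              Upper (rgt \<Gamma> v), Upper (mid \<Gamma> v), Upper (lft \<Gamma> v)]) vs)
            @ concat (map (\<lambda>e. [Lower (Circle e), Upper (Circle e)]) fs),
     qexp = (\<lambda>x y.
       if \<exists>v \<in> verts \<Gamma>. (x, y) = (Lower (rgt \<Gamma> v), Lower (lft \<Gamma> v)) \<or>
                          (x, y) = (Upper (rgt \<Gamma> v), Upper (lft \<Gamma> v)) then -1/4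
       else if \<exists>v \<in> verts \<Gamma>. (x, y) = (Lower (lft \<Gamma> v), Lower (rgt \<Gamma> v)) \<or>
                               (x, y) = (Upper (lft \<Gamma> v), Upper (rgt \<Gamma> v)) then 1/4
       else 0) \<rparr>"

text \<open>The exponent of \<open>z\<^sup>\<gamma> Z\<^sup>\<gamma>\<close>.\<close>

definition zexponent :: "'e moy_graph \<Rightarrow> ('e \<Rightarrow> nat) \<Rightarrow> 'e half_edge zvar multiset" where
  "zexponent \<Gamma> \<gamma> = (\<Sum>h \<in> half_edges \<Gamma>. repeat_mset (\<gamma> (base_edge h)) {#Lower h, Upper h#})"

definition F_series :: "'e moy_graph \<Rightarrow> 'e half_edge zvar qseries" where
  "F_series \<Gamma> = (\<lambda>m. \<Sum>\<gamma> | coloring \<Gamma> \<gamma> \<and> zexponent \<Gamma> \<gamma> = m. fract_to_laurent (homfly \<Gamma> \<gamma>))"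


section \<open>Cycle variables\<close>

definition cycle_pairing :: "'e moy_graph \<Rightarrow> 'e set \<Rightarrow> 'e set \<Rightarrow> rat" where
  "cycle_pairing \<Gamma> C C' =
     (of_nat (card {v \<in> verts \<Gamma>. base_edge (lft \<Gamma> v) \<in> C \<and> base_edge (rgt \<Gamma> v) \<in> C'}) -
      of_nat (card {v \<in> verts \<Gamma>. base_edge (rgt \<Gamma> v) \<in> C \<and> base_edge (lft \<Gamma> v) \<in> C'})) / 2"

text \<open>
  The list \<open>cs\<close> enumerates the nonempty cycles; its order only serves to choose the standard
  monomials in the variables \<open>x\<^sub>C\<close>.
\<close>

definition xvars :: "'e moy_graph \<Rightarrow> 'e set list \<Rightarrow> 'e set qvars" where
  "xvars \<Gamma> cs = \<lparr> vars = cs, qexp = cycle_pairing \<Gamma> \<rparr>"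

definition xexponent :: "'e set \<Rightarrow> 'e set multiset" where
  "xexponent C = (if C = {} then {#} else {#C#})"

text \<open>The homomorphism \<open>\<mu>\<close>, first on standard monomials, then extended by (infinite) linearity.\<close>

definition mu_mono ::
  "'e moy_graph \<Rightarrow> complex list \<Rightarrow> 'e list \<Rightarrow> 'e set list \<Rightarrow> 'e set multiset \<Rightarrow> 'e half_edge zvar qseries" where
  "mu_mono \<Gamma> vs fs cs m =
     foldr (\<lambda>C g. qmult (zvars \<Gamma> vs fs) (qmono (zexponent \<Gamma> (indicator C))) g)
       (std_word (xvars \<Gamma> cs) m) (qmono {#})"

definition mu ::
  "'e moy_graph \<Rightarrow> complex list \<Rightarrow> 'e list \<Rightarrow> 'e set list \<Rightarrow> 'e set qseries \<Rightarrow> 'e half_edge zvar qseries" where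
  "mu \<Gamma> vs fs cs f = (\<lambda>n. \<Sum>m | set_mset m \<subseteq> set cs \<and> mu_mono \<Gamma> vs fs cs m n \<noteq> 0.
     f m * mu_mono \<Gamma> vs fs cs m n)"

text \<open>\<open>cycle_poly \<Gamma> \<epsilon> \<delta>\<close> is \<open>P\<^sub>\<Gamma>(q\<^sup>\<epsilon>, a\<^sup>\<delta>, x)\<close>, i.e. the sum of the \<open>(a\<^bsup>-\<delta>/2\<^esup> q\<^bsup>\<epsilon>/2\<^esup>)\<^bsup>rot(C)\<^esup> x\<^sub>C\<close>.\<close>

definition cycle_poly :: "'e moy_graph \<Rightarrow> int \<Rightarrow> int \<Rightarrow> 'e set qseries" where
  "cycle_poly \<Gamma> \<epsilon> \<delta> = (\<lambda>m. \<Sum>C \<in> cycles \<Gamma>.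
     aq (- \<delta> * rot \<Gamma> C) (of_int (\<epsilon> * rot \<Gamma> C) / 2) * qmono (xexponent C) m)"

text \<open>The substitution of \<open>q\<^bsup>k rot(C)\<^esup> x\<^sub>C\<close> for \<open>x\<^sub>C\<close>.\<close>

definition rescale :: "'e moy_graph \<Rightarrow> nat \<Rightarrow> 'e set qseries \<Rightarrow> 'e set qseries" where
  "rescale \<Gamma> k f = (\<lambda>m. f m * aq 0 (of_int (int k * (\<Sum>C \<in># m. rot \<Gamma> C))))"

primrec partial_qpoch :: "'e moy_graph \<Rightarrow> 'e set list \<Rightarrow> 'e set qseries \<Rightarrow> nat \<Rightarrow> 'e set qseries" where
  "partial_qpoch \<Gamma> cs P 0 = qmono {#}"
| "partial_qpoch \<Gamma> cs P (Suc n) = qmult (xvars \<Gamma> cs) (partial_qpoch \<Gamma> cs P n) (rescale \<Gamma> n P)"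

definition qpoch :: "'e moy_graph \<Rightarrow> 'e set list \<Rightarrow> 'e set qseries \<Rightarrow> 'e set qseries" where
  "qpoch \<Gamma> cs P = (THE f. qseries_tendsto (partial_qpoch \<Gamma> cs P) f)"

end

theory Submission
  imports Defs
begin

text \<open>
  Put \<open>a = q\<^sup>N\<close>. A state assigns to each of the \<open>N\<close> colors a (possibly empty) cycle, and the vertex
  weights are the powers of \<open>q\<close> that arise when the product over the colors of the monomials
  \<open>z\<^sup>C Z\<^sup>C\<close> is brought into standard order. Hence the generating series of the \<open>N\<close>-th MOY evaluations
  is the product, over the colors \<open>x \<in> A\<^sub>N\<close> in increasing order, of the factors
  \<open>\<Sum>\<^sub>C q\<^bsup>x rot(C)\<^esup> z\<^sup>C Z\<^sup>C\<close>. The factors of \<open>\<mu>((P\<^sub>\<Gamma>(q,a,x),q)\<^sub>\<infinity>)\<close> are those with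
  \<open>x = -(N-1)/2, -(N-3)/2, \<dots>\<close>, and the factors of \<open>\<mu>((P\<^sub>\<Gamma>(q,a\<^sup>-\<^sup>1,x),q)\<^sub>\<infinity>)\<close> are those with
  \<open>x = (N+1)/2, (N+3)/2, \<dots>\<close>; this is the first identity at \<open>a = q\<^sup>N\<close>. The second one holds since
  \<open>A\<^bsub>N+2\<^esub>\<close> has one more color at either end.

  For general \<open>a\<close> the first identity is taken as the definition of the series. Positivity of the
  rotation numbers makes the coefficients of the infinite products rational, with denominators
  \<open>1 - q\<^sup>d\<close>, \<open>d > 0\<close>, so the quotient has coefficients in \<open>\<rat>(q\<^bsup>1/2\<^esup>, a\<^bsup>1/2\<^esup>)\<close> that specialise to the MOY
  evaluations; as infinitely many specialisations determine them, they are the HOMFLY evaluations.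
  All series are handled through coefficients attached to words in the cycles, for which products
  are plain convolutions.
\<close>


section \<open>Convolution of functions on words\<close>

text \<open>Words turn both identities into statements in the free algebra on the nonempty cycles.
  The commutation relations enter only through one exponent per word, the cost of sorting it, and
  this cost is additive up to a term that depends on the two weights alone; hence the passage from
  words to series is multiplicative. The same word coefficients describe a series in the
  \<open>x_C\<close> and its image under \<open>\<mu>\<close>. The empty cycle is not a letter: it
  supplies the constant term 1 of every factor, which permits division by recursion on the length of
  a word and leaves only letters of positive rotation number.

  One obstacle is arithmetic: the vertex weights are powers of q^(1/4), whereas the HOMFLY
  evaluation is rational in q^(1/2). A parity count resolves it: two cycles take different branches
  at an even number of vertices, so sorting a word of cycles costs a power of q^(1/2). Another is
  that the description of \<open>homfly\<close> admits a different fraction for each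
  \<open>N\<close>, so that uniqueness has to compare these with one fixed fraction.\<close>

definition conv :: "('c list \<Rightarrow> 'a::comm_ring_1) \<Rightarrow> ('c list \<Rightarrow> 'a) \<Rightarrow> 'c list \<Rightarrow> 'a" where
  "conv c d w = (\<Sum>i\<le>length w. c (take i w) * d (drop i w))"

lemma conv_Nil [simp]: "conv c d [] = c [] * d []"
  by (simp add: conv_def)

lemma conv_Cons: "conv c d (x # w) = c [] * d (x # w) + conv (\<lambda>u. c (x # u)) d w"
  by (simp add: conv_def sum.atMost_Suc_shift del: sum.atMost_Suc)

lemma conv_snoc: "conv c d (w @ [x]) = conv c (\<lambda>v. d (v @ [x])) w + c (w @ [x]) * d []"
  by (auto simp: conv_def intro!: sum.cong)

text \<open>One factor of the ordered product, 1 plus a linear form in the letters; the 1 is the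
  contribution of the empty cycle.\<close>

definition linear_word :: "('c \<Rightarrow> 'a::comm_ring_1) \<Rightarrow> 'c list \<Rightarrow> 'a" where
  "linear_word f w = (case w of [] \<Rightarrow> 1 | [x] \<Rightarrow> f x | _ \<Rightarrow> 0)"

lemma linear_word_simps [simp]:
  "linear_word f [] = 1" "linear_word f [x] = f x" "linear_word f (x # y # w) = 0"
  by (simp_all add: linear_word_def)

lemma conv_zero_left: "conv (\<lambda>u. 0) d w = 0"
  by (simp add: conv_def)

lemma conv_zero_right: "conv c (\<lambda>u. 0) w = 0"
  by (simp add: conv_def)

lemma conv_delta_left: "conv (\<lambda>u. if u = [] then k else 0) d w = k * d w"
  by (cases w) (simp_all add: conv_Cons conv_zero_left)

lemma conv_delta_right: "conv c (\<lambda>u. if u = [] then k else 0) w = c w * k"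
  by (cases w rule: rev_cases) (simp_all add: conv_snoc conv_zero_right)

lemma conv_linear_left_Cons: "conv (linear_word f) d (x # w) = d (x # w) + f x * d w"
proof -
  have "(\<lambda>u. linear_word f (x # u)) = (\<lambda>u. if u = [] then f x else 0)"
    by (auto simp: linear_word_def split: list.splits)
  then show ?thesis by (simp add: conv_Cons conv_delta_left)
qed


lemma conv_mult_left: "conv (\<lambda>u. k * c u) d w = k * conv c d w"
  by (simp add: conv_def sum_distrib_left mult.assoc)

lemma conv_add_left: "conv (\<lambda>u. c u + c' u) d w = conv c d w + conv c' d w"
  by (simp add: conv_def sum.distrib distrib_right)

text \<open>A character of the free monoid acts by an algebra automorphism. Here it is the
  substitution of q^(k rot(C)) x_C for x_C.\<close>

lemma conv_character:
  assumes "\<And>u v. h (u @ v) = h u * (h v :: 'a::comm_ring_1)"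
  shows "conv (\<lambda>u. h u * c u) (\<lambda>v. h v * d v) w = h w * conv c d w"
proof -
  have "h w = h (take i w) * h (drop i w)" for i
    using assms[of "take i w" "drop i w"] by simp
  then have "h (take i w) * c (take i w) * (h (drop i w) * d (drop i w)) =
      h w * (c (take i w) * d (drop i w))" for i
    by (simp only: ac_simps)
  then show ?thesis by (simp add: conv_def sum_distrib_left)
qed

lemma conv_hom:
  assumes "\<And>a b. h (a + b) = h a + h b" "\<And>a b. h (a * b) = h a * (h b :: 'b::comm_ring_1)" "h 0 = 0"
  shows "h (conv c d w) = conv (\<lambda>u. h (c u)) (\<lambda>v. h (d v)) w"
proof -
  have "h (sum f A) = (\<Sum>i\<in>A. h (f i))" for f :: "nat \<Rightarrow> 'a" and A
    by (induction A rule: infinite_finite_induct) (simp_all add: assms)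
  then show ?thesis by (simp add: conv_def assms)
qed

text \<open>Division by \<open>d\<close>, meaningful if \<open>d [] = 1\<close>.\<close>

function conv_div :: "('c list \<Rightarrow> 'a::comm_ring_1) \<Rightarrow> ('c list \<Rightarrow> 'a) \<Rightarrow> 'c list \<Rightarrow> 'a" where
  "conv_div c d w = c w - (\<Sum>i<length w. conv_div c d (take i w) * d (drop i w))"
  by auto
termination by (relation "Wellfounded.measure (\<lambda>(c, d, w). length w)") auto

declare conv_div.simps [simp del]

lemma conv_conv_div:
  assumes "d [] = 1"
  shows "conv (conv_div c d) d w = c w"
proof -
  have "conv (conv_div c d) d w =
      (\<Sum>i<length w. conv_div c d (take i w) * d (drop i w)) + conv_div c d w"
    using assms by (simp add: conv_def lessThan_Suc_atMost[symmetric])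
  then show ?thesis by (simp add: conv_div.simps[of c d w])
qed

text \<open>The cut at the end of \<open>w\<close> contributes \<open>f w\<close> itself, since
  \<open>d [] = 1\<close>; all other cuts involve shorter words. This is how two series that solve
  the same division problem are identified.\<close>

lemma conv_div_unique:
  assumes "d [] = 1" and "\<And>w. conv f d w = c w"
  shows "f w = conv_div c d w"
proof (induction w rule: length_induct)
  case (1 w)
  have "f w = c w - (\<Sum>i<length w. f (take i w) * d (drop i w))"
    using assms(1) assms(2)[of w] by (simp add: conv_def lessThan_Suc_atMost[symmetric] eq_diff_eq add.commute)
  also have "\<dots> = conv_div c d w"
    unfolding conv_div.simps[of c d w] using 1 by simp
  finally show ?case .
qed

text \<open>The indeterminate of \<^typ>\<open>int fls\<close> is \<open>q\<^bsup>1/4\<^esup>\<close>; the constant hides the simplifier's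
  preference for \<^const>\<open>fls_shift\<close> over products with powers of the indeterminate.\<close>

definition q4 :: "int \<Rightarrow> int fls" where
  "q4 k = fls_X_intpow k"

lemma q4_0 [simp]: "q4 0 = 1"
  by (simp add: q4_def)

lemma q4_add: "q4 (a + b) = q4 a * q4 b"
  by (simp add: q4_def fls_X_intpow_times_fls_X_intpow del: fls_X_intpow_times_conv_shift)

lemma q4_nonzero [simp]: "q4 k \<noteq> 0"
  by (simp add: q4_def)

lemma q4_power: "q4 k ^ n = q4 (int n * k)"
  by (simp add: q4_def fls_X_intpow_power)

lemma fls_nth_q4: "fls_nth (q4 k) i = (if i = k then 1 else 0)"
  by (simp add: q4_def)

lemma fls_nth_q4_mult: "fls_nth (q4 k * f) i = fls_nth f (i - k)"
  by (simp add: q4_def fls_X_intpow_times_conv_shift)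

lemma q4_eq_iff: "q4 a = q4 b \<longleftrightarrow> a = b"
  by (metis fls_nth_q4 zero_neq_one)

lemma qpow_eq_q4: "qpow r = q4 \<lfloor>4 * r\<rfloor>"
  by (simp add: qpow_def q4_def)

text \<open>The series 1/(1 - q^d); the factor 4 is due to the indeterminate q^(1/4).\<close>

definition geometric :: "nat \<Rightarrow> int fls" where
  "geometric d = fps_to_fls (Abs_fps (\<lambda>n. if 4 * d dvd n then 1 else 0))"

lemma geometric_eq:
  assumes "d > 0"
  shows "geometric d = 1 + q4 (4 * int d) * geometric d"
proof -
  have "4 * int d dvd i - 4 * int d \<longleftrightarrow> 4 * int d dvd i" for i
    using dvd_diff_right_iff[of "4 * int d" "4 * int d" i]
    by (metis dvd_refl dvd_minus_iff minus_diff_eq)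
  moreover have "4 * d dvd nat i \<longleftrightarrow> 4 * int d dvd i" if "i \<ge> 0" for i
    using that by (metis int_dvd_int_iff int_nat_eq of_nat_mult of_nat_numeral)
  moreover have "i < 0" if "4 * int d dvd i" "i \<noteq> 0" "i < 4 * int d" for i
    using that zdvd_not_zless by (meson linorder_neqE_linordered_idom)
  ultimately show ?thesis using assms
    by (intro fls_eqI) (auto simp: geometric_def fls_nth_q4_mult)
qed

text \<open>The ring Z[[q^(1/2)]] inside the Laurent series in q^(1/4).\<close>

definition integral_q :: "int fls set" where
  "integral_q = {f. \<forall>i. fls_nth f i \<noteq> 0 \<longrightarrow> 0 \<le> i \<and> even i}"

lemma integral_q_q4: "k \<ge> 0 \<Longrightarrow> even k \<Longrightarrow> q4 k \<in> integral_q"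
  by (simp add: integral_q_def fls_nth_q4)

lemma integral_q_geometric: "geometric d \<in> integral_q"
proof -
  have "even n" if "4 * d dvd n" for n using that by (auto elim!: dvdE)
  then have "even i" if "4 * d dvd nat i" "i \<ge> 0" for i :: int using that even_nat_iff by blast
  then show ?thesis by (auto simp: integral_q_def geometric_def split: if_splits)
qed

lemma integral_q_1: "1 \<in> integral_q"
  using integral_q_q4[of 0] by simp

lemma integral_q_mult:
  assumes "f \<in> integral_q" "g \<in> integral_q"
  shows "f * g \<in> integral_q"
proof -
  { fix n assume "fls_nth (f * g) n \<noteq> 0"
    then have "(\<Sum>i=fls_subdegree f + fls_subdegree g..n.
        fls_nth f (i - fls_subdegree g) * fls_nth g (fls_subdegree g + n - i)) \<noteq> 0"
      by (simp add: fls_times_nth(1))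
    then obtain i where "fls_nth f (i - fls_subdegree g) \<noteq> 0" "fls_nth g (fls_subdegree g + n - i) \<noteq> 0"
      by (metis (no_types, lifting) mult_eq_0_iff sum.not_neutral_contains_not_neutral)
    then have "0 \<le> i - fls_subdegree g" "even (i - fls_subdegree g)"
      "0 \<le> fls_subdegree g + n - i" "even (fls_subdegree g + n - i)"
      using assms by (auto simp: integral_q_def)
    then have "0 \<le> n \<and> even n" by presburger }
  then show ?thesis by (auto simp: integral_q_def)
qed


section \<open>Reordering words in q-commuting variables\<close>

text \<open>The exponent paid for a letter \<open>x\<close> that stands to the left of
  \<open>y\<close>; only pairs in the wrong order cost anything.\<close>

definition brel :: "'x qvars \<Rightarrow> 'x \<Rightarrow> 'x \<Rightarrow> rat" where
  "brel X x y = (if before (vars X) y x then qexp X x y else 0)"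

definition cross :: "'x qvars \<Rightarrow> 'x multiset \<Rightarrow> 'x multiset \<Rightarrow> rat" where
  "cross X a b = (\<Sum>x\<in>#a. \<Sum>y\<in>#b. brel X x y)"

lemma cross_empty [simp]: "cross X {#} b = 0" "cross X a {#} = 0"
  by (simp_all add: cross_def)

lemma cross_add: "cross X (a + a') b = cross X a b + cross X a' b"
  "cross X a (b + b') = cross X a b + cross X a b'"
  by (simp_all add: cross_def sum_mset.distrib)

lemma reorder_eq_sum:
  "reorder X w = (\<Sum>j<length w. \<Sum>i<j. brel X (w ! i) (w ! j))"
proof -
  have "reorder X w = (\<Sum>(j, i) | j < length w \<and> i < j \<and> before (vars X) (w ! j) (w ! i).
     qexp X (w ! i) (w ! j))"
    unfolding reorder_def
    by (rule sum.reindex_bij_witness[of _ "\<lambda>(i, j). (j, i)" "\<lambda>(i, j). (j, i)"]) auto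
  also have "\<dots> = (\<Sum>(j, i) \<in> Sigma {..<length w} (\<lambda>j. {..<j}). brel X (w ! i) (w ! j))"
    by (rule sum.mono_neutral_cong_left) (auto simp: brel_def split: if_splits)
  finally show ?thesis by (simp add: sum.Sigma)
qed

lemma reorder_Nil [simp]: "reorder X [] = 0"
  by (simp add: reorder_eq_sum)

lemma reorder_Cons: "reorder X (x # w) = (\<Sum>y\<in>#mset w. brel X x y) + reorder X w"
proof -
  have "(\<Sum>y\<in>#mset w. brel X x y) = (\<Sum>j<length w. brel X x (w ! j))"
    by (simp add: sum_mset_sum_list sum_list_sum_nth atLeast0LessThan flip: mset_map)
  then show ?thesis
    by (simp add: reorder_eq_sum sum.lessThan_Suc_shift sum.distrib del: sum.lessThan_Suc)
qed

text \<open>The pairs with one letter in each word contribute a quantity that sees only the two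
  multisets and is bilinear in them.\<close>

lemma reorder_append:
  "reorder X (u @ v) = reorder X u + reorder X v + cross X (mset u) (mset v)"
  by (induction u) (simp_all add: reorder_Cons cross_def algebra_simps)

lemma mset_std_word:
  assumes "distinct (vars X)"
  shows "mset (std_word X m) = filter_mset (\<lambda>x. x \<in> set (vars X)) m"
proof -
  have "mset (concat (map (\<lambda>x. replicate (count m x) x) xs)) = filter_mset (\<lambda>x. x \<in> set xs) m"
    if "distinct xs" for xs
    using that
    by (induction xs) (auto simp: multiset_eq_iff)
  then show ?thesis using assms by (simp add: std_word_def)
qed

lemma before_Cons: "before (z # zs) u w \<longleftrightarrow> u = z \<and> w \<in> set zs \<or> before zs u w"
  unfolding before_def by (auto simp: Cons_eq_append_conv)

lemma before_in_set: "before zs u w \<Longrightarrow> u \<in> set zs \<and> w \<in> set zs"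
  unfolding before_def by auto

lemma before_append:
  "before (xs @ ys) u w \<longleftrightarrow> before xs u w \<or> u \<in> set xs \<and> w \<in> set ys \<or> before ys u w"
  by (induction xs) (auto simp: before_Cons before_def[of "[]"])

lemma before_irrefl: "distinct xs \<Longrightarrow> \<not> before xs u u"
  by (induction xs) (auto simp: before_Cons before_def[of "[]"])

lemma before_antisym: "distinct xs \<Longrightarrow> before xs u w \<Longrightarrow> \<not> before xs w u"
  by (induction xs) (auto simp: before_Cons before_def[of "[]"] dest: before_in_set)

lemma reorder_std_word [simp]:
  assumes "distinct (vars X)"
  shows "reorder X (std_word X m) = 0"
proof -
  \<comment> \<open>The induction runs over suffixes \<open>ws\<close> of the list of variables,
    because \<open>brel\<close> still refers to the whole list.\<close>
  have "reorder X (concat (map (\<lambda>x. replicate (count m x) x) ws)) = 0"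
    if "vars X = us @ ws" for us ws
    using that
  proof (induction ws arbitrary: us)
    case (Cons x ws)
    have 1: "reorder X (replicate k x) = 0" for k
      using before_irrefl[OF assms] by (induction k) (auto simp: reorder_Cons brel_def)
    have 2: "\<not> before (vars X) y x" if "y \<in> set ws" for y
    proof -
      have "before (vars X) x y" using Cons.prems that unfolding before_def by blast
      then show ?thesis using assms before_antisym by metis
    qed
    have "reorder X (concat (map (\<lambda>x. replicate (count m x) x) ws)) = 0"
      using Cons.IH[of "us @ [x]"] Cons.prems by simp
    moreover have "cross X (mset (replicate k x)) (mset (concat (map (\<lambda>x. replicate (count m x) x) ws))) = 0" for k
      using 2 unfolding cross_def
      by (intro sum_mset.neutral ballI) (auto simp: brel_def intro!: sum_mset.neutral split: if_splits)
    ultimately show ?case using 1 by (simp add: reorder_append)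
  qed simp
  from this[of "[]" "vars X"] show ?thesis by (simp add: std_word_def)
qed

section \<open>Exponents of q are integral multiples of 1/4\<close>

lemma Ints_mult4_sum_mset:
  assumes "\<And>x. x \<in># a \<Longrightarrow> (4::rat) * f x \<in> \<int>"
  shows "4 * (\<Sum>x\<in>#a. f x) \<in> \<int>"
  using assms by (induction a) (auto simp: distrib_left)

lemma Ints_cross:
  assumes "\<And>x y. 4 * qexp X x y \<in> \<int>"
  shows "4 * cross X a b \<in> \<int>"
  unfolding cross_def
  by (intro Ints_mult4_sum_mset) (auto simp: brel_def assms)

lemma Ints_reorder:
  assumes "\<And>x y. 4 * qexp X x y \<in> \<int>"
  shows "4 * reorder X w \<in> \<int>"
proof (induction w)
  case (Cons x w)
  have "4 * (\<Sum>y\<in>#mset w. brel X x y) \<in> \<int>"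
    by (intro Ints_mult4_sum_mset) (auto simp: brel_def assms)
  then show ?case using Cons by (simp add: reorder_Cons distrib_left)
qed simp

lemma aq_0_0 [simp]: "aq 0 0 = 1"
  by (simp add: aq_def qpow_def)

text \<open>One setting for both kinds of variables: a letter \<open>C\<close> stands for
  \<open>x_C\<close> itself, with weight \<open>{#C#}\<close>, or for the monomial z^C Z^C. Nonempty
  weights make the sums over words finite; integrality of the exponents makes the floor in
  \<open>qpow\<close> additive.\<close>

locale word_series =
  fixes X :: "'x qvars" and wt_of :: "'c \<Rightarrow> 'x multiset" and L :: "'c set"
  assumes dist: "distinct (vars X)" and fin: "finite L"
    and nonempty: "C \<in> L \<Longrightarrow> wt_of C \<noteq> {#}"
    and ints: "4 * qexp X x y \<in> \<int>"
begin

definition weight :: "'c list \<Rightarrow> 'x multiset" where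
  "weight w = sum_list (map wt_of w)"

definition word :: "'c list \<Rightarrow> 'x list" where
  "word w = concat (map (\<lambda>C. std_word X (wt_of C)) w)"

text \<open>The image of a word series when every letter is replaced by its standard monomial and
  the resulting product is sorted.\<close>

definition wsum :: "('c list \<Rightarrow> laurent) \<Rightarrow> 'x qseries" where
  "wsum c n = (\<Sum>w | set w \<subseteq> L \<and> weight w = n. c w * aq 0 (reorder X (word w)))"

lemma weight_simps [simp]: "weight [] = {#}" "weight (C # w) = wt_of C + weight w"
  "weight (u @ v) = weight u + weight v"
  by (simp_all add: weight_def)

lemma word_simps [simp]: "word [] = []" "word (C # w) = std_word X (wt_of C) @ word w"
  "word (u @ v) = word u @ word v"
  by (simp_all add: word_def)

lemma length_le_size_weight: "set w \<subseteq> L \<Longrightarrow> length w \<le> size (weight w)"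
proof (induction w)
  case (Cons C w)
  have "size (wt_of C) \<noteq> 0" using nonempty[of C] Cons.prems by simp
  moreover have "length w \<le> size (weight w)" using Cons by simp
  ultimately show ?case unfolding weight_simps size_union list.size by linarith
qed simp

lemma finite_words: "finite {w. set w \<subseteq> L \<and> weight w = n}"
proof (rule finite_subset)
  show "{w. set w \<subseteq> L \<and> weight w = n} \<subseteq> {w. set w \<subseteq> L \<and> length w \<le> size n}"
    using length_le_size_weight by auto
qed (rule finite_lists_length_le[OF fin])

lemma mset_word: "mset (word w) = filter_mset (\<lambda>x. x \<in> set (vars X)) (weight w)"
  by (induction w) (simp_all add: mset_std_word[OF dist])

lemma wsum_cong: "(\<And>w. set w \<subseteq> L \<Longrightarrow> c w = d w) \<Longrightarrow> wsum c = wsum d"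
  unfolding wsum_def by (intro ext sum.cong) auto

lemma wsum_unit: "wsum (\<lambda>w. if w = [] then 1 else 0) = qmono {#}"
proof
  fix n
  have "wsum (\<lambda>w. if w = [] then 1 else 0) n =
      (\<Sum>w | set w \<subseteq> L \<and> weight w = n. if w = [] then 1 else 0)"
    unfolding wsum_def by (intro sum.cong) auto
  also have "\<dots> = qmono {#} n"
    using finite_words[of n] by (auto simp: qmono_def)
  finally show "wsum (\<lambda>w. if w = [] then 1 else 0) n = qmono {#} n" .
qed

text \<open>Sorting a concatenation can be done in stages: sort both parts, then merge two standard
  monomials. The last stage is exactly the factor that occurs in \<open>qmult\<close>.\<close>

lemma aq_reorder_append:
  "aq 0 (reorder X (word (u @ v))) =
    aq 0 (reorder X (word u)) * aq 0 (reorder X (word v)) *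
    aq 0 (reorder X (std_word X (weight u) @ std_word X (weight v)))"
proof -
  have "4 * (reorder X (word u) + reorder X (word v)) \<in> \<int>"
    using Ints_reorder[OF ints] by (simp add: distrib_left)
  then show ?thesis
    using Ints_reorder[OF ints] Ints_cross[OF ints]
    by (simp add: reorder_append mset_word mset_std_word[OF dist] dist aq_mult)
qed

lemma weight_take_drop: "weight (take i w) + weight (drop i w) = weight w"
  by (metis append_take_drop_id weight_simps(3))

lemma weight_take_subset: "weight (take i w) \<subseteq># weight w"
  by (metis weight_take_drop mset_subset_eq_add_left)

lemma weight_drop_eq: "weight (drop i w) = weight w - weight (take i w)"
  by (metis weight_take_drop add_diff_cancel_left')

text \<open>A pair of words of weights \<open>a\<close> and \<open>n - a\<close> is the same as a
  word of weight \<open>n\<close> together with a place to cut it.\<close>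

lemma qmult_wsum: "qmult X (wsum c) (wsum d) = wsum (conv c d)"
proof
  fix n
  let ?W = "\<lambda>n. {w. set w \<subseteq> L \<and> weight w = n}"
  let ?t = "\<lambda>u v. c u * d v * aq 0 (reorder X (word (u @ v)))"
  have "qmult X (wsum c) (wsum d) n = (\<Sum>a | a \<subseteq># n. \<Sum>u\<in>?W a. \<Sum>v\<in>?W (n - a). ?t u v)"
    unfolding qmult_def wsum_def aq_reorder_append
    unfolding sum_product sum_distrib_right
    by (intro sum.cong refl) (auto simp: ac_simps sum_distrib_left)
  also have "\<dots> = (\<Sum>(a, u, v)\<in>(SIGMA a:{a. a \<subseteq># n}. SIGMA u:?W a. ?W (n - a)). ?t u v)"
    by (simp add: sum.Sigma finite_submultisets finite_words)
  also have "\<dots> = (\<Sum>(w, i)\<in>(SIGMA w:?W n. {..length w}). ?t (take i w) (drop i w))"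
    by (rule sum.reindex_bij_witness[of _
          "\<lambda>(w, i). (weight (take i w), take i w, drop i w)" "\<lambda>(a, u, v). (u @ v, length u)"])
      (auto dest: in_set_takeD in_set_dropD simp: weight_take_subset weight_drop_eq)
  also have "\<dots> = (\<Sum>w\<in>?W n. \<Sum>i\<le>length w. ?t (take i w) (drop i w))"
    by (simp add: sum.Sigma finite_words)
  also have "\<dots> = wsum (conv c d) n"
    unfolding wsum_def conv_def by (intro sum.cong refl) (simp add: sum_distrib_right del: word_simps)
  finally show "qmult X (wsum c) (wsum d) n = wsum (conv c d) n" .
qed

end


section \<open>The word coefficients of the infinite product\<close>

lemma conv_assoc: "conv (conv a b) c = conv a (conv b c)"
proof
  fix w show "conv (conv a b) c w = conv a (conv b c) w"
  proof (induction w arbitrary: a)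
    case (Cons x w)
    have "conv (conv a b) c (x # w) = a [] * b [] * c (x # w) +
        conv (\<lambda>u. a [] * b (x # u) + conv (\<lambda>u. a (x # u)) b u) c w"
      by (simp add: conv_Cons)
    also have "\<dots> = a [] * b [] * c (x # w) + a [] * conv (\<lambda>u. b (x # u)) c w +
        conv (\<lambda>u. a (x # u)) (conv b c) w"
      by (simp add: conv_add_left conv_mult_left Cons.IH)
    also have "\<dots> = conv a (conv b c) (x # w)"
      by (simp add: conv_Cons algebra_simps)
    finally show ?case .
  qed (simp add: mult.assoc)
qed

definition wrot :: "('c \<Rightarrow> int) \<Rightarrow> 'c list \<Rightarrow> int" where
  "wrot r w = sum_list (map r w)"

lemma wrot_simps [simp]: "wrot r [] = 0" "wrot r (C # w) = r C + wrot r w"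
  "wrot r (u @ v) = wrot r u + wrot r v"
  by (simp_all add: wrot_def)

text \<open>With \<open>k = 4\<close> this is one step q^(rot(C)) x_C of the rescaling in the
  infinite product; with \<open>k = - 2 * N\<close> it is the power a^(-rot/2) at a = q^N.\<close>

definition twist :: "('c \<Rightarrow> int) \<Rightarrow> int \<Rightarrow> 'c list \<Rightarrow> int fls" where
  "twist r k w = q4 (k * wrot r w)"

lemma twist_append: "twist r k (u @ v) = twist r k u * twist r k v"
  by (simp add: twist_def distrib_left q4_add)

lemma twist_add: "twist r (k + l) w = twist r k w * twist r l w"
  by (simp add: twist_def distrib_right q4_add)

lemma twist_linear_word:
  "twist r k w * linear_word (\<lambda>C. q4 (l * r C)) w = linear_word (\<lambda>C. q4 ((k + l) * r C)) w"
  by (auto simp: linear_word_def twist_def distrib_right q4_add split: list.splits)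

text \<open>The coefficients of the words in the products of the first \<open>n\<close> factors, respectively of all
  factors, of \<open>(P\<^sub>\<Gamma>(q,a,x), q)\<^sub>\<infinity>\<close> at \<open>a = 1\<close>. A word \<open>w\<close> also carries the power
  \<open>a\<^bsup>-rot(w)/2\<^esup>\<close>, so nothing is lost.\<close>

primrec finite_coeff :: "('c \<Rightarrow> int) \<Rightarrow> nat \<Rightarrow> 'c list \<Rightarrow> int fls" where
  "finite_coeff r 0 = (\<lambda>w. if w = [] then 1 else 0)"
| "finite_coeff r (Suc n) = conv (linear_word (\<lambda>C. q4 (2 * r C))) (\<lambda>w. twist r 4 w * finite_coeff r n w)"

primrec inf_coeff :: "('c \<Rightarrow> int) \<Rightarrow> 'c list \<Rightarrow> int fls" where
  "inf_coeff r [] = 1"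
| "inf_coeff r (C # w) = q4 (2 * r C) * twist r 4 w * geometric (nat (wrot r (C # w))) * inf_coeff r w"

lemma finite_coeff_Nil [simp]: "finite_coeff r n [] = 1"
  by (induction n) (simp_all add: twist_def)

lemma finite_coeff_Suc_Cons:
  "finite_coeff r (Suc n) (C # w) = twist r 4 (C # w) * finite_coeff r n (C # w) + q4 (2 * r C) * (twist r 4 w * finite_coeff r n w)"
  by (simp add: conv_linear_left_Cons)

text \<open>The defining recursion splits off the factor \<open>k = 0\<close> and rescales the
  others, which suits proofs by the first letter. The ordered product grows on the right instead, by
  the factor \<open>k = n\<close>, whose exponent n + 1/2 is 2 + 4n quarters.\<close>

lemma finite_coeff_Suc_right:
  "finite_coeff r (Suc n) = conv (finite_coeff r n) (linear_word (\<lambda>C. q4 ((2 + 4 * int n) * r C)))"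
proof (induction n)
  case 0
  show ?case
  proof
    fix w
    have "(\<lambda>w. twist r 4 w * finite_coeff r 0 w) = (\<lambda>w. if w = [] then 1 else 0)"
      by (auto simp: twist_def)
    then show "finite_coeff r (Suc 0) w = conv (finite_coeff r 0) (linear_word (\<lambda>C. q4 ((2 + 4 * int 0) * r C))) w"
      by (simp add: conv_delta_left conv_delta_right)
  qed
next
  case (Suc n)
  let ?p = "linear_word (\<lambda>C. q4 (2 * r C))"
  let ?q = "\<lambda>n. linear_word (\<lambda>C. q4 ((2 + 4 * int n) * r C))"
  have "(\<lambda>w. twist r 4 w * finite_coeff r (Suc n) w) =
      conv (\<lambda>w. twist r 4 w * finite_coeff r n w) (\<lambda>w. twist r 4 w * ?q n w)"
    unfolding Suc.IH by (rule ext) (rule conv_character[symmetric], rule twist_append)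
  also have "(\<lambda>w. twist r 4 w * ?q n w) = ?q (Suc n)"
    using twist_linear_word[of r 4 _ "2 + 4 * int n"] by (simp add: algebra_simps)
  finally have "finite_coeff r (Suc (Suc n)) = conv ?p (conv (\<lambda>w. twist r 4 w * finite_coeff r n w) (?q (Suc n)))"
    by simp
  also have "\<dots> = conv (finite_coeff r (Suc n)) (?q (Suc n))"
    by (simp add: conv_assoc fun_eq_iff)
  finally show ?case .
qed

section \<open>Positive rotation numbers and the infinite product\<close>

lemma wrot_nonneg: "(\<And>C. r C > 0) \<Longrightarrow> wrot r w \<ge> 0"
  by (induction w) (auto simp: add_nonneg_nonneg order_less_imp_le)

lemma wrot_pos: "(\<And>C. r C > 0) \<Longrightarrow> w \<noteq> [] \<Longrightarrow> wrot r w > 0"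
  by (cases w) (auto simp: add_pos_nonneg wrot_nonneg)

text \<open>A word of length l arises from choices 0 \<le> k_1 < ... < k_l of the factors that
  supply its letters. Either k_1 > 0, and all indices drop by one at the cost of a twist, or the
  factor 0 supplies \<open>C\<close>. The geometric series in \<open>inf_coeff\<close> is the sum
  over k_1 and solves this recursion.\<close>

lemma inf_coeff_Cons:
  assumes "\<And>C. r C > 0"
  shows "inf_coeff r (C # w) = twist r 4 (C # w) * inf_coeff r (C # w) + q4 (2 * r C) * (twist r 4 w * inf_coeff r w)"
proof -
  let ?k = "q4 (2 * r C) * twist r 4 w * inf_coeff r w"
  define g where "g = geometric (nat (wrot r (C # w)))"
  define s where "s = twist r 4 (C # w)"
  have "wrot r (C # w) > 0" using assms by (rule wrot_pos) simp
  then have "g = 1 + s * g"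
    using geometric_eq[of "nat (wrot r (C # w))"] by (simp add: twist_def s_def g_def)
  then have "?k * g = ?k * (1 + s * g)" by (rule arg_cong)
  also have "\<dots> = s * (?k * g) + ?k" by (simp add: algebra_simps)
  finally have "?k * g = s * (?k * g) + ?k" .
  moreover have "inf_coeff r (C # w) = ?k * g" by (simp add: g_def mult_ac)
  ultimately show ?thesis unfolding s_def by (simp only: mult.assoc)
qed

lemma inf_coeff_conv:
  assumes "\<And>C. r C > 0"
  shows "conv (linear_word (\<lambda>C. q4 (2 * r C))) (\<lambda>w. twist r 4 w * inf_coeff r w) = inf_coeff r"
proof
  fix w show "conv (linear_word (\<lambda>C. q4 (2 * r C))) (\<lambda>w. twist r 4 w * inf_coeff r w) w = inf_coeff r w"
    using inf_coeff_Cons[of r, OF assms]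
    by (cases w) (simp_all only: conv_linear_left_Cons, simp add: twist_def)
qed

text \<open>The tail of the product after \<open>n\<close> factors is the whole product, rescaled.
  For n = N this becomes the first identity at a = q^N: after a twist by \<open>- 2 * N\<close> the
  tail carries the twist \<open>2 * N\<close>, which is the power a^(rot/2).\<close>

lemma inf_coeff_factor:
  assumes "\<And>C. r C > 0"
  shows "conv (finite_coeff r n) (\<lambda>w. twist r (4 * int n) w * inf_coeff r w) = inf_coeff r"
proof (induction n)
  case 0
  show ?case by (simp add: conv_delta_left fun_eq_iff twist_def)
next
  case (Suc n)
  let ?p = "linear_word (\<lambda>C. q4 (2 * r C))"
  let ?c = "\<lambda>n w. twist r (4 * int n) w * inf_coeff r w"
  have e: "?c (Suc n) = (\<lambda>w. twist r 4 w * ?c n w)"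
    by (rule ext) (simp add: distrib_left twist_add mult_ac)
  have "conv (\<lambda>w. twist r 4 w * finite_coeff r n w) (\<lambda>w. twist r 4 w * ?c n w) = (\<lambda>w. twist r 4 w * inf_coeff r w)"
    using Suc.IH by (simp add: conv_character[of "twist r 4", OF twist_append] fun_eq_iff)
  then show ?case unfolding e finite_coeff.simps conv_assoc using inf_coeff_conv[of r, OF assms] by simp
qed

lemma integral_q_inf_coeff:
  assumes "\<And>C. r C > 0"
  shows "inf_coeff r w \<in> integral_q"
proof (induction w)
  case (Cons C w)
  have "twist r 4 w \<in> integral_q" unfolding twist_def
    by (rule integral_q_q4) (use assms in \<open>simp_all add: wrot_nonneg\<close>)
  moreover have "q4 (2 * r C) \<in> integral_q" using assms[of C] by (intro integral_q_q4) simp_all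
  ultimately show ?case using Cons by (simp add: integral_q_mult integral_q_geometric)
qed (simp add: integral_q_1)

text \<open>Both sides obey the same recursion, in which positivity lowers the index
  \<open>i\<close> at every occurrence; agreement below order \<open>n\<close> thus becomes
  agreement below order \<open>n + 1\<close>. For \<open>n = 0\<close> only negative orders matter,
  where both sides vanish.\<close>

lemma finite_coeff_eventually_agree_inf_coeff:
  assumes "\<And>C. r C > 0"
  shows "i < int n \<Longrightarrow> fls_nth (finite_coeff r n w) i = fls_nth (inf_coeff r w) i"
proof (induction n arbitrary: w i)
  case 0
  have "fls_nth (inf_coeff r w) i = 0" using integral_q_inf_coeff[of r w, OF assms] 0 by (force simp: integral_q_def)
  moreover have "fls_nth (1 :: int fls) i = 0" using 0 by simp
  ultimately show ?case by simp
next
  case (Suc n)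
  show ?case
  proof (cases w)
    case (Cons C w')
    have nn: "wrot r w' \<ge> 0" "r C > 0" using assms wrot_nonneg by auto
    have "fls_nth (finite_coeff r (Suc n) w) i = fls_nth (finite_coeff r n w) (i - 4 * wrot r w) +
        fls_nth (finite_coeff r n w') (i - 2 * r C - 4 * wrot r w')"
      unfolding Cons finite_coeff_Suc_Cons by (simp add: twist_def fls_nth_q4_mult)
    also have "\<dots> = fls_nth (inf_coeff r w) (i - 4 * wrot r w) +
        fls_nth (inf_coeff r w') (i - 2 * r C - 4 * wrot r w')"
      using nn Suc.prems by (simp add: Suc.IH Cons)
    also have "\<dots> = fls_nth (inf_coeff r w) i"
      using arg_cong[OF inf_coeff_Cons[of r C w', OF assms], of "\<lambda>f. fls_nth f i"]
      by (simp add: Cons twist_def fls_nth_q4_mult del: inf_coeff.simps)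
    finally show ?thesis .
  qed (simp del: finite_coeff.simps)
qed

text \<open>A quantitative form of convergence: the order of the difference grows at least like
  \<open>n\<close>. The constant \<open>K\<close> absorbs multiplication by powers of q.\<close>

definition eventually_agree :: "(nat \<Rightarrow> int fls) \<Rightarrow> int fls \<Rightarrow> bool" where
  "eventually_agree F f \<longleftrightarrow> (\<exists>K. \<forall>n i. i < int n - K \<longrightarrow> fls_nth (F n) i = fls_nth f i)"

lemma eventually_agree_finite_coeff: "(\<And>C. r C > 0) \<Longrightarrow> eventually_agree (\<lambda>n. finite_coeff r n w) (inf_coeff r w)"
  unfolding eventually_agree_def by (rule exI[of _ 0]) (simp add: finite_coeff_eventually_agree_inf_coeff)

lemma eventually_agree_const: "eventually_agree (\<lambda>n. f) f"
  unfolding eventually_agree_def by simp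

lemma eventually_agree_add:
  assumes "eventually_agree F f" "eventually_agree G g"
  shows "eventually_agree (\<lambda>n. F n + G n) (f + g)"
proof -
  from assms obtain K L where "\<And>n i. i < int n - K \<Longrightarrow> fls_nth (F n) i = fls_nth f i"
    "\<And>n i. i < int n - L \<Longrightarrow> fls_nth (G n) i = fls_nth g i"
    unfolding eventually_agree_def by auto
  then show ?thesis unfolding eventually_agree_def by (intro exI[of _ "max K L"]) auto
qed

lemma eventually_agree_sum: "(\<And>x. x \<in> A \<Longrightarrow> eventually_agree (F x) (f x)) \<Longrightarrow> eventually_agree (\<lambda>n. \<Sum>x\<in>A. F x n) (\<Sum>x\<in>A. f x)"
  by (induction A rule: infinite_finite_induct) (auto intro: eventually_agree_add eventually_agree_const)

lemma eventually_agree_q4_mult: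
  assumes "eventually_agree F f"
  shows "eventually_agree (\<lambda>n. q4 k * F n) (q4 k * f)"
proof -
  from assms obtain K where "\<And>n i. i < int n - K \<Longrightarrow> fls_nth (F n) i = fls_nth f i"
    unfolding eventually_agree_def by auto
  then show ?thesis unfolding eventually_agree_def by (intro exI[of _ "K - k"]) (auto simp: fls_nth_q4_mult)
qed

lemma eventually_agree_tendsto:
  assumes "eventually_agree F f"
  shows "F \<longlonglongrightarrow> f"
proof -
  obtain K where K: "\<And>n i. i < int n - K \<Longrightarrow> fls_nth (F n) i = fls_nth f i"
    using assms unfolding eventually_agree_def by auto
  \<comment> \<open>An offset by \<open>nat K\<close> makes the order of the difference at least
    \<open>n\<close>.\<close>
  have d: "dist (F (n + nat K)) f \<le> inverse (2 ^ n)" for n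
  proof (cases "F (n + nat K) = f")
    case False
    let ?s = "fls_subdegree (F (n + nat K) - f)"
    have "int (n + nat K) - K \<le> ?s"
      using False K[of ?s "n + nat K"] nth_fls_subdegree_nonzero[of "F (n + nat K) - f"]
      by (cases "?s < int (n + nat K) - K") auto
    then have le: "int n \<le> ?s" by linarith
    then have "(2::real) ^ n \<le> 2 ^ nat ?s"
      by (intro power_increasing) auto
    then show ?thesis using False le by (simp add: dist_fls_def)
  qed simp
  have "(\<lambda>n. inverse (2 ^ n) :: real) \<longlonglongrightarrow> 0"
    using LIMSEQ_inverse_realpow_zero[of 2] by simp
  then have "(\<lambda>n. dist (F (n + nat K)) f) \<longlonglongrightarrow> 0"
    by (rule tendsto_sandwich[OF _ _ tendsto_const, rotated 2]) (use d in auto)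
  then have "(\<lambda>n. F (n + nat K)) \<longlonglongrightarrow> f"
    using tendsto_dist_iff by blast
  then show ?thesis by (rule LIMSEQ_offset)
qed


section \<open>Specialisation of a and rationality\<close>

text \<open>The substitution \<open>a = q\<^sup>N\<close>.\<close>

definition eval_a :: "int \<Rightarrow> laurent \<Rightarrow> int fls" where
  "eval_a N k = (\<Sum>j\<in>Poly_Mapping.keys k. Poly_Mapping.lookup k j * q4 (2 * N * j))"

lemma eval_a_superset: "finite A \<Longrightarrow> Poly_Mapping.keys k \<subseteq> A \<Longrightarrow> eval_a N k = (\<Sum>j\<in>A. Poly_Mapping.lookup k j * q4 (2 * N * j))"
  unfolding eval_a_def by (rule sum.mono_neutral_left) (auto simp: in_keys_iff)

lemma eval_a_0 [simp]: "eval_a N 0 = 0"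
  by (simp add: eval_a_def)

lemma eval_a_single [simp]: "eval_a N (Poly_Mapping.single j c) = c * q4 (2 * N * j)"
  by (subst eval_a_superset[of "{j}"]) (auto simp: lookup_single)

lemma eval_a_1 [simp]: "eval_a N 1 = 1"
  using eval_a_single[of N 0 1] by (simp add: single_one)

lemma eval_a_add: "eval_a N (k + l) = eval_a N k + eval_a N l"
  using eval_a_superset[of "Poly_Mapping.keys k \<union> Poly_Mapping.keys l" k N] eval_a_superset[of "Poly_Mapping.keys k \<union> Poly_Mapping.keys l" l N]
    eval_a_superset[of "Poly_Mapping.keys k \<union> Poly_Mapping.keys l" "k + l" N] keys_add[of k l]
  by (simp add: lookup_add sum.distrib distrib_right)

lemma eval_a_diff: "eval_a N (k - l) = eval_a N k - eval_a N l"
  by (metis eval_a_add diff_add_cancel add_diff_cancel_right')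

lemma eval_a_sum: "eval_a N (sum f A) = (\<Sum>x\<in>A. eval_a N (f x))"
  by (induction A rule: infinite_finite_induct) (simp_all add: eval_a_add)

lemma lookup_sum: "Poly_Mapping.lookup (sum f A) j = (\<Sum>x\<in>A. Poly_Mapping.lookup (f x) j)"
  by (induction A rule: infinite_finite_induct) (simp_all add: lookup_add)

lemma sum_singles:
  "(\<Sum>j\<in>Poly_Mapping.keys k. Poly_Mapping.single j (Poly_Mapping.lookup k j)) = k"
proof (rule poly_mapping_eqI)
  fix i
  have "Poly_Mapping.lookup (\<Sum>j\<in>Poly_Mapping.keys k. Poly_Mapping.single j (Poly_Mapping.lookup k j)) i =
      (\<Sum>j\<in>Poly_Mapping.keys k. if j = i then Poly_Mapping.lookup k j else 0)"
    by (simp add: lookup_sum lookup_single when_def)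
  also have "\<dots> = Poly_Mapping.lookup k i"
    by (simp add: in_keys_iff)
  finally show "Poly_Mapping.lookup (\<Sum>j\<in>Poly_Mapping.keys k.
      Poly_Mapping.single j (Poly_Mapping.lookup k j)) i = Poly_Mapping.lookup k i" .
qed

lemma eval_a_mult: "eval_a N (k * l) = eval_a N k * eval_a N l"
proof -
  let ?s = "\<lambda>k j. Poly_Mapping.single j (Poly_Mapping.lookup k j)"
  have "eval_a N (k * l) = eval_a N ((\<Sum>i\<in>Poly_Mapping.keys k. ?s k i) * (\<Sum>j\<in>Poly_Mapping.keys l. ?s l j))"
    by (simp only: sum_singles)
  also have "\<dots> = eval_a N k * eval_a N l"
    unfolding sum_product eval_a_sum mult_single eval_a_single
    by (simp add: eval_a_def sum_product distrib_left q4_add mult_ac)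
  finally show ?thesis .
qed

text \<open>Up to a power of a^(1/2), \<open>k\<close> is a polynomial over an integral domain, and
  the points q^(N/2) are pairwise distinct; a nonzero polynomial has only finitely many
  roots.\<close>

lemma eval_a_eq_0D:
  assumes "infinite {N::nat. eval_a (int N) k = 0}"
  shows "k = 0"
proof (rule ccontr)
  assume "k \<noteq> 0"
  then have K: "Poly_Mapping.keys k \<noteq> {}" by simp
  define m where "m = Min (Poly_Mapping.keys k)"
  have m: "m \<in> Poly_Mapping.keys k" "\<And>j. j \<in> Poly_Mapping.keys k \<Longrightarrow> m \<le> j"
    using K by (auto simp: m_def)
  \<comment> \<open>Division by the lowest power \<open>m\<close> of a^(1/2) yields a polynomial
    whose constant term is nonzero.\<close>
  define p where "p = (\<Sum>j\<in>Poly_Mapping.keys k. monom (Poly_Mapping.lookup k j) (nat (j - m)))"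
  have c: "coeff p 0 = Poly_Mapping.lookup k m"
  proof -
    have "coeff p 0 = (\<Sum>j\<in>Poly_Mapping.keys k. if j = m then Poly_Mapping.lookup k j else 0)"
      unfolding p_def coeff_sum using m by (intro sum.cong) (auto, force)
    then show ?thesis using m by simp
  qed
  then have "p \<noteq> 0" using m(1) by (metis coeff_0 in_keys_iff)
  then have fin: "finite {x. poly p x = 0}" by (rule poly_roots_finite)
  have eval_a: "poly p (q4 (2 * int N)) * q4 (2 * int N * m) = eval_a (int N) k" for N
  proof -
    have "q4 (2 * int N) ^ nat (j - m) * q4 (2 * int N * m) = q4 (2 * int N * j)" if "j \<in> Poly_Mapping.keys k" for j
      using m(2)[OF that] by (simp add: q4_power algebra_simps flip: q4_add)
    then show ?thesis
      unfolding p_def eval_a_def poly_sum poly_monom sum_distrib_right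
      by (intro sum.cong) (auto simp: mult.assoc)
  qed
  have "(\<lambda>N. q4 (2 * int N)) ` {N::nat. eval_a (int N) k = 0} \<subseteq> {x. poly p x = 0}"
    using eval_a by (auto simp flip: eval_a)
  then have "finite ((\<lambda>N. q4 (2 * int N)) ` {N::nat. eval_a (int N) k = 0})"
    using fin by (rule finite_subset)
  moreover have "inj_on (\<lambda>N. q4 (2 * int N)) {N::nat. eval_a (int N) k = 0}"
    by (auto simp: inj_on_def q4_eq_iff)
  ultimately show False using assms finite_imageD by blast
qed

lemma infinite_subset_ge_1: "(\<And>N. N \<ge> 1 \<Longrightarrow> P N) \<Longrightarrow> infinite {N::nat. P N}"
  by (metis (mono_tags, lifting) infinite_nat_iff_unbounded_le le_max_iff_disj max.cobounded1 mem_Collect_eq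
      max.cobounded2)

lemma eval_a_eqI:
  assumes "\<And>N::nat. N \<ge> 1 \<Longrightarrow> eval_a (int N) k = eval_a (int N) l"
  shows "k = l"
proof -
  have "eval_a (int N) (k - l) = 0" if "N \<ge> 1" for N
    using assms[OF that] by (simp add: eval_a_diff)
  then have "k - l = 0" by (intro eval_a_eq_0D infinite_subset_ge_1)
  then show ?thesis by simp
qed

lemma eval_a_aq [simp]: "eval_a N (aq j r) = qpow r * q4 (2 * N * j)"
  by (simp add: aq_def)

lemma qpow_quarter: "qpow (of_int k / 4) = q4 k"
  by (simp add: qpow_eq_q4)

lemma qpow_of_int: "qpow (of_int k) = q4 (4 * k)"
  using qpow_quarter[of "4 * k"] by simp

lemma qpow_half: "qpow (of_int k / 2) = q4 (2 * k)"
  using qpow_quarter[of "2 * k"] by simp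

lemma lookup_shift_a: "Poly_Mapping.lookup (shift_a k) j = qpow (of_int j) * Poly_Mapping.lookup k j"
  unfolding shift_a_def lookup_mapp by (simp add: when_def in_keys_iff)

text \<open>The substitution of q^2 a for a moves the point q^N to q^(N+2); this is where the two
  additional colors of the second identity come from.\<close>

lemma eval_a_shift_a: "eval_a N (shift_a k) = eval_a (N + 2) k"
proof -
  have "Poly_Mapping.keys (shift_a k) \<subseteq> Poly_Mapping.keys k" by (auto simp: in_keys_iff lookup_shift_a)
  then have "eval_a N (shift_a k) = (\<Sum>j\<in>Poly_Mapping.keys k. Poly_Mapping.lookup (shift_a k) j * q4 (2 * N * j))"
    by (intro eval_a_superset) auto
  also have "\<dots> = eval_a (N + 2) k"
    unfolding eval_a_def
    by (intro sum.cong refl) (simp add: lookup_shift_a qpow_of_int algebra_simps q4_add)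
  finally show ?thesis .
qed

section \<open>Polynomials in q^(1/2) and a^(1/2) as coefficients\<close>

lemma poly_map_poly_add:
  assumes "g 0 = 0" "\<And>a b. g (a + b) = g a + (g b :: 'b::comm_ring_1)"
  shows "poly (map_poly g (p + r)) x = poly (map_poly g p) x + poly (map_poly g r) x"
proof -
  have "map_poly g (p + r) = map_poly g p + map_poly g r"
    by (rule poly_eqI) (simp add: coeff_map_poly assms)
  then show ?thesis by simp
qed

lemma poly_map_poly_mult:
  fixes g :: "'a::comm_ring_1 \<Rightarrow> 'b::comm_ring_1"
  assumes "g 0 = 0" "\<And>a b. g (a + b) = g a + g b" "\<And>a b. g (a * b) = g a * g b"
  shows "poly (map_poly g (p * r)) x = poly (map_poly g p) x * poly (map_poly g r) x"
proof (induction p rule: pCons_induct)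
  case (pCons a p)
  have s: "poly (map_poly g (smult a r)) x = g a * poly (map_poly g r) x"
  proof -
    have "map_poly g (smult a r) = smult (g a) (map_poly g r)"
      by (rule poly_eqI) (simp add: coeff_map_poly assms)
    then show ?thesis by simp
  qed
  have c: "poly (map_poly g (pCons b s)) x = g b + x * poly (map_poly g s) x" for b s
    using assms by (simp add: map_poly_pCons)
  show ?case
    by (simp add: poly_map_poly_add assms s c pCons.IH algebra_simps)
qed simp

lemma q_embed_add: "q_embed (p + r) = q_embed p + q_embed r"
  unfolding q_embed_def by (rule poly_map_poly_add) auto

lemma q_embed_mult: "q_embed (p * r) = q_embed p * q_embed r"
  unfolding q_embed_def by (rule poly_map_poly_mult) auto

lemma q_embed_0 [simp]: "q_embed 0 = 0"
  by (simp add: q_embed_def)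

lemma q_embed_1 [simp]: "q_embed 1 = 1"
  by (simp add: q_embed_def map_poly_1')

lemma q_embed_monom: "q_embed (monom 1 n) = q4 (2 * int n)"
  by (simp add: q_embed_def map_poly_monom poly_monom qpow_eq_q4 q4_power mult.commute)

lemma q_embed_eq_0_iff [simp]: "q_embed p = 0 \<longleftrightarrow> p = 0"
proof
  assume z: "q_embed p = 0"
  show "p = 0"
  proof (rule poly_eqI)
    fix n
    have "q_embed p = (\<Sum>i\<le>degree p. of_int (coeff p i) * q4 (2 * int i))"
      by (simp add: q_embed_def poly_altdef coeff_map_poly qpow_eq_q4 q4_power mult.commute
          degree_map_poly fls_of_int)
    then have "fls_nth (q_embed p) (2 * int n) = (\<Sum>i\<le>degree p. if i = n then coeff p i else 0)"
      by (simp only: fls_nth_sum) (intro sum.cong, auto simp: fls_nth_q4 fls_of_int)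
    also have "\<dots> = coeff p n" by (simp add: coeff_eq_0)
    finally show "coeff p n = coeff 0 n" using z by simp
  qed
qed simp

lemma at_qN_add: "at_qN N (p + r) = at_qN N p + at_qN N r"
  unfolding at_qN_def by (rule poly_map_poly_add) (auto simp: q_embed_add)

lemma at_qN_diff: "at_qN N (p - r) = at_qN N p - at_qN N r"
  by (metis at_qN_add diff_add_cancel add_diff_cancel_right')

lemma at_qN_mult: "at_qN N (p * r) = at_qN N p * at_qN N r"
  unfolding at_qN_def by (rule poly_map_poly_mult) (auto simp: q_embed_add q_embed_mult)

lemma aq_embed_add: "aq_embed (p + r) = aq_embed p + aq_embed r"
  unfolding aq_embed_def by (rule poly_map_poly_add) (auto simp: q_embed_add single_add)

lemma aq_embed_mult: "aq_embed (p * r) = aq_embed p * aq_embed r"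
  unfolding aq_embed_def
  by (rule poly_map_poly_mult) (auto simp: q_embed_add q_embed_mult single_add mult_single)

lemma aq_embed_monom: "aq_embed (monom s n) = Poly_Mapping.single (int n) (q_embed s)"
proof -
  have "aq 1 0 ^ n = Poly_Mapping.single (int n) 1"
    by (induction n) (simp_all add: aq_def qpow_eq_q4 mult_single single_one)
  then show ?thesis
    by (simp add: aq_embed_def map_poly_monom poly_monom mult_single)
qed

lemma at_qN_monom: "at_qN N (monom s n) = q_embed s * q4 (2 * int N * int n)"
  using qpow_half[of "int N"] by (simp add: at_qN_def map_poly_monom poly_monom q4_power mult_ac)

lemma eval_a_aq_embed: "eval_a (int N) (aq_embed p) = at_qN N p"
proof (induction p rule: pCons_induct)
  case (pCons a p)
  have "pCons a p = monom a 0 + monom 1 1 * p"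
    by (simp add: monom_0 monom_Suc)
  then show ?case
    using pCons.IH
    by (simp add: aq_embed_add at_qN_add aq_embed_mult at_qN_mult aq_embed_monom at_qN_monom eval_a_add eval_a_mult)
qed (simp add: aq_embed_def at_qN_def)

text \<open>The embedding into \<open>laurent\<close> keeps the coefficients apart, so the
  infinitely many points q^N detect a nonzero polynomial. This is the uniqueness needed for
  \<open>homfly\<close>.\<close>

lemma at_qN_eq_0D:
  assumes "\<And>N. N \<ge> 1 \<Longrightarrow> at_qN N p = 0"
  shows "p = 0"
proof -
  have "aq_embed p = 0"
    using assms by (intro eval_a_eqI) (simp add: eval_a_aq_embed)
  moreover have "Poly_Mapping.lookup (aq_embed p) (int n) = q_embed (coeff p n)" for n
  proof -
    have "aq_embed p = (\<Sum>i\<le>degree p. Poly_Mapping.single (int i) (q_embed (coeff p i)))"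
    proof -
      have "aq_embed (sum f A) = (\<Sum>i\<in>A. aq_embed (f i))" for f and A :: "nat set"
        by (induction A rule: infinite_finite_induct) (simp_all add: aq_embed_add, simp_all add: aq_embed_def)
      note s = this
      have "aq_embed p = aq_embed (\<Sum>i\<le>degree p. monom (coeff p i) i)"
        by (simp add: poly_as_sum_of_monoms)
      then show ?thesis by (simp only: s aq_embed_monom)
    qed
    then have "Poly_Mapping.lookup (aq_embed p) (int n) =
        (\<Sum>i\<le>degree p. if i = n then q_embed (coeff p i) else 0)"
      by (auto simp: lookup_sum lookup_single when_def intro!: sum.cong)
    then show ?thesis by (simp add: coeff_eq_0)
  qed
  ultimately have "coeff p n = 0" for n
    by (metis lookup_zero q_embed_eq_0_iff)
  then show ?thesis by (simp add: poly_eq_iff)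
qed

lemma aq_embed_0 [simp]: "aq_embed 0 = 0"
  by (simp add: aq_embed_def)

lemma aq_embed_1 [simp]: "aq_embed 1 = 1"
  using aq_embed_monom[of 1 0] by (simp add: single_one monom_0 flip: one_pCons)

lemma aq_embed_eq_0_iff [simp]: "aq_embed p = 0 \<longleftrightarrow> p = 0"
proof
  assume "aq_embed p = 0"
  then have "at_qN N p = 0" for N by (metis eval_a_0 eval_a_aq_embed)
  then show "p = 0" by (intro at_qN_eq_0D)
qed (simp add: aq_embed_def)

text \<open>The denominators \<open>a\<^bsup>n/2\<^esup> s(q\<^bsup>1/2\<^esup>)\<close> allowed here vanish at no \<open>a = q\<^sup>N\<close>.\<close>

definition rational :: "laurent set" where
  "rational = {k. \<exists>p s n. s \<noteq> 0 \<and> k * aq_embed (monom s n) = aq_embed p}"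

lemma rational_add:
  assumes "k \<in> rational" "l \<in> rational"
  shows "k + l \<in> rational"
proof -
  obtain p s n where 1: "s \<noteq> 0" "k * aq_embed (monom s n) = aq_embed p"
    using assms(1) by (auto simp: rational_def)
  obtain p' s' n' where 2: "s' \<noteq> 0" "l * aq_embed (monom s' n') = aq_embed p'"
    using assms(2) by (auto simp: rational_def)
  have "(k + l) * aq_embed (monom (s * s') (n + n')) =
      aq_embed (p * monom s' n' + p' * monom s n)"
    by (simp add: aq_embed_add aq_embed_mult flip: 1 2 mult_monom) (simp add: algebra_simps)
  moreover have "s * s' \<noteq> 0" using 1 2 by simp
  ultimately show ?thesis unfolding rational_def by blast
qed

lemma rational_mult:
  assumes "k \<in> rational" "l \<in> rational"
  shows "k * l \<in> rational"
proof -
  obtain p s n where 1: "s \<noteq> 0" "k * aq_embed (monom s n) = aq_embed p"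
    using assms(1) by (auto simp: rational_def)
  obtain p' s' n' where 2: "s' \<noteq> 0" "l * aq_embed (monom s' n') = aq_embed p'"
    using assms(2) by (auto simp: rational_def)
  have "(k * l) * (aq_embed (monom s n) * aq_embed (monom s' n')) = aq_embed (p * p')"
    by (simp add: aq_embed_mult mult_ac flip: 1 2)
  then have "(k * l) * aq_embed (monom (s * s') (n + n')) = aq_embed (p * p')"
    by (simp only: mult_monom[symmetric] aq_embed_mult)
  moreover have "s * s' \<noteq> 0" using 1 2 by simp
  ultimately show ?thesis unfolding rational_def by blast
qed

text \<open>Embedded polynomials contain only integral powers of q^(1/2), that is, even powers of
  the indeterminate.\<close>

lemma rational_single_q4:
  assumes "even i"
  shows "Poly_Mapping.single j (q4 i) \<in> rational"
proof -
  obtain m where m: "i = 2 * m" using assms by (elim evenE)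
  \<comment> \<open>Negative exponents are moved into the denominator; of \<open>nat m\<close> and
    \<open>nat (- m)\<close> at least one is 0, and likewise for \<open>j\<close>.\<close>
  have "Poly_Mapping.single j (q4 i) * aq_embed (monom (monom 1 (nat (- m))) (nat (- j))) =
      aq_embed (monom (monom 1 (nat m)) (nat j))"
    by (auto simp: aq_embed_monom mult_single q_embed_monom m simp flip: q4_add
        intro!: arg_cong2[of _ _ _ _ Poly_Mapping.single] arg_cong[of _ _ q4])
  moreover have "monom 1 (nat (- m)) \<noteq> (0 :: int poly)" by simp
  ultimately show ?thesis unfolding rational_def by blast
qed

lemma rational_0: "0 \<in> rational"
  unfolding rational_def by (intro CollectI exI[of _ 0] exI[of _ 1]) simp


lemma rational_minus:
  assumes "k \<in> rational"
  shows "- k \<in> rational"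
proof -
  have "aq_embed (- 1) = - 1"
    using aq_embed_add[of 1 "- 1"] by (simp add: add_eq_0_iff)
  then have "- 1 \<in> rational"
    unfolding rational_def
    by (intro CollectI exI[of _ "- 1"] exI[of _ 1] exI[of _ 0]) (simp add: aq_embed_monom single_one)
  then show ?thesis using rational_mult[of "- 1" k] assms by simp
qed

lemma rational_sum: "(\<And>x. x \<in> A \<Longrightarrow> f x \<in> rational) \<Longrightarrow> sum f A \<in> rational"
  by (induction A rule: infinite_finite_induct) (auto intro: rational_add rational_0)

lemma rational_geometric: "Poly_Mapping.single 0 (geometric d) \<in> rational" if "d > 0"
proof -
  \<comment> \<open>This is 1 - q^d, written in the variable q^(1/2).\<close>
  let ?s = "1 - monom 1 (2 * d) :: int poly"
  have "q_embed ?s + q_embed (monom 1 (2 * d)) = 1"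
    by (simp flip: q_embed_add)
  then have "q_embed ?s = 1 - q4 (4 * int d)" by (simp add: q_embed_monom eq_diff_eq)
  moreover have "geometric d - q4 (4 * int d) * geometric d = 1"
    using geometric_eq[OF that] by (metis add_diff_cancel_right')
  ultimately have "geometric d * q_embed ?s = 1"
    by (simp add: right_diff_distrib mult.commute)
  then have "Poly_Mapping.single 0 (geometric d) * aq_embed (monom ?s 0) = aq_embed (monom 1 0)"
    by (simp add: aq_embed_monom mult_single)
  moreover have "?s \<noteq> 0"
    using \<open>geometric d * q_embed ?s = 1\<close> by auto
  ultimately show ?thesis unfolding rational_def by blast
qed

text \<open>Existence holds because the given denominator vanishes at no q^N. For uniqueness, a
  fixed representative \<open>p0 / r0\<close> of a competitor is compared with the fraction provided
  for each \<open>N\<close>. The relation between the values of \<open>p0\<close> and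
  \<open>r0\<close> survives even where \<open>r0\<close> vanishes, so the cross-multiplied
  difference is zero at every q^N.\<close>

lemma homfly_eq:
  assumes "k * aq_embed (monom s n) = aq_embed p" "s \<noteq> 0"
    and "\<And>N. N \<ge> 1 \<Longrightarrow> eval_a (int N) k = moy_eval \<Gamma> N \<gamma>"
  shows "homfly \<Gamma> \<gamma> = Fract p (monom s n)"
  unfolding homfly_def
proof (rule the_equality)
  let ?r = "monom s n"
  have r: "at_qN N ?r \<noteq> 0" for N
    using assms(2) by (simp add: at_qN_monom)
  have p: "at_qN N p = moy_eval \<Gamma> N \<gamma> * at_qN N ?r" if "N \<ge> 1" for N
    using arg_cong[OF assms(1), of "eval_a (int N)"] assms(3)[OF that] by (simp add: eval_a_mult eval_a_aq_embed)
  show "\<forall>N\<ge>1. \<exists>p' r'. Fract p ?r = Fract p' r' \<and> at_qN N r' \<noteq> 0 \<and>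
      at_qN N p' = moy_eval \<Gamma> N \<gamma> * at_qN N r'"
    using r p by blast
  fix h assume h: "\<forall>N\<ge>1. \<exists>p r. h = Fract p r \<and> at_qN N r \<noteq> 0 \<and>
      at_qN N p = moy_eval \<Gamma> N \<gamma> * at_qN N r"
  obtain p0 r0 where h0: "h = Fract p0 r0" "r0 \<noteq> 0" by (cases h) auto
  have "at_qN N (p0 * ?r - p * r0) = 0" if N: "N \<ge> 1" for N
  proof -
    obtain p' r' where h': "h = Fract p' r'" "at_qN N r' \<noteq> 0"
      "at_qN N p' = moy_eval \<Gamma> N \<gamma> * at_qN N r'"
      using h N by blast
    have "r' \<noteq> 0" using h'(2) by (auto simp: at_qN_def)
    then have "p0 * r' = p' * r0" using h' h0 by (simp add: eq_fract)
    then have "at_qN N p0 * at_qN N r' = at_qN N p' * at_qN N r0"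
      by (metis at_qN_mult)
    then have "at_qN N r' * (at_qN N p0 - moy_eval \<Gamma> N \<gamma> * at_qN N r0) = 0"
      using h' by (simp add: algebra_simps)
    then have "at_qN N p0 = moy_eval \<Gamma> N \<gamma> * at_qN N r0" using h'(2) by simp
    then have "at_qN N (p0 * ?r) = at_qN N (p * r0)" using p[OF N] by (simp add: at_qN_mult)
    then show ?thesis by (simp add: at_qN_diff)
  qed
  then have "p0 * ?r - p * r0 = 0" by (rule at_qN_eq_0D)
  then have "p0 * ?r = p * r0" by simp
  then show "h = Fract p ?r" using h0 assms(2) by (simp add: eq_fract monom_eq_0_iff)
qed

text \<open>The quotient is unique as \<open>laurent\<close> has no zero divisors and
  \<open>aq_embed\<close> is injective.\<close>

lemma fract_to_laurent_eq:
  assumes "k * aq_embed r = aq_embed p" "r \<noteq> 0"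
  shows "fract_to_laurent (Fract p r) = k"
  unfolding fract_to_laurent_def
proof (rule the_equality)
  show "\<exists>p' r'. r' \<noteq> 0 \<and> Fract p r = Fract p' r' \<and> k * aq_embed r' = aq_embed p'"
    using assms by blast
  fix l assume "\<exists>p' r'. r' \<noteq> 0 \<and> Fract p r = Fract p' r' \<and> l * aq_embed r' = aq_embed p'"
  then obtain p' r' where l: "r' \<noteq> 0" "Fract p r = Fract p' r'" "l * aq_embed r' = aq_embed p'"
    by blast
  have "p * r' = p' * r" using l assms(2) by (simp add: eq_fract)
  then have "aq_embed p * aq_embed r' = aq_embed p' * aq_embed r" by (metis aq_embed_mult)
  then have "(k * aq_embed r) * aq_embed r' = (l * aq_embed r') * aq_embed r"
    by (simp only: l(3) assms(1))
  then have "(k - l) * (aq_embed r * aq_embed r') = 0"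
    by (simp add: algebra_simps)
  then show "l = k" using l(1) assms(2) by simp
qed

lemma fract_to_laurent_homfly:
  assumes "k \<in> rational" "\<And>N. N \<ge> 1 \<Longrightarrow> eval_a (int N) k = moy_eval \<Gamma> N \<gamma>"
  shows "fract_to_laurent (homfly \<Gamma> \<gamma>) = k"
proof -
  obtain p s n where "s \<noteq> 0" "k * aq_embed (monom s n) = aq_embed p"
    using assms(1) by (auto simp: rational_def)
  then show ?thesis
    using homfly_eq[of k s n p \<Gamma> \<gamma>] assms(2) by (simp add: fract_to_laurent_eq monom_eq_0_iff)
qed


section \<open>Series given by word coefficients\<close>

definition pairsum :: "('a \<Rightarrow> 'a \<Rightarrow> rat) \<Rightarrow> 'a list \<Rightarrow> rat" where
  "pairsum g w = (\<Sum>j<length w. \<Sum>i<j. g (w ! i) (w ! j))"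

lemma pairsum_Nil [simp]: "pairsum g [] = 0"
  by (simp add: pairsum_def)

lemma pairsum_Cons [simp]: "pairsum g (x # w) = (\<Sum>y\<in>#mset w. g x y) + pairsum g w"
proof -
  have "(\<Sum>y\<in>#mset w. g x y) = (\<Sum>j<length w. g x (w ! j))"
    by (simp add: sum_mset_sum_list sum_list_sum_nth atLeast0LessThan flip: mset_map)
  then show ?thesis
    by (simp add: pairsum_def sum.lessThan_Suc_shift sum.distrib del: sum.lessThan_Suc)
qed

text \<open>For a symmetric cost the order of the letters is immaterial: each unordered pair of
  positions counts once, which is half of the double sum without its diagonal. The well-definedness
  of \<open>\<mu>\<close> rests on this.\<close>

lemma pairsum_symmetric:
  assumes "\<And>x y. x \<in># mset w \<Longrightarrow> y \<in># mset w \<Longrightarrow> g x y = g y x"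
  shows "2 * pairsum g w = (\<Sum>x\<in>#mset w. \<Sum>y\<in>#mset w. g x y) - (\<Sum>x\<in>#mset w. g x x)"
  using assms
proof (induction w)
  case (Cons x w)
  have "(\<Sum>y\<in>#mset w. g y x) = (\<Sum>y\<in>#mset w. g x y)"
    using Cons.prems by (intro arg_cong[of _ _ sum_mset] image_mset_cong) auto
  then show ?case using Cons by (simp add: sum_mset.distrib)
qed simp

lemma reorder_eq_pairsum: "reorder X w = pairsum (brel X) w"
  by (induction w) (simp_all add: reorder_Cons)

context word_series
begin

text \<open>The blocks are already sorted, so only pairs of letters from different blocks
  contribute.\<close>

lemma reorder_word: "reorder X (word w) = pairsum (\<lambda>C D. cross X (wt_of C) (wt_of D)) w"
proof (induction w)
  case (Cons C w)
  \<comment> \<open>\<open>std_word\<close> drops letters that are not variables;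
    \<open>cross\<close> does not see them either.\<close>
  have f: "brel X x y = 0" if "x \<notin> set (vars X) \<or> y \<notin> set (vars X)" for x y
    using that before_in_set[of "vars X" y x] by (auto simp: brel_def)
  have c: "cross X (filter_mset (\<lambda>x. x \<in> set (vars X)) a) (filter_mset (\<lambda>x. x \<in> set (vars X)) b) =
      cross X a b" for a b
  proof (induction a)
    case (add x a)
    have "(\<Sum>y\<in>#filter_mset (\<lambda>x. x \<in> set (vars X)) b. brel X x y) = (\<Sum>y\<in>#b. brel X x y)"
      by (induction b) (auto simp: f)
    moreover have "(\<Sum>y\<in>#b. brel X x y) = 0" if "x \<notin> set (vars X)"
      using that by (intro sum_mset.neutral) (auto simp: f)
    ultimately show ?case using add by (auto simp: cross_def)
  qed simp
  have "cross X a (weight w) = (\<Sum>D\<in>#mset w. cross X a (wt_of D))" for a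
    by (induction w) (simp_all add: cross_add)
  then show ?case
    using Cons by (simp add: reorder_append mset_word mset_std_word[OF dist] reorder_std_word[OF dist] c)
qed simp

lemma shift_wsum: "shift_a (wsum c n) = wsum (\<lambda>w. shift_a (c w)) n"
proof (rule poly_mapping_eqI)
  fix j
  have "Poly_Mapping.lookup (a * aq 0 r) j = Poly_Mapping.lookup a j * qpow r" for a r j
  proof -
    have "a * aq 0 r = (\<Sum>i\<in>Poly_Mapping.keys a. Poly_Mapping.single i (Poly_Mapping.lookup a i) * aq 0 r)"
      by (simp add: sum_singles flip: sum_distrib_right)
    then have "Poly_Mapping.lookup (a * aq 0 r) j =
        (\<Sum>i\<in>Poly_Mapping.keys a. if i = j then Poly_Mapping.lookup a i * qpow r else 0)"
      by (simp add: lookup_sum lookup_single aq_def mult_single when_def)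
    then show ?thesis by (simp add: in_keys_iff)
  qed
  then show "Poly_Mapping.lookup (shift_a (wsum c n)) j =
      Poly_Mapping.lookup (wsum (\<lambda>w. shift_a (c w)) n) j"
    by (simp add: wsum_def lookup_sum lookup_shift_a sum_distrib_left mult.assoc)
qed

lemma wsum_supported:
  assumes "finite A" "\<And>w. w \<in> A \<Longrightarrow> set w \<subseteq> L" "\<And>w. w \<notin> A \<Longrightarrow> c w = 0"
  shows "wsum c n = (\<Sum>w\<in>A. c w * aq 0 (reorder X (word w)) * qmono (weight w) n)"
proof -
  have "wsum c n = (\<Sum>w | w \<in> A \<and> weight w = n. c w * aq 0 (reorder X (word w)))"
    unfolding wsum_def using assms by (intro sum.mono_neutral_right finite_words) auto
  also have "\<dots> = (\<Sum>w\<in>A. c w * aq 0 (reorder X (word w)) * qmono (weight w) n)"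
    using assms(1) by (intro sum.mono_neutral_cong_left) (auto simp: qmono_def)
  finally show ?thesis .
qed

lemma wsum_linear_word:
  "wsum (linear_word f) n = qmono {#} n + (\<Sum>C\<in>L. f C * qmono (wt_of C) n)"
proof -
  \<comment> \<open>Cutting off the words with letters outside \<open>L\<close> makes the support
    finite.\<close>
  let ?c = "\<lambda>w. if set w \<subseteq> L then linear_word f w else 0"
  have "wsum (linear_word f) n = wsum ?c n"
    by (rule fun_cong[OF wsum_cong]) simp
  also have "\<dots> = (\<Sum>w\<in>insert [] ((\<lambda>C. [C]) ` L). ?c w * aq 0 (reorder X (word w)) * qmono (weight w) n)"
  proof (rule wsum_supported)
    show "?c w = 0" if "w \<notin> insert [] ((\<lambda>C. [C]) ` L)" for w
      using that by (auto simp: linear_word_def split: list.splits)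
  qed (use fin in auto)
  also have "\<dots> = qmono {#} n + (\<Sum>C\<in>L. f C * qmono (wt_of C) n)"
  proof (subst sum.insert)
    show "?c [] * aq 0 (reorder X (word [])) * qmono (weight []) n +
        (\<Sum>w\<in>(\<lambda>C. [C]) ` L. ?c w * aq 0 (reorder X (word w)) * qmono (weight w) n) =
        qmono {#} n + (\<Sum>C\<in>L. f C * qmono (wt_of C) n)"
      by (simp add: sum.reindex inj_on_def reorder_std_word[OF dist])
  qed (use fin in auto)
  finally show ?thesis .
qed

end

lemma pairsum_diff: "pairsum (\<lambda>x y. f x y - g x y) w = pairsum f w - pairsum g w"
  by (simp add: pairsum_def sum_subtractf)

lemma cross_sum:
  "cross X (sum A I) (sum B J) = (\<Sum>i\<in>I. \<Sum>j\<in>J. cross X (A i) (B j))"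
proof -
  have "cross X a (sum B J) = (\<Sum>j\<in>J. cross X a (B j))" for a
    by (induction J rule: infinite_finite_induct) (simp_all add: cross_add)
  then show ?thesis
    by (induction I rule: infinite_finite_induct) (simp_all add: cross_add)
qed

lemma cross_repeat:
  "cross X (repeat_mset k a) b = of_nat k * cross X a b"
  "cross X a (repeat_mset k b) = of_nat k * cross X a b"
  by (induction k) (simp_all add: cross_add algebra_simps)

text \<open>If the power of a^(1/2) is additive along words, the convolution takes place in the
  coefficients in q alone.\<close>

lemma conv_single:
  assumes "\<And>u v. h (u @ v) = h u + (h v :: int)"
  shows "conv (\<lambda>w. Poly_Mapping.single (h w) (c w)) (\<lambda>w. Poly_Mapping.single (h w) (d w)) w =
    Poly_Mapping.single (h w) (conv c d w :: int fls)"
proof -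
  have "h (take i w) + h (drop i w) = h w" for i
    using assms[of "take i w" "drop i w"] by simp
  moreover have "Poly_Mapping.single k (sum f A) = (\<Sum>i\<in>A. Poly_Mapping.single k (f i))"
    for k :: int and f :: "nat \<Rightarrow> int fls" and A
    by (induction A rule: infinite_finite_induct) (simp_all add: single_add)
  ultimately show ?thesis by (simp add: conv_def mult_single)
qed

lemma rational_inf_coeff:
  assumes "\<And>C. r C > 0"
  shows "Poly_Mapping.single j (inf_coeff r w) \<in> rational"
proof (induction w arbitrary: j)
  case Nil
  then show ?case using rational_single_q4[of 0 j] by simp
next
  case (Cons C w)
  have "Poly_Mapping.single j (inf_coeff r (C # w)) =
      Poly_Mapping.single j (q4 (2 * r C + 4 * wrot r w)) *
      (Poly_Mapping.single 0 (geometric (nat (wrot r (C # w)))) * Poly_Mapping.single 0 (inf_coeff r w))"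
    by (simp add: mult_single q4_add twist_def mult_ac)
  moreover have "nat (wrot r (C # w)) > 0"
    using wrot_pos[of r "C # w", OF assms] by simp
  ultimately show ?case
    using Cons by (auto intro!: rational_mult rational_single_q4 rational_geometric)
qed

lemma rational_conv_div:
  assumes "\<And>w. c w \<in> rational" "\<And>w. d w \<in> rational"
  shows "conv_div c d w \<in> rational"
proof (induction w rule: length_induct)
  case (1 w)
  have "conv_div c d (take i w) * d (drop i w) \<in> rational" if "i < length w" for i
    using 1 assms that by (intro rational_mult) auto
  then have "c w + - (\<Sum>i<length w. conv_div c d (take i w) * d (drop i w)) \<in> rational"
    using assms by (intro rational_add rational_minus rational_sum) auto
  then show ?case by (subst conv_div.simps) simp
qed

text \<open>The word coefficients of \<open>F\<^sub>\<Gamma>\<close>, defined so that the first identity holds.\<close>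

definition F_coeff :: "('c \<Rightarrow> int) \<Rightarrow> 'c list \<Rightarrow> laurent" where
  "F_coeff r = conv_div (\<lambda>w. Poly_Mapping.single (- wrot r w) (inf_coeff r w))
     (\<lambda>w. Poly_Mapping.single (wrot r w) (inf_coeff r w))"

text \<open>Both sides solve the same division problem, one by the definition of
  \<open>F_coeff\<close>, the other by \<open>inf_coeff_factor\<close>. Factor k carries the
  exponent k + 1/2 - N/2, so the right-hand side is the product over the colors in A_N.\<close>

lemma eval_a_F_coeff:
  assumes "\<And>C. r C > 0"
  shows "eval_a (int N) (F_coeff r w) = twist r (- 2 * int N) w * finite_coeff r N w"
proof -
  let ?c = "\<lambda>w. twist r (- 2 * int N) w * inf_coeff r w" and ?d = "\<lambda>w. twist r (2 * int N) w * inf_coeff r w"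
  have "conv (\<lambda>w. twist r (- 2 * int N) w * finite_coeff r N w) ?d w = ?c w" for w
  proof -
    have "?d = (\<lambda>w. twist r (- 2 * int N) w * (twist r (4 * int N) w * inf_coeff r w))"
      by (rule ext) (simp add: mult.assoc[symmetric] flip: twist_add)
    moreover have "conv (\<lambda>w. twist r (- 2 * int N) w * finite_coeff r N w)
        (\<lambda>w. twist r (- 2 * int N) w * (twist r (4 * int N) w * inf_coeff r w)) w =
        twist r (- 2 * int N) w * conv (finite_coeff r N) (\<lambda>w. twist r (4 * int N) w * inf_coeff r w) w"
      by (rule conv_character) (rule twist_append)
    ultimately show ?thesis by (simp only: inf_coeff_factor[of r, OF assms])
  qed
  moreover have "?d [] = 1" by (simp add: twist_def)
  ultimately have "twist r (- 2 * int N) w * finite_coeff r N w = conv_div ?c ?d w"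
    using conv_div_unique[of ?d "\<lambda>w. twist r (- 2 * int N) w * finite_coeff r N w" ?c w] by blast
  moreover have "conv (\<lambda>w. eval_a (int N) (F_coeff r w)) ?d w = ?c w" for w
  proof -
    have "eval_a (int N) (conv (F_coeff r) (\<lambda>w. Poly_Mapping.single (wrot r w) (inf_coeff r w)) w) = ?c w"
      unfolding F_coeff_def by (subst conv_conv_div) (simp_all add: single_one twist_def mult_ac)
    then show ?thesis
      by (subst (asm) conv_hom[of "eval_a (int N)"]) (simp_all add: eval_a_add eval_a_mult twist_def mult_ac)
  qed
  ultimately show ?thesis
    using conv_div_unique[of ?d "\<lambda>w. eval_a (int N) (F_coeff r w)" ?c w] \<open>?d [] = 1\<close> by simp
qed

text \<open>At a = q^N the left-hand side is the product over the N + 2 colors of A_(N+2). Its first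
  factor comes off by the recursion for \<open>finite_coeff\<close>, its last one by
  \<open>finite_coeff_Suc_right\<close>.\<close>

lemma shift_a_F_coeff:
  assumes "\<And>C. r C > 0"
  shows "shift_a (F_coeff r w) = conv (conv (linear_word (\<lambda>C. aq (- r C) (- of_int (r C) / 2))) (F_coeff r))
     (linear_word (\<lambda>C. aq (r C) (of_int (r C) / 2))) w"
proof (rule eval_a_eqI)
  fix N :: nat
  let ?l = "\<lambda>k. linear_word (\<lambda>C. q4 (k * r C))"
  let ?p = "linear_word (\<lambda>C. aq (- r C) (- of_int (r C) / 2))"
  let ?q = "linear_word (\<lambda>C. aq (r C) (of_int (r C) / 2))"
  have lin: "eval_a (int N) (linear_word f w) = linear_word (\<lambda>C. eval_a (int N) (f C)) w" for f :: "'a \<Rightarrow> laurent" and w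
    by (simp add: linear_word_def split: list.splits)
  \<comment> \<open>The constant is four times -(N+1)/2, the lowest color of A_(N+2).\<close>
  have p: "(\<lambda>w. eval_a (int N) (?p w)) = ?l (- 2 * (int N + 2) + 2)"
  proof -
    have "eval_a (int N) (aq (- r C) (- of_int (r C) / 2)) = q4 ((- 2 * (int N + 2) + 2) * r C)" for C
      using qpow_half[of "- r C"]
      by (simp flip: q4_add) (rule arg_cong[of _ _ q4], simp add: algebra_simps)
    then show ?thesis by (simp only: lin)
  qed
  \<comment> \<open>Four times (N+1)/2, the highest color of A_(N+2).\<close>
  have q: "(\<lambda>w. eval_a (int N) (?q w)) = ?l (- 2 * (int N + 2) + (2 + 4 * (1 + int N)))"
  proof -
    have "eval_a (int N) (aq (r C) (of_int (r C) / 2)) = q4 ((- 2 * (int N + 2) + (2 + 4 * (1 + int N))) * r C)" for C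
      using qpow_half[of "r C"]
      by (simp flip: q4_add) (rule arg_cong[of _ _ q4], simp add: algebra_simps)
    then show ?thesis by (simp only: lin)
  qed
  let ?s = "twist r (- 2 * (int N + 2))"
  have "eval_a (int N) (shift_a (F_coeff r w)) = ?s w * finite_coeff r (Suc (Suc N)) w"
    using eval_a_F_coeff[of r "N + 2" w, OF assms] by (simp add: eval_a_shift_a add.commute del: finite_coeff.simps)
  also have "finite_coeff r (Suc (Suc N)) =
      conv (conv (?l 2) (\<lambda>w. twist r 4 w * finite_coeff r N w)) (?l (2 + 4 * (1 + int N)))"
    by (subst finite_coeff_Suc_right) (simp add: mult.commute)
  also have "?s w * \<dots> w = conv (\<lambda>w. ?s w * conv (?l 2) (\<lambda>w. twist r 4 w * finite_coeff r N w) w)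
      (\<lambda>w. ?s w * ?l (2 + 4 * (1 + int N)) w) w"
    by (rule conv_character[symmetric]) (rule twist_append)
  also have "(\<lambda>w. ?s w * conv (?l 2) (\<lambda>w. twist r 4 w * finite_coeff r N w) w) =
      conv (\<lambda>w. ?s w * ?l 2 w) (\<lambda>w. ?s w * (twist r 4 w * finite_coeff r N w))"
    by (rule ext, rule conv_character[symmetric]) (rule twist_append)
  also have "(\<lambda>w. ?s w * ?l 2 w) = (\<lambda>w. eval_a (int N) (?p w))"
    unfolding p by (rule ext) (rule twist_linear_word)
  also have "(\<lambda>w. ?s w * ?l (2 + 4 * (1 + int N)) w) = (\<lambda>w. eval_a (int N) (?q w))"
    unfolding q by (rule ext) (rule twist_linear_word)
  \<comment> \<open>The middle factors are recentred on A_N, because -2(N+2) + 4 = -2N.\<close>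
  also have "(\<lambda>w. ?s w * (twist r 4 w * finite_coeff r N w)) = (\<lambda>w. eval_a (int N) (F_coeff r w))"
    unfolding eval_a_F_coeff[of r N, OF assms] by (rule ext) (simp add: mult.assoc[symmetric] flip: twist_add)
  also have "conv (conv (\<lambda>w. eval_a (int N) (?p w)) (\<lambda>w. eval_a (int N) (F_coeff r w))) (\<lambda>w. eval_a (int N) (?q w)) w =
      eval_a (int N) (conv (conv ?p (F_coeff r)) ?q w)"
    by (simp add: conv_hom[of "eval_a (int N)", OF eval_a_add eval_a_mult eval_a_0])
  finally show "eval_a (int N) (shift_a (F_coeff r w)) = eval_a (int N) (conv (conv ?p (F_coeff r)) ?q w)" .
qed


section \<open>Combinatorics of MOY graphs\<close>

lemma distinct_concat_map:
  assumes "distinct xs" "\<And>x. x \<in> set xs \<Longrightarrow> distinct (f x)"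
    and "\<And>x y. x \<in> set xs \<Longrightarrow> y \<in> set xs \<Longrightarrow> x \<noteq> y \<Longrightarrow> set (f x) \<inter> set (f y) = {}"
  shows "distinct (concat (map f xs))"
  using assms by (induction xs) auto

lemma before_concat_map:
  assumes "x \<in> set xs" "before (f x) a b"
  shows "before (concat (map f xs)) a b"
  using assms by (induction xs) (auto simp: before_append)

locale graph =
  fixes \<Gamma> :: "'e moy_graph"
  assumes moy: "moy_graph \<Gamma>"
begin

definition left_edge :: "complex \<Rightarrow> 'e" where "left_edge v = base_edge (lft \<Gamma> v)"
definition right_edge :: "complex \<Rightarrow> 'e" where "right_edge v = base_edge (rgt \<Gamma> v)"
definition mid_edge :: "complex \<Rightarrow> 'e" where "mid_edge v = base_edge (mid \<Gamma> v)"

lemma finite_verts [simp]: "finite (verts \<Gamma>)" and finite_edges [simp]: "finite (edges \<Gamma>)"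
  using moy by (auto simp: moy_graph_def)

lemma config: "v \<in> verts \<Gamma> \<Longrightarrow> vertex_config \<Gamma> v (lft \<Gamma> v, mid \<Gamma> v, rgt \<Gamma> v)"
proof -
  assume "v \<in> verts \<Gamma>"
  then obtain c where c: "vertex_config \<Gamma> v c" using moy by (auto simp: moy_graph_def)
  then have "(THE c. vertex_config \<Gamma> v c) = c"
    by (intro the_equality) (auto intro: vertex_config_unique)
  then show ?thesis using c by (simp add: lft_def mid_def rgt_def)
qed

lemma config_cases:
  assumes "v \<in> verts \<Gamma>"
  obtains (split) "lft \<Gamma> v = Initial (left_edge v)" "rgt \<Gamma> v = Initial (right_edge v)" "mid \<Gamma> v = Terminal (mid_edge v)"
      "in_edges \<Gamma> v = {mid_edge v}" "out_edges \<Gamma> v = {left_edge v, right_edge v}" "left_edge v \<noteq> right_edge v"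
  | (merge) "lft \<Gamma> v = Terminal (left_edge v)" "rgt \<Gamma> v = Terminal (right_edge v)" "mid \<Gamma> v = Initial (mid_edge v)"
      "out_edges \<Gamma> v = {mid_edge v}" "in_edges \<Gamma> v = {left_edge v, right_edge v}" "left_edge v \<noteq> right_edge v"
proof -
  have inv: "A = {base_edge x}" "x = f (base_edge x)"
    if "f ` A = {x}" "\<And>e. base_edge (f e) = e" for A x and f :: "'e \<Rightarrow> 'e half_edge"
  proof -
    have "A = base_edge ` f ` A" using that(2) by (simp add: image_image)
    then show "A = {base_edge x}" using that(1) by simp
    have "x \<in> f ` A" using that(1) by simp
    then show "x = f (base_edge x)" using that(2) by auto
  qed
  have inv2: "A = {base_edge x, base_edge y}" "x = f (base_edge x)" "y = f (base_edge y)"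
    if "f ` A = {x, y}" "\<And>e. base_edge (f e) = e" for A x y and f :: "'e \<Rightarrow> 'e half_edge"
  proof -
    have "A = base_edge ` f ` A" using that(2) by (simp add: image_image)
    then show "A = {base_edge x, base_edge y}" using that(1) by simp
    have "x \<in> f ` A" "y \<in> f ` A" using that(1) by simp_all
    then show "x = f (base_edge x)" "y = f (base_edge y)" using that(2) by auto
  qed
  note c = config[OF assms, unfolded vertex_config_def, simplified]
  then consider (a) "Terminal ` in_edges \<Gamma> v = {mid \<Gamma> v}" "Initial ` out_edges \<Gamma> v = {lft \<Gamma> v, rgt \<Gamma> v}"
    | (b) "Initial ` out_edges \<Gamma> v = {mid \<Gamma> v}" "Terminal ` in_edges \<Gamma> v = {lft \<Gamma> v, rgt \<Gamma> v}"
    by blast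
  then show ?thesis
  proof cases
    case a
    show ?thesis
      using inv[OF a(1)] inv2[OF a(2)] c by (intro split) (auto simp: left_edge_def right_edge_def mid_edge_def)
  next
    case b
    show ?thesis
      using inv[OF b(1)] inv2[OF b(2)] c by (intro merge) (auto simp: left_edge_def right_edge_def mid_edge_def)
  qed
qed

lemma half_edges_at:
  assumes "v \<in> verts \<Gamma>"
  shows "{lft \<Gamma> v, mid \<Gamma> v, rgt \<Gamma> v} = Initial ` out_edges \<Gamma> v \<union> Terminal ` in_edges \<Gamma> v"
  using assms by (cases rule: config_cases) auto

lemma circles_not_at:
  assumes "v \<in> verts \<Gamma>"
  shows "out_edges \<Gamma> v \<inter> circles \<Gamma> = {}" "in_edges \<Gamma> v \<inter> circles \<Gamma> = {}"
  using assms moy by (auto simp: out_edges_def in_edges_def circles_def moy_graph_def)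

lemma noncircles_eq:
  "edges \<Gamma> - circles \<Gamma> = (\<Union>v\<in>verts \<Gamma>. out_edges \<Gamma> v)"
  "edges \<Gamma> - circles \<Gamma> = (\<Union>v\<in>verts \<Gamma>. in_edges \<Gamma> v)"
proof -
  show "edges \<Gamma> - circles \<Gamma> = (\<Union>v\<in>verts \<Gamma>. out_edges \<Gamma> v)"
    by (auto simp: out_edges_def circles_def)
  have "pathstart (curve \<Gamma> e) \<in> verts \<Gamma> \<longleftrightarrow> pathfinish (curve \<Gamma> e) \<in> verts \<Gamma>" if "e \<in> edges \<Gamma>" for e
    using moy that unfolding moy_graph_def by metis
  then show "edges \<Gamma> - circles \<Gamma> = (\<Union>v\<in>verts \<Gamma>. in_edges \<Gamma> v)"
    by (auto simp: in_edges_def circles_def)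
qed

lemma half_edges_eq:
  "half_edges \<Gamma> = (\<Union>v\<in>verts \<Gamma>. {lft \<Gamma> v, mid \<Gamma> v, rgt \<Gamma> v}) \<union> Circle ` circles \<Gamma>"
proof -
  have "half_edges \<Gamma> = Initial ` (\<Union>v\<in>verts \<Gamma>. out_edges \<Gamma> v) \<union>
      Terminal ` (\<Union>v\<in>verts \<Gamma>. in_edges \<Gamma> v) \<union> Circle ` circles \<Gamma>"
    unfolding half_edges_def using noncircles_eq by simp
  also have "\<dots> = (\<Union>v\<in>verts \<Gamma>. Initial ` out_edges \<Gamma> v \<union> Terminal ` in_edges \<Gamma> v) \<union> Circle ` circles \<Gamma>"
    by auto
  finally show ?thesis using half_edges_at by simp
qed

lemma half_edges_disjoint:
  assumes "v \<in> verts \<Gamma>" "w \<in> verts \<Gamma>" "v \<noteq> w"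
  shows "{lft \<Gamma> v, mid \<Gamma> v, rgt \<Gamma> v} \<inter> {lft \<Gamma> w, mid \<Gamma> w, rgt \<Gamma> w} = {}"
  unfolding half_edges_at[OF assms(1)] half_edges_at[OF assms(2)]
  using assms(3) by (auto simp: out_edges_def in_edges_def)

text \<open>A loop can make the middle edge equal to a side edge; the half-edges still differ, one
  being initial and the other terminal.\<close>

lemma half_edges_distinct:
  assumes "v \<in> verts \<Gamma>"
  shows "lft \<Gamma> v \<noteq> rgt \<Gamma> v" "lft \<Gamma> v \<noteq> mid \<Gamma> v" "mid \<Gamma> v \<noteq> rgt \<Gamma> v"
  using assms by (cases rule: config_cases; simp)+

lemma finite_circles [simp]: "finite (circles \<Gamma>)"
  by (rule finite_subset[OF _ finite_edges]) (auto simp: circles_def)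

lemma finite_half_edges [simp]: "finite (half_edges \<Gamma>)"
  by (simp add: half_edges_eq)

lemma half_edges_in: "v \<in> verts \<Gamma> \<Longrightarrow> lft \<Gamma> v \<in> half_edges \<Gamma>" "v \<in> verts \<Gamma> \<Longrightarrow> rgt \<Gamma> v \<in> half_edges \<Gamma>"
  by (auto simp: half_edges_eq)

lemma base_edge_half_edges: "base_edge ` half_edges \<Gamma> = edges \<Gamma>"
  unfolding half_edges_def image_Un image_image by (auto simp: circles_def)

lemma finite_cycles [simp]: "finite (cycles \<Gamma>)"
  by (rule finite_subset[of _ "Pow (edges \<Gamma>)"]) (auto simp: cycles_def)

lemma cycle_at:
  assumes "C \<in> cycles \<Gamma>" "v \<in> verts \<Gamma>"
  shows "mid_edge v \<in> C \<longleftrightarrow> left_edge v \<in> C \<or> right_edge v \<in> C" "\<not> (left_edge v \<in> C \<and> right_edge v \<in> C)"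
proof -
  have c: "card (C \<inter> in_edges \<Gamma> v) + card (C \<inter> out_edges \<Gamma> v) \<in> {0, 2}"
      "card (C \<inter> in_edges \<Gamma> v) = card (C \<inter> out_edges \<Gamma> v)"
    using assms by (auto simp: cycles_def)
  have i: "C \<inter> insert x A = (if x \<in> C then insert x (C \<inter> A) else C \<inter> A)" for x A by auto
  show "mid_edge v \<in> C \<longleftrightarrow> left_edge v \<in> C \<or> right_edge v \<in> C" "\<not> (left_edge v \<in> C \<and> right_edge v \<in> C)"
    using assms(2) c by (cases rule: config_cases; auto simp: i split: if_splits)+
qed

text \<open>Twice the bilinear extension of \<open>cycle_pairing\<close> from cycles to flows, so
  that its values are integers.\<close>

definition flow_pairing :: "('e \<Rightarrow> nat) \<Rightarrow> ('e \<Rightarrow> nat) \<Rightarrow> int" where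
  "flow_pairing \<gamma> \<delta> = (\<Sum>v\<in>verts \<Gamma>. int (\<gamma> (left_edge v)) * int (\<delta> (right_edge v)) - int (\<gamma> (right_edge v)) * int (\<delta> (left_edge v)))"

abbreviation cycle_flow_pairing :: "'e set \<Rightarrow> 'e set \<Rightarrow> int" where
  "cycle_flow_pairing C D \<equiv> flow_pairing (indicator C) (indicator D)"

lemma flow_pairing_swap: "flow_pairing \<delta> \<gamma> = - flow_pairing \<gamma> \<delta>"
  by (simp add: flow_pairing_def algebra_simps flip: sum_negf)

lemma cycle_pairing_eq: "cycle_pairing \<Gamma> C D = of_int (cycle_flow_pairing C D) / 2"
proof -
  have "int (card {v \<in> verts \<Gamma>. base_edge (lft \<Gamma> v) \<in> C \<and> base_edge (rgt \<Gamma> v) \<in> D}) =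
      (\<Sum>v\<in>verts \<Gamma>. int (indicator C (left_edge v)) * int (indicator D (right_edge v)))" for C D
  proof -
    have "card {v \<in> verts \<Gamma>. base_edge (lft \<Gamma> v) \<in> C \<and> base_edge (rgt \<Gamma> v) \<in> D} =
        (\<Sum>v\<in>verts \<Gamma>. if base_edge (lft \<Gamma> v) \<in> C \<and> base_edge (rgt \<Gamma> v) \<in> D then 1 else 0)"
      unfolding card_eq_sum by (rule sum.inter_filter) simp
    also have "\<dots> = (\<Sum>v\<in>verts \<Gamma>. indicator C (left_edge v) * indicator D (right_edge v))"
      by (intro sum.cong) (auto simp: left_edge_def right_edge_def)
    finally show ?thesis by (simp only: of_nat_sum of_nat_mult)
  qed
  note this[of C D] this[of D C]
  then have "cycle_flow_pairing C D = int (card {v \<in> verts \<Gamma>. base_edge (lft \<Gamma> v) \<in> C \<and> base_edge (rgt \<Gamma> v) \<in> D}) -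
      int (card {v \<in> verts \<Gamma>. base_edge (lft \<Gamma> v) \<in> D \<and> base_edge (rgt \<Gamma> v) \<in> C})"
    by (simp add: flow_pairing_def sum_subtractf mult.commute)
  then show ?thesis
    unfolding cycle_pairing_def by (simp add: conj_commute)
qed

text \<open>Modulo 2, the pairing counts the vertices at which the two cycles take different branches. These
  are exactly the vertices of odd degree in the intersection of the cycles.\<close>

lemma even_cycle_flow_pairing:
  assumes "C \<in> cycles \<Gamma>" "D \<in> cycles \<Gamma>"
  shows "even (cycle_flow_pairing C D)"
proof -
  let ?E = "C \<inter> D - circles \<Gamma>"
  have sub: "?E \<subseteq> edges \<Gamma> - circles \<Gamma>" using assms by (auto simp: cycles_def)
  have fE: "finite ?E" using sub finite_edges by (meson finite_Diff finite_subset)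
  have out: "(\<Sum>v\<in>verts \<Gamma>. card (?E \<inter> out_edges \<Gamma> v)) = card ?E"
  proof -
    have "card (\<Union>v\<in>verts \<Gamma>. ?E \<inter> out_edges \<Gamma> v) = (\<Sum>v\<in>verts \<Gamma>. card (?E \<inter> out_edges \<Gamma> v))"
      using fE by (intro card_UN_disjoint) (auto simp: out_edges_def)
    moreover have "(\<Union>v\<in>verts \<Gamma>. ?E \<inter> out_edges \<Gamma> v) = ?E"
      using sub unfolding noncircles_eq(1) by blast
    ultimately show ?thesis by simp
  qed
  have inn: "(\<Sum>v\<in>verts \<Gamma>. card (?E \<inter> in_edges \<Gamma> v)) = card ?E"
  proof -
    have "card (\<Union>v\<in>verts \<Gamma>. ?E \<inter> in_edges \<Gamma> v) = (\<Sum>v\<in>verts \<Gamma>. card (?E \<inter> in_edges \<Gamma> v))"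
      using fE by (intro card_UN_disjoint) (auto simp: in_edges_def)
    moreover have "(\<Union>v\<in>verts \<Gamma>. ?E \<inter> in_edges \<Gamma> v) = ?E"
      using sub unfolding noncircles_eq(2) by blast
    ultimately show ?thesis by simp
  qed
  let ?t = "\<lambda>v. int (indicator C (left_edge v)) * int (indicator D (right_edge v)) -
    int (indicator C (right_edge v)) * int (indicator D (left_edge v))"
  \<comment> \<open>If both cycles pass \<open>v\<close> on different branches, they share only the
    middle half-edge there and \<open>?t v\<close> is 1 or -1; otherwise \<open>?t v\<close> is 0
    and they share no or two half-edges.\<close>
  have "even (?t v + int (card (?E \<inter> out_edges \<Gamma> v) + card (?E \<inter> in_edges \<Gamma> v)))" if v: "v \<in> verts \<Gamma>" for v
  proof -
    have i: "(A - B) \<inter> insert x S = (if x \<in> A - B then insert x ((A - B) \<inter> S) else (A - B) \<inter> S)"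
      for A B S and x :: 'e by auto
    show ?thesis
      using v
      by (cases rule: config_cases)
        (use cycle_at[OF assms(1) v] cycle_at[OF assms(2) v] circles_not_at[OF v] in
          \<open>auto simp: i indicator_def\<close>)
  qed
  then have "even (\<Sum>v\<in>verts \<Gamma>. ?t v + int (card (?E \<inter> out_edges \<Gamma> v) + card (?E \<inter> in_edges \<Gamma> v)))"
    by (rule dvd_sum)
  also have "(\<Sum>v\<in>verts \<Gamma>. ?t v + int (card (?E \<inter> out_edges \<Gamma> v) + card (?E \<inter> in_edges \<Gamma> v))) =
      cycle_flow_pairing C D + 2 * int (card ?E)"
    using out inn by (simp add: flow_pairing_def sum.distrib flip: of_nat_sum)
  finally show ?thesis by simp
qed

lemma rot_empty [simp]: "rot \<Gamma> {} = 0"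
  by (auto simp: rot_def connected_cycles_def intro!: sum.neutral)

section \<open>Exponents of colorings\<close>

lemma count_zexponent:
  "count (zexponent \<Gamma> \<gamma>) (Lower h) = (if h \<in> half_edges \<Gamma> then \<gamma> (base_edge h) else 0)"
  "count (zexponent \<Gamma> \<gamma>) (Upper h) = (if h \<in> half_edges \<Gamma> then \<gamma> (base_edge h) else 0)"
proof -
  have "count (zexponent \<Gamma> \<gamma>) (Lower h) = (\<Sum>h'\<in>half_edges \<Gamma>. if h' = h then \<gamma> (base_edge h') else 0)"
    unfolding zexponent_def count_sum by (intro sum.cong) auto
  moreover have "count (zexponent \<Gamma> \<gamma>) (Upper h) = (\<Sum>h'\<in>half_edges \<Gamma>. if h' = h then \<gamma> (base_edge h') else 0)"
    unfolding zexponent_def count_sum by (intro sum.cong) auto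
  ultimately show "count (zexponent \<Gamma> \<gamma>) (Lower h) = (if h \<in> half_edges \<Gamma> then \<gamma> (base_edge h) else 0)"
    "count (zexponent \<Gamma> \<gamma>) (Upper h) = (if h \<in> half_edges \<Gamma> then \<gamma> (base_edge h) else 0)"
    by simp_all
qed

lemma zexponent_sum: "zexponent \<Gamma> (\<lambda>e. \<gamma> e + \<delta> e) = zexponent \<Gamma> \<gamma> + zexponent \<Gamma> \<delta>"
proof (rule multiset_eqI)
  fix x show "count (zexponent \<Gamma> (\<lambda>e. \<gamma> e + \<delta> e)) x = count (zexponent \<Gamma> \<gamma> + zexponent \<Gamma> \<delta>) x"
    by (cases x) (simp_all add: count_zexponent)
qed

text \<open>Every edge has a half-edge, so the exponent recovers the coloring; a coefficient of
  \<open>F_series\<close> therefore involves at most one coloring.\<close>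

lemma zexponent_inj:
  assumes "coloring \<Gamma> \<gamma>" "coloring \<Gamma> \<delta>" "zexponent \<Gamma> \<gamma> = zexponent \<Gamma> \<delta>"
  shows "\<gamma> = \<delta>"
proof
  fix e
  show "\<gamma> e = \<delta> e"
  proof (cases "e \<in> edges \<Gamma>")
    case True
    then obtain h where "h \<in> half_edges \<Gamma>" "e = base_edge h"
      using base_edge_half_edges by blast
    then show ?thesis using assms(3) count_zexponent(1)[of _ h] by metis
  next
    case False
    then show ?thesis using assms by (simp add: coloring_def)
  qed
qed

end


section \<open>The homomorphism from cycle to half-edge variables\<close>

locale positive_graph = graph \<Gamma> for \<Gamma> :: "'e moy_graph" +
  fixes vs :: "complex list" and fs :: "'e list" and cs :: "'e set list"
  assumes positive: "positive_moy \<Gamma>"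
    and vs: "distinct vs" "set vs = verts \<Gamma>"
    and fs: "distinct fs" "set fs = circles \<Gamma>"
    and cs: "distinct cs" "set cs = cycles \<Gamma> - {{}}"
begin

abbreviation Z :: "'e half_edge zvar qvars" where "Z \<equiv> zvars \<Gamma> vs fs"
abbreviation X :: "'e set qvars" where "X \<equiv> xvars \<Gamma> cs"
abbreviation zexp :: "'e set \<Rightarrow> 'e half_edge zvar multiset" where "zexp C \<equiv> zexponent \<Gamma> (indicator C)"

definition block :: "complex \<Rightarrow> 'e half_edge zvar list" where
  "block v = [Lower (lft \<Gamma> v), Lower (mid \<Gamma> v), Lower (rgt \<Gamma> v),
            Upper (rgt \<Gamma> v), Upper (mid \<Gamma> v), Upper (lft \<Gamma> v)]"

lemma vars_Z: "vars Z = concat (map block vs) @ concat (map (\<lambda>e. [Lower (Circle e), Upper (Circle e)]) fs)"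
  by (simp add: zvars_def block_def[abs_def])

lemma set_vars_Z: "set (vars Z) = Lower ` half_edges \<Gamma> \<union> Upper ` half_edges \<Gamma>"
  unfolding vars_Z half_edges_eq by (auto simp: block_def vs fs)

lemma distinct_vars_Z: "distinct (vars Z)"
proof -
  have "distinct (concat (map block vs))"
  proof (rule distinct_concat_map)
    show "distinct (block v)" if "v \<in> set vs" for v
      using half_edges_distinct[of v] that vs by (auto simp: block_def)
    show "set (block v) \<inter> set (block w) = {}" if "v \<in> set vs" "w \<in> set vs" "v \<noteq> w" for v w
      using half_edges_disjoint[of v w] that vs by (auto simp: block_def)
  qed (fact vs)
  moreover have "distinct (concat (map (\<lambda>e. [Lower (Circle e), Upper (Circle e)]) fs))"
    using fs by (intro distinct_concat_map) auto
  moreover have "set (block v) \<inter> {Lower (Circle e), Upper (Circle e)} = {}" if "v \<in> verts \<Gamma>" for v e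
    using that by (cases rule: config_cases) (auto simp: block_def)
  ultimately show ?thesis
    unfolding vars_Z by (auto simp: vs)
qed

lemma qexp_Z: "qexp Z x y =
    (if \<exists>v\<in>verts \<Gamma>. (x, y) = (Lower (rgt \<Gamma> v), Lower (lft \<Gamma> v)) \<or>
        (x, y) = (Upper (rgt \<Gamma> v), Upper (lft \<Gamma> v)) then -1/4
     else if \<exists>v\<in>verts \<Gamma>. (x, y) = (Lower (lft \<Gamma> v), Lower (rgt \<Gamma> v)) \<or>
        (x, y) = (Upper (lft \<Gamma> v), Upper (rgt \<Gamma> v)) then 1/4 else 0)"
  by (simp add: zvars_def)

lemma same_vertex:
  assumes "v \<in> verts \<Gamma>" "w \<in> verts \<Gamma>" "{lft \<Gamma> v, rgt \<Gamma> v} \<inter> {lft \<Gamma> w, rgt \<Gamma> w} \<noteq> {}"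
  shows "v = w"
  using half_edges_disjoint[OF assms(1,2)] assms(3) by auto

lemma lft_ne_rgt: "v \<in> verts \<Gamma> \<Longrightarrow> w \<in> verts \<Gamma> \<Longrightarrow> lft \<Gamma> v \<noteq> rgt \<Gamma> w"
  using same_vertex[of v w] half_edges_distinct by auto

lemma before_Z:
  assumes "v \<in> verts \<Gamma>"
  shows "before (vars Z) (Lower (lft \<Gamma> v)) (Lower (rgt \<Gamma> v))"
    "before (vars Z) (Upper (rgt \<Gamma> v)) (Upper (lft \<Gamma> v))"
    "\<not> before (vars Z) (Lower (rgt \<Gamma> v)) (Lower (lft \<Gamma> v))"
    "\<not> before (vars Z) (Upper (lft \<Gamma> v)) (Upper (rgt \<Gamma> v))"
proof -
  have "before (block v) (Lower (lft \<Gamma> v)) (Lower (rgt \<Gamma> v))"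
    "before (block v) (Upper (rgt \<Gamma> v)) (Upper (lft \<Gamma> v))"
    by (auto simp: block_def before_Cons)
  then show *: "before (vars Z) (Lower (lft \<Gamma> v)) (Lower (rgt \<Gamma> v))"
    "before (vars Z) (Upper (rgt \<Gamma> v)) (Upper (lft \<Gamma> v))"
    unfolding vars_Z using assms vs by (auto simp: before_append intro: before_concat_map)
  show "\<not> before (vars Z) (Lower (rgt \<Gamma> v)) (Lower (lft \<Gamma> v))"
    "\<not> before (vars Z) (Upper (lft \<Gamma> v)) (Upper (rgt \<Gamma> v))"
    using * before_antisym[OF distinct_vars_Z] by blast+
qed

lemma brel_Z:
  "brel Z (Lower h) (Upper h') = 0" "brel Z (Upper h) (Lower h') = 0"
  "brel Z (Lower h) (Lower h') = (\<Sum>v\<in>verts \<Gamma>. if h = rgt \<Gamma> v \<and> h' = lft \<Gamma> v then - 1/4 else 0)"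
  "brel Z (Upper h) (Upper h') = (\<Sum>v\<in>verts \<Gamma>. if h = lft \<Gamma> v \<and> h' = rgt \<Gamma> v then 1/4 else 0)"
proof -
  show "brel Z (Lower h) (Upper h') = 0" "brel Z (Upper h) (Lower h') = 0"
    by (auto simp: brel_def qexp_Z)
  \<comment> \<open>A half-edge belongs to a single vertex, so a case distinction over the vertices
    equals a sum over them; sums can be interchanged in \<open>cross_zexponent\<close>.\<close>
  have one: "(\<Sum>v\<in>verts \<Gamma>. if P v then c else 0) = (if \<exists>v\<in>verts \<Gamma>. P v then c else (0::rat))"
    if "\<And>v w. v \<in> verts \<Gamma> \<Longrightarrow> w \<in> verts \<Gamma> \<Longrightarrow> P v \<Longrightarrow> P w \<Longrightarrow> v = w" for P c
  proof (cases "\<exists>v\<in>verts \<Gamma>. P v")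
    case True
    then obtain v where v: "v \<in> verts \<Gamma>" "P v" by blast
    have "(\<Sum>w\<in>verts \<Gamma>. if P w then c else 0) = (\<Sum>w\<in>verts \<Gamma>. if w = v then c else 0)"
      using that v by (intro sum.cong) auto
    then show ?thesis using v True by simp
  next
    case False
    then show ?thesis by (auto intro!: sum.neutral)
  qed
  show "brel Z (Lower h) (Lower h') = (\<Sum>v\<in>verts \<Gamma>. if h = rgt \<Gamma> v \<and> h' = lft \<Gamma> v then - 1/4 else 0)"
    using before_Z lft_ne_rgt by (subst one) (auto simp: brel_def qexp_Z intro: same_vertex)
  show "brel Z (Upper h) (Upper h') = (\<Sum>v\<in>verts \<Gamma>. if h = lft \<Gamma> v \<and> h' = rgt \<Gamma> v then 1/4 else 0)"
    using before_Z lft_ne_rgt by (subst one) (auto simp: brel_def qexp_Z intro: same_vertex)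
qed

text \<open>The lower variables pay -1/4 for right before left, the upper ones, being ordered the
  other way round, 1/4 for left before right. The reversed order is what makes the total cost
  antisymmetric.\<close>

lemma cross_zexponent: "cross Z (zexponent \<Gamma> \<gamma>) (zexponent \<Gamma> \<delta>) = of_int (flow_pairing \<gamma> \<delta>) / 4"
proof -
  let ?g = "\<lambda>h. (of_nat (\<gamma> (base_edge h)) :: rat)" and ?d = "\<lambda>h. (of_nat (\<delta> (base_edge h)) :: rat)"
  let ?H = "half_edges \<Gamma>"
  let ?b = "\<lambda>h h' v. (if h = rgt \<Gamma> v \<and> h' = lft \<Gamma> v then - 1/4 else 0) +
    (if h = lft \<Gamma> v \<and> h' = rgt \<Gamma> v then 1/4 else (0 :: rat))"
  have c: "cross Z {#Lower h, Upper h#} {#Lower h', Upper h'#} = (\<Sum>v\<in>verts \<Gamma>. ?b h h' v)" for h h'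
    by (simp add: cross_def brel_Z sum.distrib)
  have "cross Z (zexponent \<Gamma> \<gamma>) (zexponent \<Gamma> \<delta>) =
      (\<Sum>h\<in>?H. \<Sum>h'\<in>?H. \<Sum>v\<in>verts \<Gamma>. ?g h * ?d h' * ?b h h' v)"
    unfolding zexponent_def cross_sum cross_repeat c by (simp add: sum_distrib_left mult_ac)
  also have "\<dots> = (\<Sum>v\<in>verts \<Gamma>. \<Sum>h\<in>?H. \<Sum>h'\<in>?H. ?g h * ?d h' * ?b h h' v)"
    by (subst sum.swap[of _ "verts \<Gamma>"]) (rule sum.swap)
  also have "\<dots> = (\<Sum>v\<in>verts \<Gamma>. (?g (lft \<Gamma> v) * ?d (rgt \<Gamma> v) - ?g (rgt \<Gamma> v) * ?d (lft \<Gamma> v)) / 4)"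
  proof (intro sum.cong refl)
    fix v assume v: "v \<in> verts \<Gamma>"
    have "(\<Sum>h'\<in>?H. ?g h * ?d h' * ?b h h' v) =
        (if h = rgt \<Gamma> v then - (?g h * ?d (lft \<Gamma> v) / 4) else 0) +
        (if h = lft \<Gamma> v then ?g h * ?d (rgt \<Gamma> v) / 4 else 0)" for h
    proof -
      have "(\<Sum>h'\<in>?H. ?g h * ?d h' * ?b h h' v) =
        (\<Sum>h'\<in>?H. if h' = lft \<Gamma> v then if h = rgt \<Gamma> v then - (?g h * ?d h' / 4) else 0 else 0) +
        (\<Sum>h'\<in>?H. if h' = rgt \<Gamma> v then if h = lft \<Gamma> v then ?g h * ?d h' / 4 else 0 else 0)"
        unfolding sum.distrib[symmetric] by (intro sum.cong) (auto simp: distrib_left)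
      then show ?thesis using half_edges_in[OF v] by simp
    qed
    then show "(\<Sum>h\<in>?H. \<Sum>h'\<in>?H. ?g h * ?d h' * ?b h h' v) =
        (?g (lft \<Gamma> v) * ?d (rgt \<Gamma> v) - ?g (rgt \<Gamma> v) * ?d (lft \<Gamma> v)) / 4"
      using half_edges_in[OF v] by (simp add: sum.distrib diff_divide_distrib)
  qed
  also have "\<dots> = of_int (flow_pairing \<gamma> \<delta>) / 4"
    by (simp add: flow_pairing_def left_edge_def right_edge_def sum_divide_distrib)
  finally show ?thesis .
qed

lemma zexponent_nonempty: "C \<in> set cs \<Longrightarrow> zexp C \<noteq> {#}"
proof
  assume C: "C \<in> set cs" and z: "zexp C = {#}"
  then obtain e where e: "e \<in> C" "e \<in> edges \<Gamma>" using cs by (auto simp: cycles_def)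
  then obtain h where h: "h \<in> half_edges \<Gamma>" "e = base_edge h"
    using base_edge_half_edges by blast
  then have "count (zexp C) (Lower h) = 1" using e by (simp add: count_zexponent)
  then show False using z by simp
qed

lemma vars_X [simp]: "vars X = cs" and qexp_X [simp]: "qexp X = cycle_pairing \<Gamma>"
  by (simp_all add: xvars_def)

sublocale x: word_series X "\<lambda>C. {#C#}" "set cs"
proof
  have "4 * (of_int k / 2 :: rat) \<in> \<int>" for k
  proof -
    have "4 * (of_int k / 2 :: rat) = of_int (2 * k)" by simp
    then show ?thesis by (simp only: Ints_of_int)
  qed
  then show "4 * qexp X C D \<in> \<int>" for C D
    by (simp add: cycle_pairing_eq)
qed (use cs in auto)

sublocale z: word_series Z zexp "set cs"
proof
  show "4 * qexp Z C D \<in> \<int>" for C D by (simp add: qexp_Z)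
qed (auto simp: distinct_vars_Z zexponent_nonempty)

lemma reorder_z: "reorder Z (z.word w) = pairsum (\<lambda>C D. of_int (cycle_flow_pairing C D) / 4) w"
  unfolding z.reorder_word cross_zexponent ..

text \<open>Here the evenness of the pairing removes the odd powers of q^(1/4).\<close>

lemma reorder_z_half:
  assumes "set w \<subseteq> set cs"
  shows "\<exists>k. reorder Z (z.word w) = of_int k / 2"
  using assms
proof (induction w)
  case (Cons C w)
  have "\<exists>k. (\<Sum>D\<in>#mset u. (of_int (cycle_flow_pairing C D) / 4 :: rat)) = of_int k / 2" if "set u \<subseteq> set cs" for u
    using that
  proof (induction u)
    case (Cons D u)
    then obtain k where "(\<Sum>D\<in>#mset u. (of_int (cycle_flow_pairing C D) / 4 :: rat)) = of_int k / 2" by auto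
    moreover obtain l where "cycle_flow_pairing C D = 2 * l"
      using even_cycle_flow_pairing[of C D] \<open>set (C # w) \<subseteq> set cs\<close> Cons.prems cs by (auto elim!: evenE)
    ultimately show ?case by (intro exI[of _ "k + l"]) (simp add: add_divide_distrib)
  qed (simp add: exI[of _ 0])
  then obtain k where k: "(\<Sum>D\<in>#mset w. (of_int (cycle_flow_pairing C D) / 4 :: rat)) = of_int k / 2"
    using Cons.prems by auto
  obtain l where "reorder Z (z.word w) = of_int l / 2" using Cons by auto
  then show ?case using k unfolding reorder_z
    by (intro exI[of _ "k + l"]) (simp add: add_divide_distrib)
qed (simp add: exI[of _ 0])

lemma x_word: "set w \<subseteq> set cs \<Longrightarrow> x.word w = w"
proof (induction w)
  case (Cons C w)
  then show ?case using std_word_single[of X C] x.dist by simp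
qed simp

lemma mset_std_word_X: "set_mset m \<subseteq> set cs \<Longrightarrow> mset (std_word X m) = m"
  by (auto simp: mset_std_word[OF x.dist] multiset_eq_iff not_in_iff)

lemma x_weight: "x.weight w = mset w"
  by (induction w) simp_all

text \<open>Well-definedness of \<open>\<mu>\<close>: reordering a word of cycles costs the same power of \<open>q\<close> on both
  sides, because the difference of the exponents is a sum of symmetric terms.\<close>

lemma reorder_x_z:
  assumes w: "set w \<subseteq> set cs"
  shows "reorder X w + reorder Z (z.word (std_word X (mset w))) = reorder Z (z.word w)"
proof -
  let ?g = "\<lambda>C D. brel X C D - of_int (cycle_flow_pairing C D) / 4"
  let ?s = "std_word X (mset w)"
  have ms: "mset ?s = mset w"
    using w by (simp add: mset_std_word_X)
  \<comment> \<open>For distinct cycles exactly one of the two orders is wrong, so swapping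
    \<open>C\<close> and \<open>D\<close> changes \<open>brel X\<close> by the cycle pairing. The
    quarter terms change by two quarters of \<open>cycle_flow_pairing\<close>, which is the same
    number.\<close>
  have sym: "?g C D = ?g D C" if "C \<in> set cs" "D \<in> set cs" for C D
  proof (cases "C = D")
    case False
    then have "before cs C D \<noteq> before cs D C" using before_total[of cs C D] that cs by simp
    moreover have "cycle_pairing \<Gamma> D C = - cycle_pairing \<Gamma> C D"
      by (simp add: cycle_pairing_eq flow_pairing_swap[of "indicator D"])
    ultimately show ?thesis
      by (auto simp: brel_def flow_pairing_swap[of "indicator D"] cycle_pairing_eq[of C D])
  qed simp
  have "2 * pairsum ?g u = (\<Sum>C\<in>#mset w. \<Sum>D\<in>#mset w. ?g C D) - (\<Sum>C\<in>#mset w. ?g C C)"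
    if u: "mset u = mset w" for u
  proof -
    have "set u = set w" using u by (metis set_mset_mset)
    then have "?g C D = ?g D C" if "C \<in># mset u" "D \<in># mset u" for C D
      using that w by (intro sym) auto
    then show ?thesis using pairsum_symmetric[of u ?g] u by simp
  qed
  from this[of w] this[of ?s] ms have "pairsum ?g w = pairsum ?g ?s" by simp
  then have "reorder X w - reorder Z (z.word w) = reorder X ?s - reorder Z (z.word ?s)"
    by (simp add: pairsum_diff reorder_z reorder_eq_pairsum[of X])
  then show ?thesis using x.dist by simp
qed

lemma mu_mono_eq:
  "mu_mono \<Gamma> vs fs cs m n =
    aq 0 (reorder Z (z.word (std_word X m))) * qmono (z.weight (std_word X m)) n"
proof -
  have scale: "qmult Z f (\<lambda>m. k * g m) = (\<lambda>m. k * qmult Z f g m)" for f g k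
    unfolding qmult_def sum_distrib_left by (intro ext sum.cong) (auto simp: mult_ac)
  have "foldr (\<lambda>C g. qmult Z (qmono (zexp C)) g) w (qmono {#}) =
      (\<lambda>n. aq 0 (reorder Z (z.word w)) * qmono (z.weight w) n)" for w
  proof (induction w)
    case (Cons C w)
    have "aq 0 (reorder Z (z.word (C # w))) = aq 0 (reorder Z (z.word w)) *
        aq 0 (reorder Z (std_word Z (zexp C) @ std_word Z (z.weight w)))"
      using z.aq_reorder_append[of "[C]" w] z.dist by simp
    then show ?case
      using Cons by (simp add: scale qmult_qmono mult.assoc)
  qed simp
  then show ?thesis by (simp add: mu_mono_def)
qed

text \<open>Words with the same multiset of letters contribute to the same standard monomial in the
  \<open>x_C\<close>. By \<open>reorder_x_z\<close>, sorting the cycles and then their half-edge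
  variables costs as much as sorting the latter at once.\<close>

lemma mu_wsum: "mu \<Gamma> vs fs cs (x.wsum c) = z.wsum c"
proof
  fix n
  let ?S = "{w. set w \<subseteq> set cs \<and> z.weight w = n}"
  note ms = mset_std_word_X
  have weight_mset: "z.weight w = (\<Sum>C\<in>#mset w. zexp C)" for w
    by (induction w) simp_all
  have nz: "aq 0 r \<noteq> 0" for r
    by (metis aq_def lookup_single_eq lookup_zero qpow_eq_q4 q4_nonzero)
  \<comment> \<open>Only finitely many standard monomials contribute at \<open>n\<close>, which
    makes the infinite linear extension in \<open>mu\<close> a finite sum.\<close>
  have T: "{m. set_mset m \<subseteq> set cs \<and> mu_mono \<Gamma> vs fs cs m n \<noteq> 0} = mset ` ?S"
  proof (intro equalityI subsetI)
    fix m assume "m \<in> {m. set_mset m \<subseteq> set cs \<and> mu_mono \<Gamma> vs fs cs m n \<noteq> 0}"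
    then have m: "set_mset m \<subseteq> set cs" "z.weight (std_word X m) = n"
      by (auto simp: mu_mono_eq qmono_def split: if_splits)
    then have "std_word X m \<in> ?S" using ms by (metis (mono_tags, lifting) mem_Collect_eq set_mset_mset)
    then show "m \<in> mset ` ?S" using ms[OF m(1)] by (intro image_eqI[of _ _ "std_word X m"]) simp_all
  next
    fix m assume "m \<in> mset ` ?S"
    then obtain w where w: "m = mset w" "set w \<subseteq> set cs" "z.weight w = n" by auto
    then have "z.weight (std_word X m) = n" using ms[of m] by (simp add: weight_mset)
    then show "m \<in> {m. set_mset m \<subseteq> set cs \<and> mu_mono \<Gamma> vs fs cs m n \<noteq> 0}"
      using w nz by (simp add: mu_mono_eq qmono_def)
  qed
  have "mu \<Gamma> vs fs cs (x.wsum c) n =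
      (\<Sum>m\<in>mset ` ?S. \<Sum>w | w \<in> ?S \<and> mset w = m. c w * aq 0 (reorder Z (z.word w)))"
    unfolding mu_def T
  proof (intro sum.cong refl)
    fix m assume "m \<in> mset ` ?S"
    then obtain u where u: "m = mset u" "set u \<subseteq> set cs" "z.weight u = n" by auto
    have w: "z.weight w = n" if "mset w = m" for w
      using that u by (simp add: weight_mset)
    have "z.weight (std_word X m) = n"
      using ms[of m] u by (intro w) simp
    then have mm: "mu_mono \<Gamma> vs fs cs m n = aq 0 (reorder Z (z.word (std_word X m)))"
      by (simp add: mu_mono_eq qmono_def)
    have "x.wsum c m * mu_mono \<Gamma> vs fs cs m n =
        (\<Sum>w | set w \<subseteq> set cs \<and> mset w = m. c w * aq 0 (reorder X (x.word w)) *
          aq 0 (reorder Z (z.word (std_word X m))))"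
      by (simp add: x.wsum_def x_weight mm sum_distrib_right)
    also have "\<dots> = (\<Sum>w | w \<in> ?S \<and> mset w = m. c w * aq 0 (reorder Z (z.word w)))"
    proof (rule sum.cong)
      show "{w. set w \<subseteq> set cs \<and> mset w = m} = {w. w \<in> ?S \<and> mset w = m}" using w by auto
      fix v assume "v \<in> {w. w \<in> ?S \<and> mset w = m}"
      then have v: "set v \<subseteq> set cs" "mset v = m" by auto
      have "aq 0 (reorder X v) * aq 0 (reorder Z (z.word (std_word X m))) = aq 0 (reorder Z (z.word v))"
        using reorder_x_z[OF v(1)] v(2)
        by (subst aq_mult) (simp_all add: Ints_reorder[OF x.ints] Ints_reorder[OF z.ints])
      then show "c v * aq 0 (reorder X (x.word v)) * aq 0 (reorder Z (z.word (std_word X m))) =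
          c v * aq 0 (reorder Z (z.word v))"
        using v by (simp add: x_word mult.assoc)
    qed
    finally show "x.wsum c m * mu_mono \<Gamma> vs fs cs m n =
        (\<Sum>w | w \<in> ?S \<and> mset w = m. c w * aq 0 (reorder Z (z.word w)))" .
  qed
  also have "\<dots> = (\<Sum>w\<in>?S. c w * aq 0 (reorder Z (z.word w)))"
    using z.finite_words by (rule sum.image_gen[symmetric])
  finally show "mu \<Gamma> vs fs cs (x.wsum c) n = z.wsum c n"
    by (simp add: z.wsum_def)
qed

end


section \<open>States as sequences of cycles\<close>

context positive_graph
begin

definition flow :: "'e set list \<Rightarrow> 'e \<Rightarrow> nat" where
  "flow xs e = (\<Sum>C\<leftarrow>xs. indicator C e)"

lemma flow_simps [simp]: "flow [] = (\<lambda>e. 0)" "flow (C # xs) = (\<lambda>e. indicator C e + flow xs e)"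
  by (simp_all add: flow_def fun_eq_iff)

lemma flow_eq_card: "flow xs e = card {i. i < length xs \<and> e \<in> xs ! i}"
proof -
  have "flow xs e = (\<Sum>i<length xs. if e \<in> xs ! i then 1 else 0)"
    by (simp add: flow_def sum_list_sum_nth atLeast0LessThan indicator_def of_bool_def)
  also have "\<dots> = card {i \<in> {..<length xs}. e \<in> xs ! i}"
    unfolding card_eq_sum by (rule sum.inter_filter[symmetric]) simp
  finally show ?thesis by simp
qed

lemma coloring_flow:
  assumes "set xs \<subseteq> cycles \<Gamma>"
  shows "coloring \<Gamma> (flow xs)"
  using assms
proof (induction xs)
  case (Cons C xs)
  have "(\<Sum>e\<in>A. indicator C e) = card (C \<inter> A)" if "finite A" for A
    using that by (simp add: indicator_def sum.If_cases Int_commute)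
  moreover have "finite (in_edges \<Gamma> v)" "finite (out_edges \<Gamma> v)" for v
    by (auto simp: in_edges_def out_edges_def)
  moreover have "\<forall>e. e \<notin> edges \<Gamma> \<longrightarrow> e \<notin> C" "\<forall>v\<in>verts \<Gamma>. card (C \<inter> in_edges \<Gamma> v) = card (C \<inter> out_edges \<Gamma> v)"
    using Cons.prems by (auto simp: cycles_def)
  ultimately show ?case using Cons by (simp add: coloring_def sum.distrib)
qed (simp add: coloring_def)

lemma zexponent_0: "zexponent \<Gamma> (\<lambda>e. 0) = {#}"
  by (simp add: zexponent_def)

lemma zexponent_flow: "zexponent \<Gamma> (flow xs) = z.weight xs"
  by (induction xs) (simp_all add: zexponent_0 zexponent_sum)

definition color_value :: "nat \<Rightarrow> nat \<Rightarrow> rat" where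
  "color_value N i = of_nat i - (of_nat N - 1) / 2"

lemma color_value_less [simp]: "color_value N i < color_value N j \<longleftrightarrow> i < j" and color_value_eq [simp]: "color_value N i = color_value N j \<longleftrightarrow> i = j"
  by (simp_all add: color_value_def)

lemma inj_color_value: "inj_on (color_value N) A"
  by (simp add: inj_on_def)

text \<open>Entry \<open>i\<close> of the list is the cycle, possibly empty, that carries the \<open>i\<close>-th color.\<close>

definition state_of :: "'e set list \<Rightarrow> 'e set \<Rightarrow> rat set" where
  "state_of xs C = (if C = {} then {} else color_value (length xs) ` {i. i < length xs \<and> xs ! i = C})"

definition cycle_lists :: "nat \<Rightarrow> 'e set list set" where
  "cycle_lists N = {xs. length xs = N \<and> set xs \<subseteq> cycles \<Gamma>}"

lemma finite_cycle_lists: "finite (cycle_lists N)"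
  using finite_lists_length_eq[OF finite_cycles, of N] by (simp add: cycle_lists_def conj_commute)

lemma A_set_eq: "A_set N = color_value N ` {..<N}"
  by (simp add: A_set_def color_value_def)

text \<open>Distinct cycles have disjoint color sets, so every color determines at most one
  cycle.\<close>

lemma bij_state_of: "bij_betw state_of (cycle_lists N) (states \<Gamma> N)"
proof (intro bij_betw_imageI equalityI subsetI)
  show "inj_on state_of (cycle_lists N)"
  proof (rule inj_onI)
    fix xs ys assume a: "xs \<in> cycle_lists N" "ys \<in> cycle_lists N" "state_of xs = state_of ys"
    have le: "us ! i = ws ! i \<or> us ! i = {}"
      if "us \<in> cycle_lists N" "ws \<in> cycle_lists N" "state_of us = state_of ws" "i < N" for us ws i
    proof (rule disjCI)
      assume "us ! i \<noteq> {}"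
      then have "color_value N i \<in> state_of us (us ! i)" using that(1,4) by (simp add: state_of_def cycle_lists_def)
      then have "color_value N i \<in> state_of ws (us ! i)" using that by simp
      then have "color_value N i \<in> color_value N ` {k. k < N \<and> ws ! k = us ! i}"
        using that \<open>us ! i \<noteq> {}\<close> by (simp add: state_of_def cycle_lists_def)
      then obtain k where k: "color_value N i = color_value N k" "ws ! k = us ! i" by blast
      then have "k = i" by simp
      then show "us ! i = ws ! i" using k(2) by metis
    qed
    show "xs = ys"
      using a le[of xs ys] le[of ys xs] by (intro nth_equalityI) (auto simp: cycle_lists_def)
  qed
next
  fix \<sigma> assume "\<sigma> \<in> state_of ` cycle_lists N"
  then obtain xs where xs: "xs \<in> cycle_lists N" "\<sigma> = state_of xs" by blast
  have mem: "x \<in> \<sigma> C \<longleftrightarrow> C \<noteq> {} \<and> (\<exists>i<N. xs ! i = C \<and> x = color_value N i)" for x C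
    using xs by (auto simp: state_of_def cycle_lists_def)
  have "\<sigma> C \<subseteq> A_set N" for C
    using mem by (auto simp: A_set_eq)
  moreover have "C \<in> cycles \<Gamma>" if x: "x \<in> \<sigma> C" for x C
  proof -
    obtain i where "i < N" "xs ! i = C" using x mem[of x C] by blast
    then show ?thesis using xs(1) by (auto simp: cycle_lists_def)
  qed
  moreover have "\<sigma> {} = {}" using mem[of _ "{}"] by auto
  moreover have "C = C'" if "x \<in> \<sigma> C" "x \<in> \<sigma> C'" for x C C'
    using that mem[of x C] mem[of x C'] by auto
  ultimately show "\<sigma> \<in> states \<Gamma> N"
    unfolding states_def by blast
next
  fix \<sigma> assume s: "\<sigma> \<in> states \<Gamma> N"
  \<comment> \<open>A color carried by no cycle is recorded by the empty cycle.\<close>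
  define f where "f i = (if \<exists>C. color_value N i \<in> \<sigma> C then SOME C. color_value N i \<in> \<sigma> C else {})" for i
  have fI: "f i = C" if "color_value N i \<in> \<sigma> C" for i C
  proof -
    have "color_value N i \<in> \<sigma> (SOME C. color_value N i \<in> \<sigma> C)" using that by (rule someI)
    then have "(SOME C. color_value N i \<in> \<sigma> C) = C"
      using that s unfolding states_def by blast
    then show ?thesis using that by (auto simp: f_def)
  qed
  have fD: "color_value N i \<in> \<sigma> C" if "f i = C" "C \<noteq> {}" for i C
  proof -
    have "\<exists>C. color_value N i \<in> \<sigma> C" using that by (auto simp: f_def split: if_splits)
    then show ?thesis using fI that by metis
  qed
  have mem: "f i \<in> cycles \<Gamma>" for i
  proof (cases "f i = {}")
    case False
    then have "color_value N i \<in> \<sigma> (f i)" using fD by blast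
    then show ?thesis using s by (auto simp: states_def)
  qed (simp add: cycles_def)
  have "state_of (map f [0..<N]) C = \<sigma> C" for C
  proof (cases "C = {}")
    case True
    then show ?thesis using s by (simp add: state_of_def states_def)
  next
    case False
    have "color_value N ` {i. i < N \<and> f i = C} = \<sigma> C"
    proof (intro equalityI subsetI)
      fix x assume x: "x \<in> \<sigma> C"
      then have "x \<in> A_set N" using s by (auto simp: states_def)
      then obtain i where "i < N" "x = color_value N i" by (auto simp: A_set_eq)
      then show "x \<in> color_value N ` {i. i < N \<and> f i = C}" using fI x by auto
    qed (use False fD in auto)
    moreover have "{i. i < N \<and> map f [0..<N] ! i = C} = {i. i < N \<and> f i = C}" by auto
    ultimately show ?thesis using False by (simp add: state_of_def)
  qed
  moreover have "map f [0..<N] \<in> cycle_lists N" using mem by (auto simp: cycle_lists_def)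
  ultimately show "\<sigma> \<in> state_of ` cycle_lists N" by (metis ext image_eqI)
qed

lemma edge_colors_state_of:
  assumes "xs \<in> cycle_lists N"
  shows "edge_colors \<Gamma> (state_of xs) e = color_value N ` {i. i < N \<and> e \<in> xs ! i}"
proof -
  have l: "length xs = N" and c: "i < N \<Longrightarrow> xs ! i \<in> cycles \<Gamma>" for i
    using assms by (auto simp: cycle_lists_def)
  show ?thesis unfolding edge_colors_def
    using c by (auto simp: state_of_def l split: if_splits)
qed

lemma card_edge_colors:
  assumes "xs \<in> cycle_lists N"
  shows "card (edge_colors \<Gamma> (state_of xs) e) = flow xs e"
  using assms by (simp add: edge_colors_state_of card_image inj_color_value flow_eq_card cycle_lists_def)

lemma rot_state_of:
  assumes "xs \<in> cycle_lists N"
  shows "rot_state \<Gamma> (state_of xs) = (\<Sum>i<N. of_int (rot \<Gamma> (xs ! i)) * color_value N i)"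
proof -
  have l: "length xs = N" and c: "i < N \<Longrightarrow> xs ! i \<in> cycles \<Gamma>" for i
    using assms by (auto simp: cycle_lists_def)
  have "of_int (rot \<Gamma> C) * (\<Sum>x\<in>state_of xs C. x) =
      (\<Sum>i | i \<in> {..<N} \<and> xs ! i = C. of_int (rot \<Gamma> (xs ! i)) * color_value N i)" for C
    by (cases "C = {}") (simp_all add: state_of_def l sum.reindex inj_color_value sum_distrib_left)
  then have "rot_state \<Gamma> (state_of xs) =
      (\<Sum>C\<in>cycles \<Gamma>. \<Sum>i | i \<in> {..<N} \<and> xs ! i = C. of_int (rot \<Gamma> (xs ! i)) * color_value N i)"
    by (simp add: rot_state_def)
  also have "\<dots> = (\<Sum>i<N. of_int (rot \<Gamma> (xs ! i)) * color_value N i)"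
    by (rule sum.group) (use c in auto)
  finally show ?thesis .
qed

lemma count_pairs:
  "int (card {(a, b). a \<in> color_value N ` {i. i < N \<and> P i} \<and> b \<in> color_value N ` {i. i < N \<and> Q i} \<and> a < b}) =
    (\<Sum>j<N. \<Sum>i<j. of_bool (P i) * of_bool (Q j))"
proof -
  have "{(a, b). a \<in> color_value N ` {i. i < N \<and> P i} \<and> b \<in> color_value N ` {i. i < N \<and> Q i} \<and> a < b} =
      (\<lambda>x. (color_value N (snd x), color_value N (fst x))) ` {x \<in> Sigma {..<N} (\<lambda>j. {..<j}). P (snd x) \<and> Q (fst x)}"
    by (auto simp: image_iff)
  moreover have "inj_on (\<lambda>x. (color_value N (snd x), color_value N (fst x))) A" for A
    by (auto simp: inj_on_def)
  ultimately have "card {(a, b). a \<in> color_value N ` {i. i < N \<and> P i} \<and> b \<in> color_value N ` {i. i < N \<and> Q i} \<and> a < b} =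
      card {x \<in> Sigma {..<N} (\<lambda>j. {..<j}). P (snd x) \<and> Q (fst x)}"
    by (simp only: card_image)
  also have "\<dots> = (\<Sum>x\<in>Sigma {..<N} (\<lambda>j. {..<j}). if P (snd x) \<and> Q (fst x) then 1 else 0)"
    unfolding card_eq_sum by (rule sum.inter_filter) auto
  also have "int \<dots> = (\<Sum>x\<in>Sigma {..<N} (\<lambda>j. {..<j}). of_bool (P (snd x)) * of_bool (Q (fst x)))"
    by (simp add: of_bool_def if_distrib cong: if_cong) (intro sum.cong, auto)
  also have "\<dots> = (\<Sum>j<N. \<Sum>i<j. of_bool (P i) * of_bool (Q j))"
  proof -
    have "(\<Sum>j<N. \<Sum>i<j. of_bool (P i) * of_bool (Q j) :: int) =
        (\<Sum>(j, i)\<in>Sigma {..<N} (\<lambda>j. {..<j}). of_bool (P i) * of_bool (Q j))"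
      by (rule sum.Sigma) auto
    then show ?thesis by (simp only: case_prod_unfold)
  qed
  finally show ?thesis .
qed

lemma prod_q4: "(\<Prod>x\<in>A. q4 (f x)) = q4 (\<Sum>x\<in>A. f x)"
  by (induction A rule: infinite_finite_induct) (simp_all add: q4_add)

text \<open>Colors increase with the position, so the difference of the counts R and L at
  \<open>v\<close> is the sum, over positions i < j, of the local term of the pairing of the two
  cycles. Summation over the vertices gives the cost of sorting.\<close>

lemma prod_wt_state_of:
  assumes xs: "xs \<in> cycle_lists N"
  shows "(\<Prod>v\<in>verts \<Gamma>. wt \<Gamma> v (state_of xs)) = qpow (reorder Z (z.word xs))"
proof -
  let ?l = "\<lambda>i v. of_bool (left_edge v \<in> xs ! i) :: int" and ?r = "\<lambda>i v. of_bool (right_edge v \<in> xs ! i) :: int"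
  let ?t = "\<lambda>v. \<Sum>j<N. \<Sum>i<j. ?l i v * ?r j v - ?r i v * ?l j v"
  have R: "int (R_count \<Gamma> v (state_of xs)) = (\<Sum>j<N. \<Sum>i<j. ?l i v * ?r j v)" for v
    unfolding R_count_def half_colors_def edge_colors_state_of[OF xs] left_edge_def right_edge_def by (rule count_pairs)
  have L: "int (L_count \<Gamma> v (state_of xs)) = (\<Sum>j<N. \<Sum>i<j. ?r i v * ?l j v)" for v
  proof -
    \<comment> \<open>With the components swapped, \<open>count_pairs\<close> applies again, left
      and right being exchanged.\<close>
    have "L_count \<Gamma> v (state_of xs) = card (prod.swap ` {(b, a). b \<in> half_colors \<Gamma> (state_of xs) (rgt \<Gamma> v) \<and>
        a \<in> half_colors \<Gamma> (state_of xs) (lft \<Gamma> v) \<and> b < a})"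
      unfolding L_count_def by (rule arg_cong[of _ _ card]) auto
    also have "\<dots> = card {(b, a). b \<in> half_colors \<Gamma> (state_of xs) (rgt \<Gamma> v) \<and>
        a \<in> half_colors \<Gamma> (state_of xs) (lft \<Gamma> v) \<and> b < a}"
      by (rule card_image) simp
    also have "int \<dots> = (\<Sum>j<N. \<Sum>i<j. ?r i v * ?l j v)"
      unfolding half_colors_def edge_colors_state_of[OF xs] left_edge_def right_edge_def by (rule count_pairs)
    finally show ?thesis .
  qed
  have "wt \<Gamma> v (state_of xs) = q4 (?t v)" for v
    using qpow_quarter[of "?t v"] arg_cong[OF R[of v], of rat_of_int] arg_cong[OF L[of v], of rat_of_int]
    by (simp add: wt_def sum_subtractf)
  then have "(\<Prod>v\<in>verts \<Gamma>. wt \<Gamma> v (state_of xs)) = q4 (\<Sum>v\<in>verts \<Gamma>. ?t v)"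
    by (simp add: prod_q4)
  also have "(\<Sum>v\<in>verts \<Gamma>. ?t v) = (\<Sum>j<N. \<Sum>v\<in>verts \<Gamma>. \<Sum>i<j. ?l i v * ?r j v - ?r i v * ?l j v)"
    by (rule sum.swap)
  also have "\<dots> = (\<Sum>j<N. \<Sum>i<j. cycle_flow_pairing (xs ! i) (xs ! j))"
  proof -
    have "int (indicator A x) = of_bool (x \<in> A)" for A and x :: 'e by (simp add: indicator_def)
    then show ?thesis unfolding flow_pairing_def by (subst sum.swap) simp
  qed
  also have "q4 \<dots> = qpow (of_int (\<Sum>j<N. \<Sum>i<j. cycle_flow_pairing (xs ! i) (xs ! j)) / 4)"
    by (rule qpow_quarter[symmetric])
  also have "of_int (\<Sum>j<N. \<Sum>i<j. cycle_flow_pairing (xs ! i) (xs ! j)) / 4 = reorder Z (z.word xs)"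
    using xs by (simp add: reorder_z pairsum_def sum_divide_distrib cycle_lists_def)
  finally show ?thesis .
qed

text \<open>Four times the rotation exponent when the colors are 1/2, 3/2, ... instead of those of
  A_N. Prepending a cycle raises all later colors by 1, in parallel with
  \<open>finite_coeff\<close>.\<close>

primrec list_rot :: "'e set list \<Rightarrow> int" where
  "list_rot [] = 0"
| "list_rot (C # xs) = 2 * rot \<Gamma> C + 4 * wrot (rot \<Gamma>) xs + list_rot xs"

lemma list_rot_eq: "list_rot xs = (\<Sum>i<length xs. (2 + 4 * int i) * rot \<Gamma> (xs ! i))"
proof (induction xs)
  case (Cons C xs)
  have "wrot (rot \<Gamma>) xs = (\<Sum>i<length xs. rot \<Gamma> (xs ! i))"
    by (simp add: wrot_def sum_list_sum_nth atLeast0LessThan)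
  then show ?case
    using Cons by (simp add: sum.lessThan_Suc_shift sum_distrib_left sum.distrib algebra_simps del: sum.lessThan_Suc)
qed simp

lemma qpow_rot_state_of:
  assumes xs: "xs \<in> cycle_lists N"
  shows "qpow (rot_state \<Gamma> (state_of xs)) = q4 (list_rot xs - 2 * int N * wrot (rot \<Gamma>) xs)"
proof -
  have l: "length xs = N" using assms by (auto simp: cycle_lists_def)
  have w: "wrot (rot \<Gamma>) xs = (\<Sum>i<N. rot \<Gamma> (xs ! i))"
    by (simp add: wrot_def sum_list_sum_nth atLeast0LessThan l)
  have "rot_state \<Gamma> (state_of xs) = of_int (list_rot xs - 2 * int N * wrot (rot \<Gamma>) xs) / 4"
    unfolding rot_state_of[OF xs] list_rot_eq w l sum_distrib_left sum_subtractf[symmetric] of_int_sum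
      sum_divide_distrib
    by (intro sum.cong refl) (simp add: color_value_def field_simps)
  then show ?thesis by (simp only: qpow_quarter)
qed

text \<open>The value off the nonempty cycles is irrelevant, but should be positive.\<close>

definition pos_rot :: "'e set \<Rightarrow> int" where
  "pos_rot C = (if C \<in> set cs then rot \<Gamma> C else 1)"

lemma pos_rot_pos: "pos_rot C > 0"
  using positive cs by (auto simp: pos_rot_def positive_moy_def)

lemma wrot_pos_rot: "set w \<subseteq> set cs \<Longrightarrow> wrot pos_rot w = wrot (rot \<Gamma>) w"
  by (induction w) (auto simp: pos_rot_def)

lemma wrot_filter: "wrot (rot \<Gamma>) (filter (\<lambda>C. C \<noteq> {}) xs) = wrot (rot \<Gamma>) xs"
  by (induction xs) auto

text \<open>Expansion of the product: each factor supplies its constant term, recorded as the empty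
  cycle, or a letter of \<open>w\<close>. The induction distinguishes the choice made in the first
  factor.\<close>

lemma finite_coeff_eq_sum_lists:
  "set w \<subseteq> set cs \<Longrightarrow> finite_coeff pos_rot N w =
    (\<Sum>xs | xs \<in> cycle_lists N \<and> filter (\<lambda>C. C \<noteq> {}) xs = w. q4 (list_rot xs))"
proof (induction N arbitrary: w)
  case 0
  have "{xs. xs \<in> cycle_lists 0 \<and> filter (\<lambda>C. C \<noteq> {}) xs = w} = (if w = [] then {[]} else {})"
    by (auto simp: cycle_lists_def)
  then show ?case by simp
next
  case (Suc N)
  let ?S = "\<lambda>N w. {xs. xs \<in> cycle_lists N \<and> filter (\<lambda>C. C \<noteq> {}) xs = w}"
  have fin: "finite (?S N w)" for N w
    using finite_cycle_lists by simp
  have e: "{} \<in> cycles \<Gamma>" by (simp add: cycles_def)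
  \<comment> \<open>If the first entry is empty, the whole word moves up by one color, which is the
    twist by 4.\<close>
  have 1: "(\<Sum>xs\<in>(#) {} ` ?S N w. q4 (list_rot xs)) = twist pos_rot 4 w * finite_coeff pos_rot N w"
  proof -
    have "wrot (rot \<Gamma>) xs = wrot pos_rot w" if "xs \<in> ?S N w" for xs
      using that Suc.prems wrot_filter[of xs] by (simp add: wrot_pos_rot)
    then show ?thesis
      using Suc by (simp add: sum.reindex q4_add twist_def sum_distrib_left)
  qed
  show ?case
  proof (cases w)
    case Nil
    have "?S (Suc N) w = (#) {} ` ?S N w"
      using e unfolding Nil by (auto simp: cycle_lists_def length_Suc_conv image_iff split: if_splits)
    then show ?thesis using 1 by (simp add: Nil twist_def)
  next
    case (Cons B w')
    have B: "B \<in> cycles \<Gamma>" "B \<noteq> {}" "set w' \<subseteq> set cs" "pos_rot B = rot \<Gamma> B"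
      using Suc.prems cs Cons by (auto simp: pos_rot_def)
    have S: "?S (Suc N) w = (#) {} ` ?S N w \<union> (#) B ` ?S N w'"
    proof (intro equalityI subsetI)
      fix xs assume "xs \<in> ?S (Suc N) w"
      then obtain C ys where "xs = C # ys" "C \<in> cycles \<Gamma>" "ys \<in> cycle_lists N" "filter (\<lambda>C. C \<noteq> {}) (C # ys) = w"
        by (auto simp: cycle_lists_def length_Suc_conv)
      then show "xs \<in> (#) {} ` ?S N w \<union> (#) B ` ?S N w'"
        by (cases "C = {}") (auto simp: Cons)
    qed (use e B Cons in \<open>auto simp: cycle_lists_def\<close>)
    have "wrot (rot \<Gamma>) xs = wrot pos_rot w'" if "xs \<in> ?S N w'" for xs
      using that B wrot_filter[of xs] by (simp add: wrot_pos_rot)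
    then have 2: "(\<Sum>xs\<in>(#) B ` ?S N w'. q4 (list_rot xs)) = q4 (2 * pos_rot B) * (twist pos_rot 4 w' * finite_coeff pos_rot N w')"
      using Suc.IH[of w'] B by (simp add: sum.reindex q4_add twist_def sum_distrib_left mult.assoc)
    have "(\<Sum>xs\<in>?S (Suc N) w. q4 (list_rot xs)) =
        (\<Sum>xs\<in>(#) {} ` ?S N w. q4 (list_rot xs)) + (\<Sum>xs\<in>(#) B ` ?S N w'. q4 (list_rot xs))"
      unfolding S using fin B by (intro sum.union_disjoint) auto
    then show ?thesis unfolding 1 2 by (simp only: Cons finite_coeff_Suc_Cons)
  qed
qed

text \<open>States are grouped by the word that remains after deleting the empty cycles. The word
  fixes the vertex weights and the total rotation number, so within a group only
  \<open>list_rot\<close> varies, and its sum is \<open>finite_coeff\<close>.\<close>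

lemma moy_eval_eq:
  assumes "coloring \<Gamma> \<gamma>"
  shows "moy_eval \<Gamma> N \<gamma> = eval_a (int N) (z.wsum (F_coeff pos_rot) (zexponent \<Gamma> \<gamma>))"
proof -
  let ?m = "zexponent \<Gamma> \<gamma>"
  let ?fl = "filter (\<lambda>C. C \<noteq> {}) :: 'e set list \<Rightarrow> 'e set list"
  let ?T = "\<lambda>xs. q4 (list_rot xs - 2 * int N * wrot (rot \<Gamma>) xs) * qpow (reorder Z (z.word xs))"
  have flow: "(\<forall>e\<in>edges \<Gamma>. flow xs e = \<gamma> e) \<longleftrightarrow> z.weight xs = ?m" if "xs \<in> cycle_lists N" for xs
  proof -
    have c: "coloring \<Gamma> (flow xs)" using that by (intro coloring_flow) (simp add: cycle_lists_def)
    have "(\<forall>e\<in>edges \<Gamma>. flow xs e = \<gamma> e) \<longleftrightarrow> flow xs = \<gamma>"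
      using c assms by (auto simp: coloring_def fun_eq_iff)
    also have "\<dots> \<longleftrightarrow> z.weight xs = ?m"
      using zexponent_inj[OF c assms] by (auto simp: zexponent_flow)
    finally show ?thesis .
  qed
  have zexp: "zexp {} = {#}"
  proof -
    have "indicator {} = (\<lambda>e :: 'e. 0 :: nat)" by (simp add: fun_eq_iff)
    then show ?thesis by (simp only: zexponent_0)
  qed
  have std: "std_word Z {#} = []" by (simp add: std_word_def)
  have fl: "z.weight (?fl xs) = z.weight xs" "z.word (?fl xs) = z.word xs" for xs
    by (induction xs) (auto simp: zexp std)
  let ?A = "{xs. xs \<in> cycle_lists N \<and> z.weight xs = ?m}"
  have "moy_eval \<Gamma> N \<gamma> = (\<Sum>xs\<in>?A. ?T xs)"
  proof -
    have "bij_betw state_of ?A {\<sigma>. \<sigma> \<in> states \<Gamma> N \<and> (\<forall>e\<in>edges \<Gamma>. card (edge_colors \<Gamma> \<sigma> e) = \<gamma> e)}"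
    proof (rule bij_betw_subset[OF bij_state_of[of N]])
      have "(\<forall>e\<in>edges \<Gamma>. card (edge_colors \<Gamma> (state_of xs) e) = \<gamma> e) \<longleftrightarrow> z.weight xs = ?m"
        if "xs \<in> cycle_lists N" for xs
        using flow[OF that] by (simp add: card_edge_colors[OF that])
      then show "state_of ` ?A = {\<sigma>. \<sigma> \<in> states \<Gamma> N \<and> (\<forall>e\<in>edges \<Gamma>. card (edge_colors \<Gamma> \<sigma> e) = \<gamma> e)}"
        unfolding bij_betw_imp_surj_on[OF bij_state_of[of N], symmetric] by blast
    qed auto
    then show ?thesis
      unfolding moy_eval_def
      by (subst sum.reindex_bij_betw[symmetric, of state_of ?A])
        (auto intro!: sum.cong simp: qpow_rot_state_of prod_wt_state_of)
  qed
  also have "\<dots> = (\<Sum>w | set w \<subseteq> set cs \<and> z.weight w = ?m. \<Sum>xs | xs \<in> ?A \<and> ?fl xs = w. ?T xs)"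
  proof (rule sum.group[symmetric])
    show "finite ?A" using finite_cycle_lists by simp
    show "finite {w. set w \<subseteq> set cs \<and> z.weight w = ?m}" by (rule z.finite_words)
    show "?fl ` ?A \<subseteq> {w. set w \<subseteq> set cs \<and> z.weight w = ?m}"
      using cs by (auto simp: fl cycle_lists_def)
  qed
  also have "\<dots> = eval_a (int N) (z.wsum (F_coeff pos_rot) ?m)"
    unfolding z.wsum_def eval_a_sum
  proof (intro sum.cong refl)
    fix w assume w: "w \<in> {w. set w \<subseteq> set cs \<and> z.weight w = ?m}"
    have "(\<Sum>xs | xs \<in> ?A \<and> ?fl xs = w. ?T xs) =
        (\<Sum>xs | xs \<in> cycle_lists N \<and> ?fl xs = w.
          q4 (list_rot xs) * (q4 (- 2 * int N * wrot pos_rot w) * qpow (reorder Z (z.word w))))"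
    proof (rule sum.cong)
      show "{xs. xs \<in> ?A \<and> ?fl xs = w} = {xs. xs \<in> cycle_lists N \<and> ?fl xs = w}"
        using w fl by auto
      fix xs assume "xs \<in> {xs. xs \<in> cycle_lists N \<and> ?fl xs = w}"
      then have "?fl xs = w" by simp
      then have "z.word xs = z.word w" "wrot (rot \<Gamma>) xs = wrot pos_rot w"
        using fl(2)[of xs] wrot_filter[of xs] w wrot_pos_rot[of w] by auto
      then show "?T xs = q4 (list_rot xs) * (q4 (- 2 * int N * wrot pos_rot w) * qpow (reorder Z (z.word w)))"
        by (simp add: mult.assoc[symmetric] flip: q4_add)
    qed
    also have "\<dots> = finite_coeff pos_rot N w * (q4 (- 2 * int N * wrot pos_rot w) * qpow (reorder Z (z.word w)))"
      using w by (simp add: finite_coeff_eq_sum_lists sum_distrib_right)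
    also have "\<dots> = eval_a (int N) (F_coeff pos_rot w * aq 0 (reorder Z (z.word w)))"
      by (simp add: eval_a_mult eval_a_F_coeff[of pos_rot, OF pos_rot_pos] twist_def mult_ac)
    finally show "(\<Sum>xs | xs \<in> ?A \<and> ?fl xs = w. ?T xs) = eval_a (int N) (F_coeff pos_rot w * aq 0 (reorder Z (z.word w)))" .
  qed
  finally show ?thesis .
qed

end


section \<open>The identities\<close>

context positive_graph
begin

lemma aq_reorder_z:
  assumes "set w \<subseteq> set cs"
  obtains k where "aq 0 (reorder Z (z.word w)) = Poly_Mapping.single 0 (q4 (2 * k))"
proof -
  obtain k where "reorder Z (z.word w) = of_int k / 2" using reorder_z_half[OF assms] by blast
  then show ?thesis using that[of k] by (simp only: aq_def qpow_half)
qed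

text \<open>At the exponent of a coloring the word sum is rational and has the values of the MOY
  evaluations. At any other exponent there are no words, as the flow of a word is a
  coloring.\<close>

lemma F_series_eq: "F_series \<Gamma> = z.wsum (F_coeff pos_rot)"
proof
  fix m
  have cyc: "coloring \<Gamma> (flow w)" if "set w \<subseteq> set cs" for w
    using that cs by (intro coloring_flow) auto
  show "F_series \<Gamma> m = z.wsum (F_coeff pos_rot) m"
  proof (cases "\<exists>\<gamma>. coloring \<Gamma> \<gamma> \<and> zexponent \<Gamma> \<gamma> = m")
    case True
    then obtain \<gamma> where \<gamma>: "coloring \<Gamma> \<gamma>" "zexponent \<Gamma> \<gamma> = m" by blast
    then have "{\<gamma>. coloring \<Gamma> \<gamma> \<and> zexponent \<Gamma> \<gamma> = m} = {\<gamma>}"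
      using zexponent_inj by blast
    then have "F_series \<Gamma> m = fract_to_laurent (homfly \<Gamma> \<gamma>)" by (simp add: F_series_def)
    also have "\<dots> = z.wsum (F_coeff pos_rot) m"
    proof (rule fract_to_laurent_homfly)
      have "F_coeff pos_rot w \<in> rational" for w
        unfolding F_coeff_def by (intro rational_conv_div rational_inf_coeff pos_rot_pos)
      moreover have "aq 0 (reorder Z (z.word w)) \<in> rational" if "set w \<subseteq> set cs" for w
        using aq_reorder_z[OF that] rational_single_q4 by (metis dvd_triv_left)
      ultimately show "z.wsum (F_coeff pos_rot) m \<in> rational"
        unfolding z.wsum_def by (intro rational_sum rational_mult) auto
      show "eval_a (int N) (z.wsum (F_coeff pos_rot) m) = moy_eval \<Gamma> N \<gamma>" for N
        using moy_eval_eq[OF \<gamma>(1)] \<gamma>(2) by simp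
    qed
    finally show ?thesis .
  next
    case False
    then have "{w. set w \<subseteq> set cs \<and> z.weight w = m} = {}"
      using cyc zexponent_flow by blast
    moreover have "{\<gamma>. coloring \<Gamma> \<gamma> \<and> zexponent \<Gamma> \<gamma> = m} = {}"
      using False by blast
    ultimately show ?thesis unfolding F_series_def z.wsum_def by (simp only: sum.empty)
  qed
qed

lemma cycle_poly_eq:
  "cycle_poly \<Gamma> \<epsilon> \<delta> = x.wsum (linear_word (\<lambda>C. aq (- \<delta> * rot \<Gamma> C) (of_int (\<epsilon> * rot \<Gamma> C) / 2)))"
proof
  fix m
  let ?f = "\<lambda>C. aq (- \<delta> * rot \<Gamma> C) (of_int (\<epsilon> * rot \<Gamma> C) / 2)"
  have "{} \<in> cycles \<Gamma>" by (simp add: cycles_def)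
  then have c: "cycles \<Gamma> = insert {} (set cs)" "{} \<notin> set cs" using cs by auto
  have "cycle_poly \<Gamma> \<epsilon> \<delta> m = ?f {} * qmono (xexponent {}) m + (\<Sum>C\<in>set cs. ?f C * qmono (xexponent C) m)"
    unfolding cycle_poly_def c(1) by (rule sum.insert) (use c(2) in auto)
  also have "(\<Sum>C\<in>set cs. ?f C * qmono (xexponent C) m) = (\<Sum>C\<in>set cs. ?f C * qmono {#C#} m)"
    using c(2) by (intro sum.cong refl) (auto simp: xexponent_def)
  also have "?f {} * qmono (xexponent {}) m = qmono {#} m"
    by (simp add: xexponent_def)
  finally show "cycle_poly \<Gamma> \<epsilon> \<delta> m = x.wsum (linear_word ?f) m"
    by (simp only: x.wsum_linear_word)
qed

lemma rescale_wsum: "rescale \<Gamma> k (x.wsum c) = x.wsum (\<lambda>w. c w * aq 0 (of_int (int k * wrot (rot \<Gamma>) w)))"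
proof
  fix m
  have "(\<Sum>C\<in>#m. rot \<Gamma> C) = wrot (rot \<Gamma>) w" if "mset w = m" for w
    using that by (auto simp: wrot_def sum_mset_sum_list simp flip: mset_map)
  then show "rescale \<Gamma> k (x.wsum c) m = x.wsum (\<lambda>w. c w * aq 0 (of_int (int k * wrot (rot \<Gamma>) w))) m"
    unfolding rescale_def x.wsum_def sum_distrib_right
    by (intro sum.cong) (auto simp: x_weight mult_ac)
qed

text \<open>Restores the power of a^(1/2) that \<open>finite_coeff\<close> and
  \<open>inf_coeff\<close> leave out.\<close>

definition graded :: "int \<Rightarrow> ('e set list \<Rightarrow> int fls) \<Rightarrow> 'e set list \<Rightarrow> laurent" where
  "graded \<delta> c w = Poly_Mapping.single (- \<delta> * wrot pos_rot w) (c w)"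

lemma partial_qpoch_eq:
  "partial_qpoch \<Gamma> cs (cycle_poly \<Gamma> 1 \<delta>) n = x.wsum (graded \<delta> (finite_coeff pos_rot n))"
proof (induction n)
  case 0
  have "graded \<delta> (finite_coeff pos_rot 0) = (\<lambda>w. if w = [] then 1 else 0)"
    by (auto simp: graded_def single_one fun_eq_iff)
  then show ?case by (simp add: x.wsum_unit)
next
  case (Suc n)
  let ?q = "linear_word (\<lambda>C. q4 ((2 + 4 * int n) * pos_rot C))"
  have "rescale \<Gamma> n (cycle_poly \<Gamma> 1 \<delta>) = x.wsum (graded \<delta> ?q)"
    unfolding cycle_poly_eq rescale_wsum
  proof (rule x.wsum_cong)
    fix w assume w: "set w \<subseteq> set cs"
    have "qpow (of_int (rot \<Gamma> C) / 2) * qpow (of_int (int n * rot \<Gamma> C)) = q4 ((2 + 4 * int n) * rot \<Gamma> C)" for C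
      unfolding qpow_half qpow_of_int q4_add[symmetric] by (rule arg_cong[of _ _ q4]) (simp add: algebra_simps)
    moreover have "qpow 0 = 1" by (simp add: qpow_eq_q4)
    ultimately show "linear_word (\<lambda>C. aq (- \<delta> * rot \<Gamma> C) (of_int (1 * rot \<Gamma> C) / 2)) w *
        aq 0 (of_int (int n * wrot (rot \<Gamma>) w)) = graded \<delta> ?q w"
      using w by (auto simp: linear_word_def graded_def pos_rot_def aq_def mult_single single_one
          simp del: of_int_mult split: list.splits)
  qed
  moreover have "conv (graded \<delta> (finite_coeff pos_rot n)) (graded \<delta> ?q) w = graded \<delta> (finite_coeff pos_rot (Suc n)) w" for w
    unfolding finite_coeff_Suc_right graded_def by (rule conv_single) (simp add: distrib_left)
  then have "conv (graded \<delta> (finite_coeff pos_rot n)) (graded \<delta> ?q) = graded \<delta> (finite_coeff pos_rot (Suc n))" ..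
  ultimately show ?case
    using Suc by (simp add: x.qmult_wsum del: finite_coeff.simps)
qed

lemma partial_qpoch_tendsto:
  "qseries_tendsto (partial_qpoch \<Gamma> cs (cycle_poly \<Gamma> 1 \<delta>)) (x.wsum (graded \<delta> (inf_coeff pos_rot)))"
  unfolding qseries_tendsto_def partial_qpoch_eq
proof (intro allI)
  fix m j
  let ?W = "{w. set w \<subseteq> set cs \<and> x.weight w = m}"
  let ?r = "\<lambda>w. \<lfloor>4 * reorder X (x.word w)\<rfloor>"
  \<comment> \<open>Each coefficient is a finite sum over words, with sorting factors that do not
    depend on \<open>n\<close>, so convergence can be checked word by word.\<close>
  have l: "Poly_Mapping.lookup (x.wsum (graded \<delta> c) m) j =
      (\<Sum>w\<in>?W. if - \<delta> * wrot pos_rot w = j then q4 (?r w) * c w else 0)" for c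
    unfolding x.wsum_def lookup_sum graded_def aq_def mult_single
    by (intro sum.cong refl) (simp add: lookup_single when_def qpow_eq_q4 mult.commute)
  have "eventually_agree (\<lambda>n. \<Sum>w\<in>?W. if - \<delta> * wrot pos_rot w = j then q4 (?r w) * finite_coeff pos_rot n w else 0)
      (\<Sum>w\<in>?W. if - \<delta> * wrot pos_rot w = j then q4 (?r w) * inf_coeff pos_rot w else 0)"
  proof (rule eventually_agree_sum)
    fix w
    show "eventually_agree (\<lambda>n. if - \<delta> * wrot pos_rot w = j then q4 (?r w) * finite_coeff pos_rot n w else 0)
      (if - \<delta> * wrot pos_rot w = j then q4 (?r w) * inf_coeff pos_rot w else 0)"
      using eventually_agree_q4_mult[OF eventually_agree_finite_coeff[of pos_rot w, OF pos_rot_pos], of "?r w"] eventually_agree_const[of 0] by auto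
  qed
  then show "(\<lambda>n. Poly_Mapping.lookup (x.wsum (graded \<delta> (finite_coeff pos_rot n)) m) j) \<longlonglongrightarrow>
      Poly_Mapping.lookup (x.wsum (graded \<delta> (inf_coeff pos_rot)) m) j"
    unfolding l by (rule eventually_agree_tendsto)
qed

lemma qpoch_eq: "qpoch \<Gamma> cs (cycle_poly \<Gamma> 1 \<delta>) = x.wsum (graded \<delta> (inf_coeff pos_rot))"
  unfolding qpoch_def
proof (rule the_equality[where a = "x.wsum (graded \<delta> (inf_coeff pos_rot))"])
  fix f assume f: "qseries_tendsto (partial_qpoch \<Gamma> cs (cycle_poly \<Gamma> 1 \<delta>)) f"
  show "f = x.wsum (graded \<delta> (inf_coeff pos_rot))"
  proof (rule ext, rule poly_mapping_eqI)
    fix m j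
    show "Poly_Mapping.lookup (f m) j = Poly_Mapping.lookup (x.wsum (graded \<delta> (inf_coeff pos_rot)) m) j"
      using f partial_qpoch_tendsto[of \<delta>] unfolding qseries_tendsto_def by (blast intro: LIMSEQ_unique)
  qed
qed (rule partial_qpoch_tendsto)

lemma first_identity:
  "qmult Z (F_series \<Gamma>) (mu \<Gamma> vs fs cs (qpoch \<Gamma> cs (cycle_poly \<Gamma> 1 (- 1)))) =
    mu \<Gamma> vs fs cs (qpoch \<Gamma> cs (cycle_poly \<Gamma> 1 1))"
proof -
  have "conv (F_coeff pos_rot) (graded (- 1) (inf_coeff pos_rot)) w = graded 1 (inf_coeff pos_rot) w" for w
    unfolding F_coeff_def graded_def by (subst conv_conv_div[symmetric, where d = "\<lambda>w. Poly_Mapping.single (wrot pos_rot w) (inf_coeff pos_rot w)"])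
      (simp_all add: single_one)
  then have "conv (F_coeff pos_rot) (graded (- 1) (inf_coeff pos_rot)) = graded 1 (inf_coeff pos_rot)" ..
  then show ?thesis
    by (simp add: F_series_eq qpoch_eq mu_wsum z.qmult_wsum)
qed

lemma second_identity:
  "(\<lambda>m. shift_a (F_series \<Gamma> m)) =
    qmult Z (qmult Z (mu \<Gamma> vs fs cs (cycle_poly \<Gamma> (- 1) 1)) (F_series \<Gamma>))
      (mu \<Gamma> vs fs cs (cycle_poly \<Gamma> 1 (- 1)))"
proof -
  have mu: "mu \<Gamma> vs fs cs (cycle_poly \<Gamma> \<epsilon> \<delta>) =
      z.wsum (linear_word (\<lambda>C. aq (- \<delta> * pos_rot C) (of_int (\<epsilon> * pos_rot C) / 2)))" for \<epsilon> \<delta>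
    unfolding cycle_poly_eq mu_wsum
    by (rule z.wsum_cong) (auto simp: linear_word_def pos_rot_def split: list.splits)
  have "(\<lambda>m. shift_a (F_series \<Gamma> m)) = z.wsum (\<lambda>w. shift_a (F_coeff pos_rot w))"
    by (simp add: F_series_eq z.shift_wsum)
  also have "(\<lambda>w. shift_a (F_coeff pos_rot w)) =
      conv (conv (linear_word (\<lambda>C. aq (- pos_rot C) (- of_int (pos_rot C) / 2))) (F_coeff pos_rot))
        (linear_word (\<lambda>C. aq (pos_rot C) (of_int (pos_rot C) / 2)))"
    by (rule ext) (rule shift_a_F_coeff[OF pos_rot_pos])
  finally show ?thesis
    by (simp add: mu F_series_eq z.qmult_wsum)
qed

lemma graded_inf_coeff_Rminus: "graded 1 (inf_coeff pos_rot) w \<in> Rminus"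
  using integral_q_inf_coeff[of pos_rot w, OF pos_rot_pos] wrot_nonneg[of pos_rot w, OF pos_rot_pos]
  by (auto simp: Rminus_def Rcoeff_def integral_q_def graded_def lookup_single when_def split: if_splits)


section \<open>Integrality of the infinite products\<close>

lemma odd_coeff_0:
  assumes "k \<in> Rcoeff" "odd i"
  shows "fls_nth (Poly_Mapping.lookup (k * Poly_Mapping.single 0 (q4 (2 * l))) j) i = 0"
proof -
  have "Poly_Mapping.lookup (k * Poly_Mapping.single 0 f) j = f * Poly_Mapping.lookup k j" for f
  proof -
    have "k * Poly_Mapping.single 0 f =
        (\<Sum>i\<in>Poly_Mapping.keys k. Poly_Mapping.single i (Poly_Mapping.lookup k i) * Poly_Mapping.single 0 f)"
      by (simp add: sum_singles flip: sum_distrib_right)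
    then have "Poly_Mapping.lookup (k * Poly_Mapping.single 0 f) j =
        (\<Sum>i\<in>Poly_Mapping.keys k. if i = j then f * Poly_Mapping.lookup k i else 0)"
      by (simp add: lookup_sum lookup_single mult_single when_def mult.commute)
    then show ?thesis by (simp add: in_keys_iff)
  qed
  moreover have "odd (i - 2 * l)" using assms(2) by simp
  then have "fls_nth (Poly_Mapping.lookup k j) (i - 2 * l) = 0"
    using assms(1) unfolding Rcoeff_def by blast
  ultimately show ?thesis by (simp add: fls_nth_q4_mult)
qed

text \<open>The word coefficients themselves witness membership. Sorting contributes half-integral
  powers of q, as \<open>cycle_pairing\<close> is half-integral.\<close>

lemma qpoch_over: "qpoch \<Gamma> cs (cycle_poly \<Gamma> 1 1) \<in> qseries_over Rminus X"
proof -
  have R: "graded 1 (inf_coeff pos_rot) w \<in> Rcoeff" for w using graded_inf_coeff_Rminus by (simp add: Rminus_def)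
  have e: "x.wsum (graded 1 (inf_coeff pos_rot)) m =
      (\<Sum>w | set w \<subseteq> set (vars X) \<and> mset w = m. graded 1 (inf_coeff pos_rot) w * aq 0 (reorder X w))" for m
    unfolding x.wsum_def x_weight vars_X by (intro sum.cong) (auto simp: x_word)
  have half: "\<exists>l. a + b = of_int l / (2::rat)" if a: "\<exists>l. a = of_int l / 2" and b: "\<exists>l. b = of_int l / 2" for a b
  proof -
    obtain k l where "a = of_int k / 2" "b = of_int l / 2" using a b by blast
    then have "a + b = of_int (k + l) / 2" by (simp add: add_divide_distrib)
    then show ?thesis by blast
  qed
  have zero: "\<exists>l. 0 = of_int l / (2::rat)" by (rule exI[of _ 0]) simp
  have "\<exists>l. reorder X w = of_int l / 2" for w
  proof (induction w)
    case (Cons C w)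
    have "\<exists>l. (\<Sum>D\<in>#u. brel X C D) = of_int l / 2" for u
    proof (induction u)
      case (add D u)
      have "\<exists>l. brel X C D = of_int l / 2"
        using zero by (simp add: brel_def cycle_pairing_eq)
      then show ?case using half[OF _ add.IH, of "brel X C D"] by simp
    qed (simp add: zero)
    then show ?case using half[OF _ Cons.IH] by (simp only: reorder_Cons)
  qed (simp add: zero)
  then have a: "\<exists>l. aq 0 (reorder X w) = Poly_Mapping.single 0 (q4 (2 * l))" for w
    using qpow_half unfolding aq_def by metis
  have "fls_nth (Poly_Mapping.lookup (x.wsum (graded 1 (inf_coeff pos_rot)) m) j) i = 0" if "odd i" for m j i
    unfolding e lookup_sum fls_nth_sum
  proof (intro sum.neutral ballI)
    fix w
    obtain l where "aq 0 (reorder X w) = Poly_Mapping.single 0 (q4 (2 * l))" using a by blast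
    then show "fls_nth (Poly_Mapping.lookup (graded 1 (inf_coeff pos_rot) w * aq 0 (reorder X w)) j) i = 0"
      using odd_coeff_0[OF R that] by simp
  qed
  then show ?thesis
    unfolding qseries_over_def qpoch_eq using e graded_inf_coeff_Rminus by blast
qed

lemma Rcoeff_sum: "(\<And>x. x \<in> A \<Longrightarrow> f x \<in> Rcoeff) \<Longrightarrow> sum f A \<in> Rcoeff"
proof (induction A rule: infinite_finite_induct)
  case (insert x A)
  have "k + l \<in> Rcoeff" if "k \<in> Rcoeff" "l \<in> Rcoeff" for k l
    unfolding Rcoeff_def
  proof (intro CollectI allI impI)
    fix j i assume "fls_nth (Poly_Mapping.lookup (k + l) j) i \<noteq> 0"
    then have "fls_nth (Poly_Mapping.lookup k j) i \<noteq> 0 \<or> fls_nth (Poly_Mapping.lookup l j) i \<noteq> 0"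
      by (auto simp: lookup_add)
    then show "0 \<le> i \<and> even i" using that by (auto simp: Rcoeff_def)
  qed
  then show ?case using insert by simp
qed (auto simp: Rcoeff_def)

lemma mu_qpoch_over: "mu \<Gamma> vs fs cs (qpoch \<Gamma> cs (cycle_poly \<Gamma> 1 1)) \<in> qseries_over Rcoeff Z"
proof -
  let ?c = "graded 1 (inf_coeff pos_rot)"
  let ?W = "\<lambda>m. {w. set w \<subseteq> set cs \<and> z.weight w = m}"
  have R: "?c w \<in> Rcoeff" for w using graded_inf_coeff_Rminus by (simp add: Rminus_def)
  have mid_edge: "mset (z.word w) = z.weight w" for w
  proof -
    have "set_mset (zexponent \<Gamma> \<gamma>) \<subseteq> set (vars Z)" for \<gamma>
      unfolding zexponent_def set_vars_Z by (auto simp: set_mset_sum split: if_splits)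
    then have "set_mset (z.weight w) \<subseteq> set (vars Z)" by (induction w) auto
    then show ?thesis unfolding z.mset_word by (auto simp: multiset_eq_iff not_in_iff)
  qed
  \<comment> \<open>Several words of cycles may spell the same word in the half-edge variables;
    their coefficients are added.\<close>
  define d where "d u = (\<Sum>w | set w \<subseteq> set cs \<and> z.weight w = mset u \<and> z.word w = u. ?c w)" for u
  have e: "z.wsum ?c m = (\<Sum>u | set u \<subseteq> set (vars Z) \<and> mset u = m. d u * aq 0 (reorder Z u))" for m
  proof -
    have fin: "finite {u. set u \<subseteq> set (vars Z) \<and> mset u = m}"
      by (rule finite_subset[OF _ finite_lists_length_eq[of "set (vars Z)" "size m"]]) auto
    have "z.wsum ?c m = (\<Sum>u | set u \<subseteq> set (vars Z) \<and> mset u = m.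
        \<Sum>w | w \<in> ?W m \<and> z.word w = u. ?c w * aq 0 (reorder Z (z.word w)))"
      unfolding z.wsum_def
    proof (rule sum.group[symmetric, OF z.finite_words fin])
      have "set (z.word w) \<subseteq> set (vars Z)" for w
      proof -
        have "set_mset (mset (z.word w)) \<subseteq> set (vars Z)" unfolding z.mset_word by auto
        then show ?thesis by simp
      qed
      then show "z.word ` ?W m \<subseteq> {u. set u \<subseteq> set (vars Z) \<and> mset u = m}"
        using mid_edge by auto
    qed
    also have "\<dots> = (\<Sum>u | set u \<subseteq> set (vars Z) \<and> mset u = m. d u * aq 0 (reorder Z u))"
      unfolding d_def sum_distrib_right by (intro sum.cong refl) auto
    finally show ?thesis .
  qed
  have "d u \<in> Rcoeff" for u unfolding d_def using R by (intro Rcoeff_sum)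
  moreover have "fls_nth (Poly_Mapping.lookup (z.wsum ?c m) j) i = 0" if "odd i" for m j i
    unfolding z.wsum_def lookup_sum fls_nth_sum
  proof (intro sum.neutral ballI)
    fix w assume "w \<in> ?W m"
    then have "set w \<subseteq> set cs" by simp
    then obtain k where "aq 0 (reorder Z (z.word w)) = Poly_Mapping.single 0 (q4 (2 * k))"
      by (rule aq_reorder_z)
    then show "fls_nth (Poly_Mapping.lookup (?c w * aq 0 (reorder Z (z.word w))) j) i = 0"
      using odd_coeff_0[OF R that] by simp
  qed
  ultimately show ?thesis
    unfolding qseries_over_def qpoch_eq mu_wsum using e by blast
qed

end

theorem theorem1p3:
  fixes \<Gamma> :: "'e moy_graph"
    and vs :: "complex list" and fs :: "'e list" and cs :: "'e set list"
  assumes "moy_graph \<Gamma>" and "positive_moy \<Gamma>"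
    and "distinct vs" and "set vs = verts \<Gamma>"
    and "distinct fs" and "set fs = circles \<Gamma>"
    and "distinct cs" and "set cs = cycles \<Gamma> - {{}}"
  shows
    "qmult (zvars \<Gamma> vs fs) (F_series \<Gamma>) (mu \<Gamma> vs fs cs (qpoch \<Gamma> cs (cycle_poly \<Gamma> 1 (-1))))
       = mu \<Gamma> vs fs cs (qpoch \<Gamma> cs (cycle_poly \<Gamma> 1 1))
     \<and> (\<lambda>m. shift_a (F_series \<Gamma> m))
       = qmult (zvars \<Gamma> vs fs)
           (qmult (zvars \<Gamma> vs fs) (mu \<Gamma> vs fs cs (cycle_poly \<Gamma> (-1) 1)) (F_series \<Gamma>))
           (mu \<Gamma> vs fs cs (cycle_poly \<Gamma> 1 (-1)))
     \<and> (\<forall>\<delta> \<in> {1, -1}. qseries_tendsto (partial_qpoch \<Gamma> cs (cycle_poly \<Gamma> 1 \<delta>))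
                                        (qpoch \<Gamma> cs (cycle_poly \<Gamma> 1 \<delta>)))
     \<and> qpoch \<Gamma> cs (cycle_poly \<Gamma> 1 1) \<in> qseries_over Rminus (xvars \<Gamma> cs)
     \<and> mu \<Gamma> vs fs cs (qpoch \<Gamma> cs (cycle_poly \<Gamma> 1 1)) \<in> qseries_over Rcoeff (zvars \<Gamma> vs fs)"
proof -
  interpret positive_graph \<Gamma> vs fs cs
    using assms by unfold_locales
  show ?thesis
    using first_identity second_identity partial_qpoch_tendsto qpoch_over mu_qpoch_over
    by (simp add: qpoch_eq)
qed

end
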